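(* Let $d\in\{1,2,\dots\}$. (a) For any $\nu>0$ and $Q\in\mathcal{U}_{d,\nu+d}$, the map $$A\mapsto Qh(A)=\tfrac12\log\det A+\int\big(\rho_{\nu,d}(y'A^{-1}y)-\rho_{\nu,d}(y'y)\big)\,dQ(y),\qquad A\in\mathcal{P}_d,$$ has a unique critical point $A(\nu):=A_\nu(Q)\in\mathcal{P}_d$, which is an absolute minimum. In parts (b) through (f) let $\nu>1$, let $P$ be a Borel probability measure on $\mathbb{R}^d$, let $Q=P\circ T_1^{-1}$ on $\mathbb{R}^{d+1}$, where $T_1(y)=(y',1)'$, and let $\nu'=\nu-1$. In parts (b) through (e) assume $P\in\mathcal{V}_{d,\nu+d}$, and let $A(\nu')=A_{\nu'}(Q)\in\mathcal{P}_{d+1}$ be as in part (a) with $(d+1,\nu')$ in place of $(d,\nu)$ (in which case $Q\in\mathcal{U}_{d+1,\nu+d}$). (b) $A(\nu')_{d+1,d+1}=\int u_{\nu',d+1}(z'A(\nu')^{-1}z)\,dQ(z)=1$. (c) For any $\mu\in\mathbb{R}^d$ and $\Sigma\in\mathcal{P}_d$ let $A=A(\Sigma,\mu,1)\in\mathcal{P}_{d+1}$. Then for any $y\in\mathbb{R}^d$ and $z:=(y',1)'$, $$u_{\nu',d+1}(z'A^{-1}z)=u_{\nu,d}\big((y-\mu)'\Sigma^{-1}(y-\mu)\big).$$ In particular, this holds for $A=A(\nu')$ and the corresponding $\mu=\mu_\nu\in\mathbb{R}^d$ and $\Sigma=\Sigma_\nu\in\mathcal{P}_d$, i.e. those with $A(\nu')=A(\Sigma_\nu,\mu_\nu,1)$.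 (d) $\int u_{\nu,d}\big((y-\mu_\nu)'\Sigma_\nu^{-1}(y-\mu_\nu)\big)\,dP(y)=1$. (e) For $h=h_{\nu,d}$, the pair $(\mu_\nu,\Sigma_\nu)$ is an M-functional for $P$. (f) If, on the other hand, $P\notin\mathcal{V}_{d,\nu+d}$, then $(\mu,\Sigma)\mapsto Ph_{\nu,d}(\mu,\Sigma)$ has no critical points on $\mathbb{R}^d\times\mathcal{P}_d$.
   Context: $\mathcal{P}_d$ is the set of symmetric strictly positive definite real $d\times d$ matrices. Vectors are columns, $'$ is transpose. For $\nu>0$ and $s\ge0$, $$\rho_{\nu,d}(s)=\frac{\nu+d}{2}\log\Big(\frac{\nu+s}{\nu}\Big),\qquad u_{\nu,d}(s)=2\rho_{\nu,d}'(s)=\frac{\nu+d}{\nu+s}.$$ For $a>0$, $\mathcal{U}_{d,a}$ is the set of Borel probability measures $Q$ on $\mathbb{R}^d$ such that $Q(H)<1-(d-q)/a$ for every linear subspace $H$ of dimension $q$, $0\le q\le d-1$; $\mathcal{V}_{d,a}$ is the set of Borel probability measures $P$ on $\mathbb{R}^d$ such that $P(J)<1-(d-q)/a$ for every affine subspace $J$ of $\mathbb{R}^d$ of dimension $q$, $0\le q\le d-1$. For $\Sigma\in\mathcal{P}_d$, $\mu\in\mathbb{R}^d$, $\gamma>0$, $$A(\Sigma,\mu,\gamma)=\gamma\begin{bmatrix}\Sigma+\mu\mu'&\mu\\ \mu'&1\end{bmatrix}\in\mathcal{P}_{d+1};$$ this is a bijection from such triples onto $\mathcal{P}_{d+1}$.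 The location-scatter function is $h_{\nu,d}(y,(\mu,\Sigma))=\rho(y,(\mu,\Sigma))-\rho(y,(0,I))$, with $\rho(y,(\mu,\Sigma))=\tfrac12\log\det\Sigma+\rho_{\nu,d}\big((y-\mu)'\Sigma^{-1}(y-\mu)\big)$, and $Ph_{\nu,d}(\mu,\Sigma)=\int h_{\nu,d}(y,(\mu,\Sigma))\,dP(y)$. That $(\mu_\nu,\Sigma_\nu)$ is an M-functional for $P$ means that $Ph_{\nu,d}$ is defined with $-\infty<Ph_{\nu,d}\le+\infty$ on $\mathbb{R}^d\times\mathcal{P}_d$ and is minimized over $\mathbb{R}^d\times\mathcal{P}_d$ uniquely at $(\mu_\nu,\Sigma_\nu)$. A critical point is a point where the gradient is zero. *)

theory Defs
  imports "HOL-Probability.Probability"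
begin

definition \<rho> :: "real \<Rightarrow> nat \<Rightarrow> real \<Rightarrow> real" where
  "\<rho> \<nu> d s = (\<nu> + real d) / 2 * ln ((\<nu> + s) / \<nu>)"

definition u :: "real \<Rightarrow> nat \<Rightarrow> real \<Rightarrow> real" where
  "u \<nu> d s = (\<nu> + real d) / (\<nu> + s)"

lemma u_eq_twice_deriv_\<rho>:
  assumes "\<nu> > 0" "s \<ge> 0"
  shows "u \<nu> d s = 2 * deriv (\<rho> \<nu> d) s"
proof -
  have "(\<rho> \<nu> d has_field_derivative u \<nu> d s / 2) (at s)"
    unfolding \<rho>_def [abs_def] u_def using assms
    by (auto intro!: derivative_eq_intros simp: divide_simps) (simp add: algebra_simps)
  then have "deriv (\<rho> \<nu> d) s = u \<nu> d s / 2"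
    by (rule DERIV_imp_deriv)
  then show ?thesis by simp
qed

definition borel_prob :: "'a::topological_space measure \<Rightarrow> bool" where
  "borel_prob P \<longleftrightarrow> prob_space P \<and> sets P = sets borel"

definition \<U> :: "real \<Rightarrow> 'a::euclidean_space measure set" where
  "\<U> a = {Q. borel_prob Q \<and>
     (\<forall>H. subspace H \<and> dim H < DIM('a) \<longrightarrow>
        measure Q H < 1 - (real DIM('a) - real (dim H)) / a)}"

definition \<V> :: "real \<Rightarrow> 'a::euclidean_space measure set" where
  "\<V> a = {P. borel_prob P \<and>
     (\<forall>J q. affine J \<and> aff_dim J = int q \<and> q < DIM('a) \<longrightarrow>
        measure P J < 1 - (real DIM('a) - real q) / a)}"

definition pd :: "(real^'n^'n) set" where
  "pd = {A. transpose A = A \<and> (\<forall>x. x \<noteq> 0 \<longrightarrow> x \<bullet> (A *v x) > 0)}"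

definition inv_form :: "real^'n^'n \<Rightarrow> real^'n \<Rightarrow> real" where
  "inv_form A y = y \<bullet> (matrix_inv A *v y)"

text \<open>
  The gradient of a function on positive definite matrices is taken in the space of
  symmetric matrices, in which \<^term>\<open>pd\<close> is open; it vanishes iff the derivative
  within \<^term>\<open>pd\<close> is zero. The set \<^term>\<open>pd\<close> is not open in the space of all
  square matrices, so \<open>at x\<close> instead of \<open>at x within S\<close> would be a different notion.
\<close>
definition critical_point_on :: "('a::real_normed_vector \<Rightarrow> real) \<Rightarrow> 'a set \<Rightarrow> 'a \<Rightarrow> bool" where
  "critical_point_on f S x \<longleftrightarrow> x \<in> S \<and> (f has_derivative (\<lambda>_. 0)) (at x within S)"

definition Qh :: "real \<Rightarrow> (real^'n) measure \<Rightarrow> real^'n^'n \<Rightarrow> real" where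
  "Qh \<nu> Q A = ln (det A) / 2 +
     (LINT y|Q. \<rho> \<nu> CARD('n) (inv_form A y) - \<rho> \<nu> CARD('n) (y \<bullet> y))"

definition A_crit :: "real \<Rightarrow> (real^'n) measure \<Rightarrow> real^'n^'n" where
  "A_crit \<nu> Q = (THE A. critical_point_on (Qh \<nu> Q) pd A)"

text \<open>
  Dimension \<open>d + 1\<close> is indexed by \<^typ>\<open>'n option\<close>, where \<^term>\<open>None\<close> stands
  for the last coordinate.
\<close>
definition T1 :: "real^'n \<Rightarrow> real^('n option)" where
  "T1 y = (\<chi> i. case i of Some k \<Rightarrow> y $ k | None \<Rightarrow> 1)"

definition A_of :: "real^'n^'n \<Rightarrow> real^'n \<Rightarrow> real \<Rightarrow> real^('n option)^('n option)" where
  "A_of \<Sigma> \<mu> \<gamma> = (\<chi> i j. \<gamma> *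
     (case (i, j) of
        (Some k, Some l) \<Rightarrow> \<Sigma> $ k $ l + \<mu> $ k * \<mu> $ l
      | (Some k, None) \<Rightarrow> \<mu> $ k
      | (None, Some l) \<Rightarrow> \<mu> $ l
      | (None, None) \<Rightarrow> 1))"

definition \<rho>_ls :: "real \<Rightarrow> real^'n \<Rightarrow> (real^'n) \<times> (real^'n^'n) \<Rightarrow> real" where
  "\<rho>_ls \<nu> y \<theta> = ln (det (snd \<theta>)) / 2 + \<rho> \<nu> CARD('n) (inv_form (snd \<theta>) (y - fst \<theta>))"

definition h_ls :: "real \<Rightarrow> real^'n \<Rightarrow> (real^'n) \<times> (real^'n^'n) \<Rightarrow> real" where
  "h_ls \<nu> y \<theta> = \<rho>_ls \<nu> y \<theta> - \<rho>_ls \<nu> y (0, mat 1)"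

text \<open>
  Integrals with values in \<open>(-\<infinity>, \<infinity>]\<close>: the integral of \<open>f\<close> is defined there iff
  its negative part is integrable.
\<close>
definition integral_defined_gt_minf :: "'a measure \<Rightarrow> ('a \<Rightarrow> real) \<Rightarrow> bool" where
  "integral_defined_gt_minf M f \<longleftrightarrow>
     f \<in> borel_measurable M \<and> (\<integral>\<^sup>+x. ennreal (- f x) \<partial>M) < \<infinity>"

definition ext_integral :: "'a measure \<Rightarrow> ('a \<Rightarrow> real) \<Rightarrow> ereal" where
  "ext_integral M f =
     enn2ereal (\<integral>\<^sup>+x. ennreal (f x) \<partial>M) - enn2ereal (\<integral>\<^sup>+x. ennreal (- f x) \<partial>M)"

lemma ext_integral_eq_lebesgue_integral:
  assumes "integrable M f"
  shows "ext_integral M f = ereal (integral\<^sup>L M f)"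
proof -
  have fin: "(\<integral>\<^sup>+x. ennreal (f x) \<partial>M) \<noteq> \<infinity>" "(\<integral>\<^sup>+x. ennreal (- f x) \<partial>M) \<noteq> \<infinity>"
    using assms unfolding real_integrable_def by auto
  then obtain a b where ab: "(\<integral>\<^sup>+x. ennreal (f x) \<partial>M) = ennreal a" "0 \<le> a"
    "(\<integral>\<^sup>+x. ennreal (- f x) \<partial>M) = ennreal b" "0 \<le> b"
    by (metis ennreal_cases infinity_ennreal_def)
  then show ?thesis
    unfolding ext_integral_def real_lebesgue_integral_def [OF assms]
    by (simp add: enn2ereal_ennreal)
qed

definition M_functional :: "real \<Rightarrow> (real^'n) measure \<Rightarrow> (real^'n) \<times> (real^'n^'n) \<Rightarrow> bool" where
  "M_functional \<nu> P \<theta>\<^sub>0 \<longleftrightarrow>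
     \<theta>\<^sub>0 \<in> UNIV \<times> pd \<and>
     (\<forall>\<theta> \<in> UNIV \<times> pd. integral_defined_gt_minf P (\<lambda>y. h_ls \<nu> y \<theta>)) \<and>
     (\<forall>\<theta> \<in> UNIV \<times> pd. \<theta> \<noteq> \<theta>\<^sub>0 \<longrightarrow>
        ext_integral P (\<lambda>y. h_ls \<nu> y \<theta>\<^sub>0) < ext_integral P (\<lambda>y. h_ls \<nu> y \<theta>))"

end

theory Submission
  imports Defs
begin

text \<open>
  Write \<open>a = \<nu> + d\<close> and \<open>s\<^sub>A(y) = y' A\<^sup>-\<^sup>1 y\<close>. The whole theorem is about one matrix equation,
  \<open>A = \<integral> u(s\<^sub>A(y)) y y' dQ(y)\<close>, called \<open>scatter_eq\<close> below: it characterizes the critical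
  points of \<open>Qh\<close>, its solutions are strict absolute minima, and it is solvable exactly when \<open>Q\<close>
  satisfies the subspace condition that defines \<open>\<U>\<close>.

  \<^bold>\<open>Minimum.\<close> Given \<open>A\<close> and \<open>B\<close> in \<open>pd\<close>, simultaneous diagonalization gives vectors \<open>w\<^sub>i\<close> with
  \<open>s\<^sub>A(y) = \<Sum> (w\<^sub>i' y)\<^sup>2\<close>, \<open>s\<^sub>B(y) = \<Sum> (w\<^sub>i' y)\<^sup>2 / b\<^sub>i\<close> and \<open>det B = det A \<Prod> b\<^sub>i\<close>. Concavity of the
  logarithm bounds the logarithm of the weighted mean \<open>(\<nu> + s\<^sub>B) / (\<nu> + s\<^sub>A)\<close> of \<open>1\<close> and the
  \<open>1 / b\<^sub>i\<close> from below by the mean of the logarithms. Integrated against \<open>Q\<close>, and with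
  \<open>\<integral> u(s\<^sub>A) (w\<^sub>i' y)\<^sup>2 dQ = 1\<close> from the equation, the linear terms cancel against the determinants,
  and \<open>Qh B \<ge> Qh A\<close> remains; the inequality is strict if \<open>B \<noteq> A\<close> and \<open>Q\<close> does not live on a
  hyperplane (\<open>scatter_eq_imp_min\<close>). This also gives uniqueness. It is the geodesic convexity of
  \<open>Qh\<close>, used only at a critical point.

  \<^bold>\<open>Critical points.\<close> The inequality \<open>ln x \<le> x - 1\<close> gives an upper bound of \<open>Qh B - Qh A\<close> that
  is explicit in \<open>B\<close> and touches at \<open>B = A\<close> (\<open>Qh_diff_le_linearized\<close>). If \<open>A\<close> is critical, then
  the derivative of this bound along every curve through \<open>A\<close> vanishes, and rank one
  perturbations yield the equation. Conversely, for a solution of the equation the bound is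
  quadratic in \<open>B - A\<close> and the lower bound is \<open>0\<close>, hence the derivative exists and is zero. No
  differentiation of matrix functions is involved.

  \<^bold>\<open>Existence.\<close> The right-hand side of the equation is increasing in \<open>A\<close> for the order of
  quadratic forms. Started at a large multiple of the identity, the iteration decreases and so
  has a positive semidefinite limit \<open>L\<close>. If \<open>L\<close> is invertible, it solves the equation. If \<open>L\<close> is
  singular with range \<open>H\<close> of dimension \<open>q\<close>, a comparison of traces shows
  \<open>d - q \<ge> a Q(H\<^sup>c)\<close>, since \<open>u(s) s\<close> tends to \<open>a\<close> off \<open>H\<close> along the iteration; this contradicts
  \<open>Q \<in> \<U>\<close> (\<open>limit_pd\<close>). Conversely a solution forces \<open>Q \<in> \<U>\<close>, by taking the trace of the
  equation over the annihilator of a subspace (\<open>scatter_eq_imp_\<U>\<close>).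

  \<^bold>\<open>Location and scatter.\<close> For \<open>A = A_of \<Sigma> \<mu> 1\<close> and \<open>z = (y', 1)'\<close> one has
  \<open>s\<^sub>A(z) = 1 + (y - \<mu>)' \<Sigma>\<^sup>-\<^sup>1 (y - \<mu>)\<close> and \<open>det A = det \<Sigma>\<close>, so that the location-scatter
  functional is the restriction of \<open>Qh\<close> in dimension \<open>d + 1\<close> to these matrices. The trace of the
  equation gives \<open>\<integral> u dQ = 1\<close>, which is the last diagonal entry of the solution; hence the
  unrestricted minimum lies among the matrices \<open>A_of \<Sigma> \<mu> 1\<close>. A critical point of the restricted
  functional gives the location equation and the scatter equation, whose trace supplies the
  missing \<open>\<integral> u = 1\<close>; together they form the full equation, and the mass condition follows.
\<close>

section \<open>Simultaneous diagonalization of quadratic forms\<close>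

lemma dot_symmetric_matrix:
  fixes A :: "real^'n^'n"
  assumes "transpose A = A"
  shows "(A *v x) \<bullet> y = x \<bullet> (A *v y)"
  by (metis assms dot_lmul_matrix vector_transpose_matrix)

lemma pd_symmetric: "A \<in> pd \<Longrightarrow> transpose A = A"
  and pd_pos: "A \<in> pd \<Longrightarrow> x \<noteq> 0 \<Longrightarrow> 0 < x \<bullet> (A *v x)"
  by (auto simp: pd_def)

lemma pd_nonneg: "A \<in> pd \<Longrightarrow> 0 \<le> x \<bullet> (A *v x)"
  by (cases "x = 0") (auto simp: less_imp_le pd_pos)

lemma mat_1_pd: "(mat 1 :: real^'n^'n) \<in> pd"
  by (simp add: pd_def)

definition orthonormal_wrt :: "real^'n^'n \<Rightarrow> ('n \<Rightarrow> real^'n) \<Rightarrow> bool" where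
  "orthonormal_wrt A w \<longleftrightarrow> (\<forall>i j. w i \<bullet> (A *v w j) = (if i = j then 1 else 0))"

text \<open>
  A new vector is found by maximizing the quotient \<open>x' B x / x' A x\<close> over the \<open>A\<close>-orthogonal
  complement \<open>S\<close> of the given vectors. At a maximizer \<open>v\<close> with value \<open>\<beta>\<close> the form \<open>\<beta> A - B\<close> is
  nonnegative on \<open>S\<close> and zero at \<open>v\<close>, so \<open>\<beta> A v - B v\<close> is orthogonal to \<open>S\<close>; it is orthogonal to
  the given vectors because they are eigenvectors of the pencil.
\<close>

lemma pencil_extend_step:
  fixes A B :: "real^'n^'n" and I :: "'n set"
  assumes A: "A \<in> pd" and B: "transpose B = B"
    and on: "\<And>i j. i \<in> I \<Longrightarrow> j \<in> I \<Longrightarrow> w i \<bullet> (A *v w j) = (if i = j then 1 else 0)"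
    and ev: "\<And>i. i \<in> I \<Longrightarrow> B *v w i = b i *\<^sub>R (A *v w i)"
    and k: "k \<notin> I"
  shows "\<exists>v \<beta>. v \<bullet> (A *v v) = 1 \<and> (\<forall>i\<in>I. v \<bullet> (A *v w i) = 0) \<and> B *v v = \<beta> *\<^sub>R (A *v v)"
proof -
  define S where "S = {x. \<forall>i\<in>I. x \<bullet> (A *v w i) = 0}"
  have subS: "subspace S"
    unfolding S_def subspace_def by (auto simp: inner_add_left)
  have symA: "transpose A = A" using A by (rule pd_symmetric)
  have "dim (span ((\<lambda>i. A *v w i) ` I)) \<le> card ((\<lambda>i. A *v w i) ` I)"
    unfolding dim_span by (rule dim_le_card') simp
  also have "\<dots> \<le> card I" by (rule card_image_le) simp
  also have "\<dots> < CARD('n)" using k by (intro psubset_card_mono) auto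
  finally have "dim ((\<lambda>i. A *v w i) ` I) < DIM(real^'n)" by simp
  from orthogonal_to_subspace_exists[OF this]
  obtain x0 :: "real^'n" where x0: "x0 \<noteq> 0"
    and x0o: "\<And>y. y \<in> span ((\<lambda>i. A *v w i) ` I) \<Longrightarrow> orthogonal x0 y" by blast
  have x0S: "x0 \<in> S"
    unfolding S_def using x0o[OF span_base] by (auto simp: orthogonal_def)
  define K where "K = sphere 0 1 \<inter> S"
  have compK: "compact K"
    unfolding K_def using closed_subspace[OF subS] by (intro compact_Int_closed) auto
  have "x0 /\<^sub>R norm x0 \<in> K"
    unfolding K_def using x0 subspace_scale[OF subS x0S] by simp
  then have K0: "K \<noteq> {}" by blast
  define R where "R x = (x \<bullet> (B *v x)) / (x \<bullet> (A *v x))" for x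
  have posK: "x \<bullet> (A *v x) > 0" if "x \<in> K" for x
    using that A pd_pos[of A x] unfolding K_def by fastforce
  have "continuous_on K R"
    unfolding R_def using posK
    by (intro continuous_intros) (auto simp: less_le)
  then obtain v where v: "v \<in> K" and vmax: "\<And>x. x \<in> K \<Longrightarrow> R x \<le> R v"
    using continuous_attains_sup[OF compK K0] by blast
  define \<beta> where "\<beta> = R v"
  define g where "g x = \<beta> * (x \<bullet> (A *v x)) - x \<bullet> (B *v x)" for x
  have g_nonneg: "0 \<le> g x" if "x \<in> S" for x
  proof (cases "x = 0")
    case True then show ?thesis by (simp add: g_def)
  next
    case False
    define y where "y = x /\<^sub>R norm x"
    have yK: "y \<in> K" unfolding K_def y_def using False subspace_scale[OF subS that] by simp
    have xy: "x = norm x *\<^sub>R y" using False by (simp add: y_def)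
    have "g x = (norm x)\<^sup>2 * (\<beta> * (y \<bullet> (A *v y)) - y \<bullet> (B *v y))"
      unfolding g_def by (subst (1 2 3 4) xy)
        (simp add: matrix_vector_mult_scaleR power2_eq_square algebra_simps)
    moreover have "y \<bullet> (B *v y) \<le> \<beta> * (y \<bullet> (A *v y))"
      using vmax[OF yK] posK[OF yK] unfolding \<beta>_def by (subst (asm) R_def) (simp add: divide_le_eq)
    ultimately show ?thesis by simp
  qed
  have gv: "g v = 0"
    using posK[OF v] by (simp add: g_def \<beta>_def R_def)
  have vS: "v \<in> S" using v by (simp add: K_def)
  have symB: "(B *v x) \<bullet> y = x \<bullet> (B *v y)" for x y
    by (rule dot_symmetric_matrix[OF B])
  have symA': "(A *v x) \<bullet> y = x \<bullet> (A *v y)" for x y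
    by (rule dot_symmetric_matrix[OF symA])
  define z where "z = \<beta> *\<^sub>R (A *v v) - B *v v"
  have zS: "x \<bullet> z = 0" if x: "x \<in> S" for x
  proof (rule ccontr)
    assume nz: "x \<bullet> z \<noteq> 0"
    \<comment> \<open>The quadratic polynomial \<open>t \<mapsto> g (v + t x)\<close> is nonnegative with value \<open>0\<close> at \<open>t = 0\<close>.\<close>
    have exp: "g (v + t *\<^sub>R x) = 2 * t * (x \<bullet> z) + t\<^sup>2 * g x" for t
    proof -
      have "v \<bullet> (A *v x) = x \<bullet> (A *v v)" "v \<bullet> (B *v x) = x \<bullet> (B *v v)"
        using symA'[of v x] symB[of v x] by (simp_all add: inner_commute)
      then have "g (v + t *\<^sub>R x) = g v + 2 * t * (x \<bullet> z) + t\<^sup>2 * g x"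
        unfolding g_def z_def
        by (simp add: matrix_vector_mult_scaleR matrix_vector_right_distrib
            inner_simps power2_eq_square algebra_simps)
      then show ?thesis using gv by simp
    qed
    have le: "0 \<le> 2 * t * (x \<bullet> z) + t\<^sup>2 * g x" for t
      using g_nonneg[of "v + t *\<^sub>R x"] exp[of t] subspace_add[OF subS vS subspace_scale[OF subS x]]
      by simp
    define c where "c = g x + 1"
    have c: "c > 0" "g x < c" using g_nonneg[OF x] by (auto simp: c_def)
    have sq: "2 * (- p / c) * p + (- p / c)\<^sup>2 * c = - (p\<^sup>2 / c)" if "c \<noteq> 0" for p c :: real
    proof -
      have "(- p / c)\<^sup>2 * c = p * p / c" using that by (simp add: power2_eq_square)
      then show ?thesis by (simp add: power2_eq_square)
    qed
    have "0 \<le> 2 * (- (x \<bullet> z) / c) * (x \<bullet> z) + (- (x \<bullet> z) / c)\<^sup>2 * g x" by (rule le)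
    also have "\<dots> \<le> 2 * (- (x \<bullet> z) / c) * (x \<bullet> z) + (- (x \<bullet> z) / c)\<^sup>2 * c"
      using c by (intro add_left_mono mult_left_mono) auto
    also have "\<dots> = - ((x \<bullet> z)\<^sup>2 / c)"
      by (rule sq) (use c in simp)
    finally have "(x \<bullet> z)\<^sup>2 / c \<le> 0" by simp
    moreover have "(x \<bullet> z)\<^sup>2 / c > 0" using c nz by simp
    ultimately show False by simp
  qed
  have zw: "w i \<bullet> z = 0" if "i \<in> I" for i
  proof -
    have vw: "v \<bullet> (A *v w i) = 0" using vS that by (simp add: S_def)
    have "w i \<bullet> (A *v v) = 0" using symA'[of "w i" v] vw by (simp add: inner_commute)
    moreover have "w i \<bullet> (B *v v) = 0"
      using symB[of "w i" v] ev[OF that] vw by (simp add: inner_commute)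
    ultimately show ?thesis by (simp add: z_def inner_simps)
  qed
  have "x \<bullet> z = 0" for x
  proof -
    define p where "p = (\<Sum>i\<in>I. (x \<bullet> (A *v w i)) *\<^sub>R w i)"
    have "x - p \<in> S"
    proof -
      have "p \<bullet> (A *v w j) = x \<bullet> (A *v w j)" if "j \<in> I" for j
      proof -
        have "p \<bullet> (A *v w j) = (\<Sum>i\<in>I. (x \<bullet> (A *v w i)) * (if i = j then 1 else 0))"
          unfolding p_def inner_sum_left by (intro sum.cong refl) (simp add: on that)
        also have "\<dots> = (\<Sum>i\<in>I. if i = j then x \<bullet> (A *v w i) else 0)"
          by (intro sum.cong refl) auto
        also have "\<dots> = x \<bullet> (A *v w j)" using that by simp
        finally show ?thesis .
      qed
      then show ?thesis by (simp add: S_def inner_simps)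
    qed
    then have "(x - p) \<bullet> z = 0" by (rule zS)
    moreover have "p \<bullet> z = 0"
      unfolding p_def inner_sum_left using zw by (intro sum.neutral) simp
    ultimately show ?thesis by (simp add: inner_simps)
  qed
  then have "z = 0" using inner_eq_zero_iff by blast
  then have Bv: "B *v v = \<beta> *\<^sub>R (A *v v)" by (simp add: z_def)
  define c where "c = v \<bullet> (A *v v)"
  have c: "c > 0" using posK[OF v] by (simp add: c_def)
  define v' where "v' = v /\<^sub>R sqrt c"
  have "v' \<bullet> (A *v v') = c / (sqrt c * sqrt c)"
    by (simp add: v'_def matrix_vector_mult_scaleR c_def[symmetric] field_simps)
  then have "v' \<bullet> (A *v v') = 1" using c by simp
  moreover have "\<forall>i\<in>I. v' \<bullet> (A *v w i) = 0" using vS by (simp add: v'_def S_def)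
  moreover have "B *v v' = \<beta> *\<^sub>R (A *v v')"
    by (simp add: v'_def matrix_vector_mult_scaleR Bv)
  ultimately show ?thesis by blast
qed

text \<open>
  Extending a given family, and not only producing one, allows a prescribed vector to be a
  member; \<open>rank_one_update\<close> relies on this.
\<close>

lemma pencil_extend:
  fixes A B :: "real^'n^'n" and I :: "'n set"
  assumes A: "A \<in> pd" and B: "transpose B = B"
    and on: "\<forall>i\<in>I. \<forall>j\<in>I. w i \<bullet> (A *v w j) = (if i = j then 1 else 0)"
    and ev: "\<forall>i\<in>I. B *v w i = b i *\<^sub>R (A *v w i)"
  shows "\<exists>w' b'. orthonormal_wrt A w' \<and> (\<forall>i. B *v w' i = b' i *\<^sub>R (A *v w' i)) \<and>
    (\<forall>i\<in>I. w' i = w i \<and> b' i = b i)"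
  using on ev
proof (induction "card (- I)" arbitrary: I w b)
  case 0
  then have "- I = {}" by simp
  then have "I = UNIV" by blast
  with 0 show ?case unfolding orthonormal_wrt_def by blast
next
  case (Suc m)
  then obtain k where k: "k \<notin> I" by (metis ComplD card.empty ex_in_conv nat.distinct(1))
  obtain v \<beta> where v: "v \<bullet> (A *v v) = 1" "\<forall>i\<in>I. v \<bullet> (A *v w i) = 0" "B *v v = \<beta> *\<^sub>R (A *v v)"
    using pencil_extend_step[OF A B _ _ k, of w b] Suc.prems by metis
  have vI: "\<forall>i\<in>I. w i \<bullet> (A *v v) = 0"
    using v(2) dot_symmetric_matrix[OF pd_symmetric[OF A]] by (metis inner_commute)
  have "- insert k I = (- I) - {k}" by auto
  then have "m = card (- insert k I)" using Suc.hyps(2) k by simp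
  moreover have "\<forall>i\<in>insert k I. \<forall>j\<in>insert k I.
      (w(k := v)) i \<bullet> (A *v (w(k := v)) j) = (if i = j then 1 else 0)"
    using Suc.prems(1) v vI k by auto
  moreover have "\<forall>i\<in>insert k I. B *v (w(k := v)) i = (b(k := \<beta>)) i *\<^sub>R (A *v (w(k := v)) i)"
    using Suc.prems(2) v k by auto
  ultimately obtain w' b' where "orthonormal_wrt A w'" "\<forall>i. B *v w' i = b' i *\<^sub>R (A *v w' i)"
    and ext: "\<forall>i\<in>insert k I. w' i = (w(k := v)) i \<and> b' i = (b(k := \<beta>)) i"
    using Suc.hyps(1)[of "insert k I" "w(k := v)" "b(k := \<beta>)"] by blast
  moreover have "\<forall>i\<in>I. w' i = w i \<and> b' i = b i" using ext k by auto
  ultimately show ?case by blast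
qed

lemma simultaneous_diagonalization:
  fixes A B :: "real^'n^'n"
  assumes "A \<in> pd" "transpose B = B"
  obtains w b where "orthonormal_wrt A w" "\<And>i. B *v w i = b i *\<^sub>R (A *v w i)"
  using pencil_extend[OF assms, of "{}"] by auto

lemma orthonormal_wrt_exists:
  fixes A :: "real^'n^'n"
  assumes "A \<in> pd"
  obtains w where "orthonormal_wrt A w"
  using simultaneous_diagonalization[OF assms pd_symmetric[OF assms]] by blast

lemma row_congruence_entry:
  "((\<chi> i. w i) ** A ** transpose (\<chi> i. w i)) $ i $ j = w i \<bullet> (A *v w j)"
proof -
  have "((\<chi> i. w i) ** (A ** transpose (\<chi> i. w i))) $ i $ j
      = (\<Sum>k\<in>UNIV. \<Sum>l\<in>UNIV. w i $ k * (A $ k $ l * w j $ l))"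
    by (simp add: matrix_matrix_mult_def transpose_def sum_distrib_left)
  also have "\<dots> = w i \<bullet> (A *v w j)"
    by (simp add: inner_vec_def matrix_vector_mult_def sum_distrib_left)
  finally show ?thesis by (simp add: matrix_mul_assoc)
qed

lemma orthonormal_wrt_congruence:
  assumes "orthonormal_wrt A w"
  shows "(\<chi> i. w i) ** A ** transpose (\<chi> i. w i) = mat 1"
  using assms by (simp add: vec_eq_iff row_congruence_entry orthonormal_wrt_def mat_def)

text \<open>
  If \<open>W\<close> has the rows \<open>w\<^sub>i\<close>, then \<open>W A W' = I\<close>, and hence \<open>A\<^sup>-\<^sup>1 = W' W\<close>.
\<close>

lemma orthonormal_wrt_matrix_inv:
  fixes A :: "real^'n^'n"
  assumes "orthonormal_wrt A w"
  shows "A ** (transpose (\<chi> i. w i) ** (\<chi> i. w i)) = mat 1"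
    and "matrix_inv A = transpose (\<chi> i. w i) ** (\<chi> i. w i)"
proof -
  let ?W = "(\<chi> i. w i) :: real^'n^'n"
  have "?W ** (A ** transpose ?W) = mat 1"
    using orthonormal_wrt_congruence[OF assms] by (simp add: matrix_mul_assoc)
  then have "(A ** transpose ?W) ** ?W = mat 1" by (rule iffD1[OF matrix_left_right_inverse])
  then show *: "A ** (transpose ?W ** ?W) = mat 1" by (simp add: matrix_mul_assoc)
  then have **: "(transpose ?W ** ?W) ** A = mat 1" by (rule iffD1[OF matrix_left_right_inverse])
  have "A ** matrix_inv A = mat 1 \<and> matrix_inv A ** A = mat 1"
    unfolding matrix_inv_def by (rule someI[where x="transpose ?W ** ?W"]) (use * ** in blast)
  then show "matrix_inv A = transpose ?W ** ?W"
    by (metis "**" matrix_mul_assoc matrix_mul_lid matrix_mul_rid)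
qed

lemma norm_row_matrix:
  fixes w :: "'b::finite \<Rightarrow> real^'n"
  shows "(norm ((\<chi> i. w i) *v y))\<^sup>2 = (\<Sum>i\<in>UNIV. (w i \<bullet> y)\<^sup>2)"
proof -
  have "((\<chi> i. w i) *v y) $ i = w i \<bullet> y" for i :: 'b
    by (simp add: matrix_vector_mult_def inner_vec_def)
  then show ?thesis
    unfolding power2_norm_eq_inner by (subst inner_vec_def) (simp add: power2_eq_square)
qed

lemma inv_form_orthonormal_wrt:
  fixes A :: "real^'n^'n"
  assumes "orthonormal_wrt A w"
  shows "inv_form A y = (\<Sum>i\<in>UNIV. (w i \<bullet> y)\<^sup>2)"
proof -
  let ?W = "(\<chi> i. w i) :: real^'n^'n"
  have "inv_form A y = y \<bullet> (transpose ?W *v (?W *v y))"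
    by (simp add: inv_form_def orthonormal_wrt_matrix_inv(2)[OF assms] matrix_vector_mul_assoc)
  also have "\<dots> = (?W *v y) \<bullet> (?W *v y)"
    by (metis dot_lmul_matrix vector_transpose_matrix transpose_transpose)
  finally show ?thesis by (simp add: norm_row_matrix[symmetric] power2_norm_eq_inner)
qed

lemma inv_form_diagonalized:
  fixes A B :: "real^'n^'n"
  assumes w: "orthonormal_wrt A w" and b: "\<And>i. B *v w i = b i *\<^sub>R (A *v w i)" and pos: "\<And>i. b i > 0"
  shows "inv_form B y = (\<Sum>i\<in>UNIV. (w i \<bullet> y)\<^sup>2 / b i)"
proof -
  have "orthonormal_wrt B (\<lambda>i. w i /\<^sub>R sqrt (b i))"
    using w pos pos[THEN less_imp_neq] unfolding orthonormal_wrt_def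
    by (auto simp: matrix_vector_mult_scaleR b less_imp_le field_simps)
  from inv_form_orthonormal_wrt[OF this, of y] show ?thesis
    using pos by (simp add: power_mult_distrib power_divide less_imp_le field_simps)
qed

lemma det_diagonalized:
  fixes A B :: "real^'n^'n"
  assumes w: "orthonormal_wrt A w" and b: "\<And>i. B *v w i = b i *\<^sub>R (A *v w i)"
  shows "det B = det A * (\<Prod>i\<in>UNIV. b i)"
proof -
  let ?W = "(\<chi> i. w i) :: real^'n^'n"
  have A1: "det ?W * det A * det ?W = 1"
    using arg_cong[OF orthonormal_wrt_congruence[OF w], of det] by (simp add: det_mul)
  have e: "(?W ** B ** transpose ?W) $ i $ j = (if i = j then b i else 0)" for i j
    using w by (simp add: row_congruence_entry b orthonormal_wrt_def)
  have "det (?W ** B ** transpose ?W) = (\<Prod>i\<in>UNIV. b i)"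
    by (subst det_diagonal) (auto simp: e)
  then have B1: "det ?W * det B * det ?W = (\<Prod>i\<in>UNIV. b i)" by (simp add: det_mul)
  have "det B = det B * (det ?W * det A * det ?W)" using A1 by simp
  also have "\<dots> = det A * (det ?W * det B * det ?W)" by (simp add: algebra_simps)
  finally show ?thesis using B1 by simp
qed

lemma matrix_eq_on_orthonormal_wrt:
  fixes A B C :: "real^'n^'n"
  assumes w: "orthonormal_wrt A w" and "\<And>i. B *v w i = C *v w i"
  shows "B = C"
proof -
  let ?W = "(\<chi> i. w i) :: real^'n^'n"
  have "(transpose ?W ** ?W) ** A = mat 1"
    using orthonormal_wrt_matrix_inv(1)[OF w] by (rule iffD1[OF matrix_left_right_inverse])
  then have inv: "transpose ?W ** (?W ** A) = mat 1" by (simp add: matrix_mul_assoc)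
  have col: "(M ** transpose ?W) $ i $ j = (M *v w j) $ i" for M :: "real^'n^'n" and i j
    by (simp add: matrix_matrix_mult_def matrix_vector_mult_def transpose_def)
  have "B ** transpose ?W = C ** transpose ?W"
    by (simp add: vec_eq_iff col assms(2))
  then have "B ** (transpose ?W ** (?W ** A)) = C ** (transpose ?W ** (?W ** A))"
    by (metis matrix_mul_assoc)
  then show ?thesis by (simp add: inv)
qed

lemma pd_diagonalized_pos:
  assumes A: "A \<in> pd" and B: "B \<in> pd" and w: "orthonormal_wrt A w" and b: "B *v w i = b *\<^sub>R (A *v w i)"
  shows "b > 0"
proof -
  have "w i \<noteq> 0" using w unfolding orthonormal_wrt_def by (metis inner_zero_left zero_neq_one)
  from pd_pos[OF B this] w show ?thesis by (simp add: b orthonormal_wrt_def)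
qed

lemma det_pd_pos:
  fixes A :: "real^'n^'n"
  assumes A: "A \<in> pd" shows "0 < det A"
proof -
  obtain w b where w: "orthonormal_wrt (mat 1) w" and b: "\<And>i. A *v w i = b i *\<^sub>R (mat 1 *v w i)"
    using simultaneous_diagonalization[OF mat_1_pd pd_symmetric[OF A]] by blast
  have "b i > 0" for i by (rule pd_diagonalized_pos[OF mat_1_pd A w b])
  then show ?thesis using det_diagonalized[OF w b] by (simp add: prod_pos)
qed


section \<open>The inverse form and the weights\<close>

lemma matrix_inv_pd:
  fixes A :: "real^'n^'n"
  assumes "A \<in> pd"
  shows "A *v (matrix_inv A *v y) = y" "matrix_inv A *v (A *v y) = y"
proof -
  obtain w where w: "orthonormal_wrt A w" using orthonormal_wrt_exists[OF assms] .
  have 1: "A ** matrix_inv A = mat 1"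
    using orthonormal_wrt_matrix_inv[OF w] by simp
  then have 2: "matrix_inv A ** A = mat 1" by (rule iffD1[OF matrix_left_right_inverse])
  show "A *v (matrix_inv A *v y) = y" "matrix_inv A *v (A *v y) = y"
    by (simp_all add: matrix_vector_mul_assoc 1 2)
qed

lemma inv_form_eqI: "A \<in> pd \<Longrightarrow> A *v x = y \<Longrightarrow> inv_form A y = y \<bullet> x"
  unfolding inv_form_def using matrix_inv_pd(2) by metis

lemma inv_form_mat_1: "inv_form (mat 1 :: real^'n^'n) y = y \<bullet> y"
  by (rule inv_form_eqI[OF mat_1_pd]) simp

text \<open>
  The inverse form is the convex conjugate of the form itself:
  \<open>s\<^sub>A(y) = sup\<^sub>x (2 x' y - x' A x)\<close>. Monotonicity, bounds and limits of \<open>s\<^sub>A\<close> are all read off from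
  this description, without continuity of matrix inversion.
\<close>

lemma inv_form_ge:
  fixes A :: "real^'n^'n"
  assumes A: "A \<in> pd"
  shows "2 * (x \<bullet> y) - x \<bullet> (A *v x) \<le> inv_form A y"
proof -
  define z where "z = matrix_inv A *v y"
  have Az: "A *v z = y" by (simp add: z_def matrix_inv_pd[OF A])
  have zx: "z \<bullet> (A *v x) = x \<bullet> y"
    using dot_symmetric_matrix[OF pd_symmetric[OF A], of z x] Az by (simp add: inner_commute)
  have "0 \<le> (x - z) \<bullet> (A *v (x - z))" by (rule pd_nonneg[OF A])
  also have "\<dots> = x \<bullet> (A *v x) - 2 * (x \<bullet> y) + z \<bullet> y"
    by (simp add: matrix_vector_mult_diff_distrib inner_simps Az zx)
  finally show ?thesis by (simp add: inv_form_def z_def[symmetric] inner_commute)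
qed

lemma inv_form_attained:
  fixes A :: "real^'n^'n"
  assumes A: "A \<in> pd"
  obtains x where "inv_form A y = 2 * (x \<bullet> y) - x \<bullet> (A *v x)"
proof
  show "inv_form A y = 2 * ((matrix_inv A *v y) \<bullet> y) - (matrix_inv A *v y) \<bullet> (A *v (matrix_inv A *v y))"
    by (simp add: inv_form_def matrix_inv_pd[OF A] inner_commute)
qed

lemma inv_form_antimono:
  fixes A B :: "real^'n^'n"
  assumes "A \<in> pd" "B \<in> pd" "\<And>x. x \<bullet> (B *v x) \<le> x \<bullet> (A *v x)"
  shows "inv_form A y \<le> inv_form B y"
proof -
  obtain x where "inv_form A y = 2 * (x \<bullet> y) - x \<bullet> (A *v x)"
    using inv_form_attained[OF assms(1)] .
  also have "\<dots> \<le> 2 * (x \<bullet> y) - x \<bullet> (B *v x)" using assms(3)[of x] by simp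
  also have "\<dots> \<le> inv_form B y" by (rule inv_form_ge[OF assms(2)])
  finally show ?thesis .
qed

lemma inv_form_nonneg: "A \<in> pd \<Longrightarrow> 0 \<le> inv_form A y"
  using inv_form_ge[of A 0 y] by simp

lemma continuous_on_inv_form: "continuous_on S (inv_form A)"
  unfolding inv_form_def by (intro continuous_intros)

lemma borel_measurable_inv_form [measurable]: "inv_form A \<in> borel_measurable borel"
  by (rule borel_measurable_continuous_onI[OF continuous_on_inv_form])

lemma norm_matrix_vector_mult_le:
  fixes M :: "real^'n^'m"
  shows "norm (M *v x) \<le> real CARD('m) * norm M * norm x"
proof -
  have "norm (M *v x) \<le> (\<Sum>i\<in>UNIV. \<bar>(M *v x) $ i\<bar>)" by (rule norm_le_l1_cart)
  also have "\<dots> \<le> (\<Sum>i\<in>(UNIV::'m set). norm M * norm x)"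
  proof (rule sum_mono)
    fix i
    have "(M *v x) $ i = M $ i \<bullet> x" by (simp add: matrix_vector_mult_def inner_vec_def)
    also have "\<bar>\<dots>\<bar> \<le> norm (M $ i) * norm x" by (rule Cauchy_Schwarz_ineq2)
    also have "\<dots> \<le> norm M * norm x"
      by (intro mult_right_mono Finite_Cartesian_Product.norm_nth_le) simp
    finally show "\<bar>(M *v x) $ i\<bar> \<le> norm M * norm x" .
  qed
  finally show ?thesis by (simp add: mult.assoc)
qed

lemma abs_quadratic_form_le:
  fixes M :: "real^'n^'n"
  shows "\<bar>x \<bullet> (M *v x)\<bar> \<le> real CARD('n) * norm M * (norm x)\<^sup>2"
proof -
  have "\<bar>x \<bullet> (M *v x)\<bar> \<le> norm x * norm (M *v x)" by (rule Cauchy_Schwarz_ineq2)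
  also have "\<dots> \<le> norm x * (real CARD('n) * norm M * norm x)"
    by (intro mult_left_mono norm_matrix_vector_mult_le) simp
  finally show ?thesis by (simp add: power2_eq_square mult_ac)
qed

lemma inv_form_upper:
  fixes A :: "real^'n^'n"
  obtains C where "C > 0" "\<And>y. inv_form A y \<le> C * (norm y)\<^sup>2"
proof
  show "real CARD('n) * norm (matrix_inv A) + 1 > 0" by (simp add: add_nonneg_pos)
  fix y :: "real^'n"
  have "inv_form A y \<le> real CARD('n) * norm (matrix_inv A) * (norm y)\<^sup>2"
    unfolding inv_form_def using abs_quadratic_form_le[of y "matrix_inv A"] by simp
  then show "inv_form A y \<le> (real CARD('n) * norm (matrix_inv A) + 1) * (norm y)\<^sup>2"
    by (simp add: distrib_right add_increasing2)
qed

lemma inv_form_lower: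
  fixes A :: "real^'n^'n"
  assumes A: "A \<in> pd"
  obtains c where "c > 0" "\<And>y. c * (norm y)\<^sup>2 \<le> inv_form A y"
proof -
  define K where "K = real CARD('n) * norm A + 1"
  have K: "K > 0" unfolding K_def by (simp add: add_nonneg_pos)
  show ?thesis
  proof
    show "1 / K > 0" using K by simp
    fix y :: "real^'n"
    have "y \<bullet> (A *v y) \<le> K * (norm y)\<^sup>2"
      unfolding K_def using abs_quadratic_form_le[of y A] by (simp add: distrib_right add_increasing2)
    then have "(1/K)\<^sup>2 * (y \<bullet> (A *v y)) \<le> (1/K)\<^sup>2 * (K * (norm y)\<^sup>2)"
      by (intro mult_left_mono) auto
    also have "\<dots> = (1/K) * (norm y)\<^sup>2" using K by (simp add: power2_eq_square)
    finally have q: "(1/K)\<^sup>2 * (y \<bullet> (A *v y)) \<le> (1/K) * (norm y)\<^sup>2" .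
    have "2 * (((1/K) *\<^sub>R y) \<bullet> y) - ((1/K) *\<^sub>R y) \<bullet> (A *v ((1/K) *\<^sub>R y)) \<le> inv_form A y"
      by (rule inv_form_ge[OF A])
    moreover have "2 * (((1/K) *\<^sub>R y) \<bullet> y) - ((1/K) *\<^sub>R y) \<bullet> (A *v ((1/K) *\<^sub>R y))
        = 2 * ((1/K) * (norm y)\<^sup>2) - (1/K)\<^sup>2 * (y \<bullet> (A *v y))"
      unfolding power2_norm_eq_inner
      by (simp add: matrix_vector_mult_scaleR power2_eq_square)
    ultimately show "1 / K * (norm y)\<^sup>2 \<le> inv_form A y" using q by simp
  qed
qed

lemma pd_lower:
  fixes A :: "real^'n^'n"
  assumes A: "A \<in> pd"
  obtains c where "c > 0" "\<And>x. c * (norm x)\<^sup>2 \<le> x \<bullet> (A *v x)"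
proof -
  obtain C where C: "C > 0" "\<And>y. inv_form A y \<le> C * (norm y)\<^sup>2" using inv_form_upper[of A] by blast
  show ?thesis
  proof
    show "1 / C > 0" using C by simp
    fix x :: "real^'n"
    have "2 * (x \<bullet> ((1/C) *\<^sub>R x)) - x \<bullet> (A *v x) \<le> inv_form A ((1/C) *\<^sub>R x)" by (rule inv_form_ge[OF A])
    also have "\<dots> \<le> C * (norm ((1/C) *\<^sub>R x))\<^sup>2" by (rule C)
    also have "\<dots> = (1/C) * (norm x)\<^sup>2" using C by (simp add: power_divide power2_eq_square)
    finally show "1 / C * (norm x)\<^sup>2 \<le> x \<bullet> (A *v x)"
      by (simp add: power2_norm_eq_inner)
  qed
qed

lemma u_pos: "\<nu> > 0 \<Longrightarrow> s \<ge> 0 \<Longrightarrow> u \<nu> d s > 0"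
  by (simp add: u_def)

lemma u_antimono: "\<nu> > 0 \<Longrightarrow> s \<ge> 0 \<Longrightarrow> s \<le> t \<Longrightarrow> u \<nu> d t \<le> u \<nu> d s"
  by (simp add: u_def frac_le)

lemma u_mult_le: "\<nu> > 0 \<Longrightarrow> s \<ge> 0 \<Longrightarrow> u \<nu> d s * s \<le> \<nu> + real d"
proof -
  assume *: "\<nu> > 0" "s \<ge> 0"
  then have "(\<nu> + real d) * s \<le> (\<nu> + real d) * (\<nu> + s)" by (intro mult_left_mono) auto
  then show ?thesis using * by (simp add: u_def divide_le_eq)
qed

text \<open>
  Traces of the estimating equation produce \<open>\<integral> u(s) s\<close>; this identity turns them into
  statements about the total weight \<open>\<integral> u(s)\<close>.
\<close>

lemma u_mult_eq: "\<nu> > 0 \<Longrightarrow> s \<ge> 0 \<Longrightarrow> u \<nu> d s * s = (\<nu> + real d) - \<nu> * u \<nu> d s"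
  by (simp add: u_def field_simps)

lemma borel_measurable_u [measurable]: "u \<nu> d \<in> borel_measurable borel"
  unfolding u_def[abs_def] by measurable

lemma borel_measurable_\<rho> [measurable]: "\<rho> \<nu> d \<in> borel_measurable borel"
  unfolding \<rho>_def[abs_def] by measurable

lemma borel_prob_integrable_bounded:
  fixes f :: "'a::topological_space \<Rightarrow> real"
  assumes "borel_prob Q" "f \<in> borel_measurable borel" "\<And>x. \<bar>f x\<bar> \<le> C"
  shows "integrable Q f"
proof -
  interpret prob_space Q using assms(1) by (simp add: borel_prob_def)
  have "sets Q = sets borel" using assms(1) by (simp add: borel_prob_def)
  then have "f \<in> borel_measurable Q" using assms(2) measurable_cong_sets by blast
  then show ?thesis using assms(3) by (intro integrable_const_bound[where B=C]) auto
qed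

text \<open>
  The weight \<open>u(s)\<close> decays like \<open>1 / s\<close>, and \<open>s\<^sub>A(y)\<close> is comparable to \<open>|y|\<^sup>2\<close>; so second moments with
  this weight exist for every probability measure.
\<close>

lemma weight_inner_bounded:
  fixes A :: "real^'n^'n"
  assumes \<nu>: "\<nu> > 0" and A: "A \<in> pd"
  obtains C where "\<And>y. u \<nu> d (inv_form A y) * (x \<bullet> y)\<^sup>2 \<le> C"
proof -
  obtain c where c: "c > 0" "\<And>y. c * (norm y)\<^sup>2 \<le> inv_form A y" using inv_form_lower[OF A] by blast
  show ?thesis
  proof
    fix y
    have s: "inv_form A y \<ge> 0" by (rule inv_form_nonneg[OF A])
    have "(x \<bullet> y)\<^sup>2 \<le> (norm x * norm y)\<^sup>2"
      using Cauchy_Schwarz_ineq2[of x y] by (metis abs_ge_zero power2_abs power_mono)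
    also have "\<dots> = (norm x)\<^sup>2 * (norm y)\<^sup>2" by (simp add: power_mult_distrib)
    also have "\<dots> \<le> (norm x)\<^sup>2 * (inv_form A y / c)"
      using c by (intro mult_left_mono) (auto simp: pos_le_divide_eq mult.commute)
    finally have "u \<nu> d (inv_form A y) * (x \<bullet> y)\<^sup>2 \<le> u \<nu> d (inv_form A y) * ((norm x)\<^sup>2 * (inv_form A y / c))"
      using u_pos[OF \<nu> s] by (intro mult_left_mono) (auto simp: less_imp_le)
    also have "\<dots> = (norm x)\<^sup>2 / c * (u \<nu> d (inv_form A y) * inv_form A y)" by simp
    also have "\<dots> \<le> (norm x)\<^sup>2 / c * (\<nu> + real d)"
      using c u_mult_le[OF \<nu> s] by (intro mult_left_mono) auto
    finally show "u \<nu> d (inv_form A y) * (x \<bullet> y)\<^sup>2 \<le> (norm x)\<^sup>2 / c * (\<nu> + real d)" .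
  qed
qed

lemma integrable_weight_inner:
  fixes A :: "real^'n^'n"
  assumes Q: "borel_prob Q" and \<nu>: "\<nu> > 0" and A: "A \<in> pd"
  shows "integrable Q (\<lambda>y. u \<nu> d (inv_form A y) * (x \<bullet> y)\<^sup>2)"
proof -
  obtain C where C: "\<And>y. u \<nu> d (inv_form A y) * (x \<bullet> y)\<^sup>2 \<le> C"
    using weight_inner_bounded[OF \<nu> A] by blast
  show ?thesis
  proof (rule borel_prob_integrable_bounded[OF Q, where C=C])
    show "(\<lambda>y. u \<nu> d (inv_form A y) * (x \<bullet> y)\<^sup>2) \<in> borel_measurable borel" by measurable
    show "\<bar>u \<nu> d (inv_form A y) * (x \<bullet> y)\<^sup>2\<bar> \<le> C" for y
      using C[of y] u_pos[OF \<nu> inv_form_nonneg[OF A, of y], of d] by (simp add: abs_mult)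
  qed
qed

lemma integrable_weight_inv_form:
  fixes A B :: "real^'n^'n"
  assumes Q: "borel_prob Q" and \<nu>: "\<nu> > 0" and A: "A \<in> pd" and B: "B \<in> pd"
  shows "integrable Q (\<lambda>y. u \<nu> d (inv_form A y) * inv_form B y)"
proof -
  obtain w where w: "orthonormal_wrt B w" using orthonormal_wrt_exists[OF B] .
  show ?thesis
    unfolding inv_form_orthonormal_wrt[OF w] sum_distrib_left
    by (intro Bochner_Integration.integrable_sum integrable_weight_inner[OF Q \<nu> A])
qed

lemma integrable_weight:
  fixes A :: "real^'n^'n"
  assumes Q: "borel_prob Q" and \<nu>: "\<nu> > 0" and A: "A \<in> pd"
  shows "integrable Q (\<lambda>y. u \<nu> d (inv_form A y))"
proof (rule borel_prob_integrable_bounded[OF Q, where C="u \<nu> d 0"])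
  show "(\<lambda>y. u \<nu> d (inv_form A y)) \<in> borel_measurable borel" by measurable
  show "\<bar>u \<nu> d (inv_form A y)\<bar> \<le> u \<nu> d 0" for y
    using u_antimono[OF \<nu> _ inv_form_nonneg[OF A, of y], of d]
      u_pos[OF \<nu> inv_form_nonneg[OF A, of y], of d] by simp
qed

lemma \<rho>_diff:
  assumes "\<nu> > 0" "s \<ge> 0" "t \<ge> 0"
  shows "\<rho> \<nu> d s - \<rho> \<nu> d t = (\<nu> + real d) / 2 * ln ((\<nu> + s) / (\<nu> + t))"
proof -
  have "ln ((\<nu> + s) / \<nu>) - ln ((\<nu> + t) / \<nu>) = ln ((\<nu> + s) / (\<nu> + t))"
    using assms by (simp add: ln_div)
  then show ?thesis by (simp add: \<rho>_def right_diff_distrib[symmetric])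
qed

text \<open>
  Any two inverse forms are comparable, so the quotient of \<open>\<nu> + s\<^sub>A\<close> and \<open>\<nu> + s\<^sub>B\<close> stays between
  positive constants.
\<close>

lemma integrable_\<rho>_diff:
  fixes A B :: "real^'n^'n"
  assumes Q: "borel_prob Q" and \<nu>: "\<nu> > 0" and A: "A \<in> pd" and B: "B \<in> pd"
  shows "integrable Q (\<lambda>y. \<rho> \<nu> d (inv_form A y) - \<rho> \<nu> d (inv_form B y))"
proof -
  have upper: "\<exists>C. \<forall>y. \<rho> \<nu> d (inv_form A y) - \<rho> \<nu> d (inv_form B y) \<le> C"
    if A: "A \<in> pd" and B: "B \<in> pd" for A B :: "real^'n^'n"
  proof -
    obtain C where C: "C > 0" "\<And>y. inv_form A y \<le> C * (norm y)\<^sup>2" using inv_form_upper[of A] by blast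
    obtain c where c: "c > 0" "\<And>y. c * (norm y)\<^sup>2 \<le> inv_form B y" using inv_form_lower[OF B] by blast
    have "\<rho> \<nu> d (inv_form A y) - \<rho> \<nu> d (inv_form B y) \<le> (\<nu> + real d) / 2 * ln (1 + C / c)" for y
    proof -
      have s: "inv_form A y \<ge> 0" "inv_form B y \<ge> 0" by (simp_all add: inv_form_nonneg A B)
      have "(norm y)\<^sup>2 \<le> inv_form B y / c"
        using c(2)[of y] c(1) by (simp add: pos_le_divide_eq mult.commute)
      then have "C * (norm y)\<^sup>2 \<le> C * (inv_form B y / c)" using C(1) by (intro mult_left_mono) auto
      then have "inv_form A y \<le> C * (inv_form B y / c)" using C(2)[of y] by linarith
      moreover have "(1 + C / c) * (\<nu> + inv_form B y) = \<nu> + C * (inv_form B y / c) + (inv_form B y + C / c * \<nu>)"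
        by (simp add: algebra_simps)
      moreover have "0 \<le> inv_form B y + C / c * \<nu>" using s C c \<nu> by simp
      ultimately have "\<nu> + inv_form A y \<le> (1 + C / c) * (\<nu> + inv_form B y)" by linarith
      then have "(\<nu> + inv_form A y) / (\<nu> + inv_form B y) \<le> 1 + C / c"
        using s \<nu> by (simp add: divide_le_eq)
      then have "ln ((\<nu> + inv_form A y) / (\<nu> + inv_form B y)) \<le> ln (1 + C / c)"
        using s \<nu> by (intro ln_mono) auto
      then show ?thesis unfolding \<rho>_diff[OF \<nu> s]
        using \<nu> by (intro mult_left_mono) auto
    qed
    then show ?thesis by blast
  qed
  obtain C1 where C1: "\<And>y. \<rho> \<nu> d (inv_form A y) - \<rho> \<nu> d (inv_form B y) \<le> C1"
    using upper[OF A B] by blast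
  obtain C2 where C2: "\<And>y. \<rho> \<nu> d (inv_form B y) - \<rho> \<nu> d (inv_form A y) \<le> C2"
    using upper[OF B A] by blast
  show ?thesis
  proof (rule borel_prob_integrable_bounded[OF Q, where C="max C1 C2"])
    show "(\<lambda>y. \<rho> \<nu> d (inv_form A y) - \<rho> \<nu> d (inv_form B y)) \<in> borel_measurable borel" by measurable
    show "\<bar>\<rho> \<nu> d (inv_form A y) - \<rho> \<nu> d (inv_form B y)\<bar> \<le> max C1 C2" for y
      using C1[of y] C2[of y] by linarith
  qed
qed


section \<open>The estimating equation and the minima\<close>

text \<open>
  The equation \<open>A = \<integral> u(y' A\<^sup>-\<^sup>1 y) y y' dQ(y)\<close>, stated for the quadratic forms of both sides so
  that only real integrals occur.
\<close>

definition scatter_eq :: "real \<Rightarrow> (real^'n) measure \<Rightarrow> real^'n^'n \<Rightarrow> bool" where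
  "scatter_eq \<nu> Q A \<longleftrightarrow> A \<in> pd \<and>
     (\<forall>x. x \<bullet> (A *v x) = (LINT y|Q. u \<nu> CARD('n) (inv_form A y) * (x \<bullet> y)\<^sup>2))"

text \<open>
  Jensen's inequality for the logarithm of the mean of the numbers \<open>1\<close> and \<open>1 / b\<^sub>i\<close> with weights
  proportional to \<open>\<nu>\<close> and \<open>p\<^sub>i\<close>. Proved from \<open>exp x \<ge> 1 + x\<close>, whose strictness for \<open>x \<noteq> 0\<close> gives
  the strict version: the mean includes the number \<open>1\<close> with positive weight, so the numbers that
  carry weight are all equal only if they are all \<open>1\<close>.
\<close>

lemma ln_mean_ge_mean_ln:
  fixes p b :: "'i::finite \<Rightarrow> real"
  assumes \<nu>: "\<nu> > 0" and b: "\<And>i. b i > 0" and p: "\<And>i. p i \<ge> 0"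
  shows "- (\<Sum>i\<in>UNIV. p i * ln (b i)) / (\<nu> + (\<Sum>i\<in>UNIV. p i))
      \<le> ln ((\<nu> + (\<Sum>i\<in>UNIV. p i / b i)) / (\<nu> + (\<Sum>i\<in>UNIV. p i)))" (is "?m \<le> ln (?N / ?T)")
    and "p i > 0 \<Longrightarrow> b i \<noteq> 1 \<Longrightarrow>
      - (\<Sum>i\<in>UNIV. p i * ln (b i)) / (\<nu> + (\<Sum>i\<in>UNIV. p i))
      < ln ((\<nu> + (\<Sum>i\<in>UNIV. p i / b i)) / (\<nu> + (\<Sum>i\<in>UNIV. p i)))"
proof -
  define m where "m = ?m"
  have T: "?T > 0" using \<nu> p by (simp add: add_pos_nonneg sum_nonneg)
  have N: "?N > 0" using \<nu> p b by (simp add: add_pos_nonneg sum_nonneg less_imp_le)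
  \<comment> \<open>The claim is \<open>exp m * T \<le> N\<close>; both sides are split into the contribution of \<open>\<nu>\<close> and those of the \<open>p i\<close>.\<close>
  have e0: "\<nu> * (exp m * (1 - m)) \<le> \<nu>"
  proof -
    have "exp m * (1 - m) \<le> exp m * exp (- m)"
      using exp_ge_add_one_self[of "- m"] by (intro mult_left_mono) auto
    then show ?thesis using \<nu> by (simp add: exp_minus)
  qed
  have ib: "1 / b i = exp m * exp (- ln (b i) - m)" for i
    using b[of i] by (simp add: exp_diff exp_minus inverse_eq_divide)
  have e1: "p i * (exp m * (1 + (- ln (b i) - m))) \<le> p i / b i" for i
  proof -
    have "exp m * (1 + (- ln (b i) - m)) \<le> 1 / b i"
      unfolding ib using exp_ge_add_one_self[of "- ln (b i) - m"] by (intro mult_left_mono) auto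
    then have "p i * (exp m * (1 + (- ln (b i) - m))) \<le> p i * (1 / b i)"
      using p by (intro mult_left_mono) auto
    then show ?thesis by simp
  qed
  have mT: "m * ?T = - (\<Sum>i\<in>UNIV. p i * ln (b i))" using T by (simp add: m_def)
  have "\<nu> * (exp m * (1 - m)) + (\<Sum>i\<in>UNIV. p i * (exp m * (1 + (- ln (b i) - m))))
      = exp m * (\<nu> * (1 - m) + (\<Sum>i\<in>UNIV. p i * (1 - m) - p i * ln (b i)))"
    by (simp add: sum_distrib_left algebra_simps)
  also have "\<dots> = exp m * (?T * (1 - m) - (\<Sum>i\<in>UNIV. p i * ln (b i)))"
    by (simp add: sum_subtractf sum_distrib_right[symmetric] distrib_right)
  also have "\<dots> = exp m * ?T" using mT by (simp add: algebra_simps)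
  finally have sumeq: "\<nu> * (exp m * (1 - m)) + (\<Sum>i\<in>UNIV. p i * (exp m * (1 + (- ln (b i) - m))))
      = exp m * ?T" .
  have "exp m * ?T \<le> ?N"
    unfolding sumeq[symmetric] using e0 e1 by (intro add_mono sum_mono) auto
  then have "exp m \<le> ?N / ?T" using T by (simp add: pos_le_divide_eq)
  then have "ln (exp m) \<le> ln (?N / ?T)" by (intro ln_mono) auto
  then show "?m \<le> ln (?N / ?T)" unfolding m_def by simp
  show "?m < ln (?N / ?T)" if pi: "p i > 0" "b i \<noteq> 1"
  proof -
    have "exp m * ?T < ?N"
    proof (cases "m = 0")
      case True
      have "1 + (- ln (b i) - m) < exp (- ln (b i) - m)"
        using True pi b[of i] exp_minus_greater[of "ln (b i)"] by simp
      then have "exp m * (1 + (- ln (b i) - m)) < 1 / b i"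
        unfolding ib by (intro mult_strict_left_mono) auto
      then have "p i * (exp m * (1 + (- ln (b i) - m))) < p i * (1 / b i)"
        using pi by (intro mult_strict_left_mono) auto
      then have "(\<Sum>i\<in>UNIV. p i * (exp m * (1 + (- ln (b i) - m)))) < (\<Sum>i\<in>UNIV. p i / b i)"
        using e1 by (intro sum_strict_mono_ex1) auto
      then show ?thesis unfolding sumeq[symmetric] using e0 by linarith
    next
      case False
      have "exp m * (1 - m) < exp m * exp (- m)"
        using exp_minus_greater[of m] False by (intro mult_strict_left_mono) auto
      then have "\<nu> * (exp m * (1 - m)) < \<nu>" using \<nu> by (simp add: exp_minus)
      moreover have "(\<Sum>i\<in>UNIV. p i * (exp m * (1 + (- ln (b i) - m)))) \<le> (\<Sum>i\<in>UNIV. p i / b i)"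
        using e1 by (intro sum_mono) auto
      ultimately show ?thesis unfolding sumeq[symmetric] by linarith
    qed
    then have "exp m < ?N / ?T" using T by (simp add: pos_less_divide_eq)
    then have "ln (exp m) < ln (?N / ?T)" by (subst ln_less_cancel_iff) (use N T in auto)
    then show ?thesis unfolding m_def by simp
  qed
qed

lemma ln_det_diagonalized:
  fixes A B :: "real^'n^'n"
  assumes A: "A \<in> pd" and w: "orthonormal_wrt A w"
    and b: "\<And>i. B *v w i = b i *\<^sub>R (A *v w i)" and bpos: "\<And>i. b i > 0"
  shows "ln (det B) = ln (det A) + (\<Sum>i\<in>UNIV. ln (b i))"
proof -
  have "ln (prod b UNIV) = (\<Sum>i\<in>UNIV. ln (b i))"
    by (rule ln_prod) (simp_all add: bpos less_imp_neq[OF bpos, symmetric])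
  moreover have "prod b UNIV > 0" by (intro prod_pos bpos)
  ultimately show ?thesis
    unfolding det_diagonalized[OF w b] using det_pd_pos[OF A] by (subst ln_mult_pos) auto
qed

lemma Qh_diff:
  fixes A B :: "real^'n^'n"
  assumes Q: "borel_prob Q" and \<nu>: "\<nu> > 0" and A: "A \<in> pd" and B: "B \<in> pd"
  shows "Qh \<nu> Q B - Qh \<nu> Q A = (ln (det B) - ln (det A)) / 2 +
    (LINT y|Q. \<rho> \<nu> CARD('n) (inv_form B y) - \<rho> \<nu> CARD('n) (inv_form A y))"
proof -
  have i: "integrable Q (\<lambda>y. \<rho> \<nu> CARD('n) (inv_form C y) - \<rho> \<nu> CARD('n) (y \<bullet> y))" if "C \<in> pd" for C :: "real^'n^'n"
    using integrable_\<rho>_diff[OF Q \<nu> that mat_1_pd] by (simp add: inv_form_mat_1)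
  have "(LINT y|Q. \<rho> \<nu> CARD('n) (inv_form B y) - \<rho> \<nu> CARD('n) (inv_form A y)) =
    (LINT y|Q. (\<rho> \<nu> CARD('n) (inv_form B y) - \<rho> \<nu> CARD('n) (y \<bullet> y)) -
      (\<rho> \<nu> CARD('n) (inv_form A y) - \<rho> \<nu> CARD('n) (y \<bullet> y)))" by simp
  also have "\<dots> = (LINT y|Q. \<rho> \<nu> CARD('n) (inv_form B y) - \<rho> \<nu> CARD('n) (y \<bullet> y)) -
      (LINT y|Q. \<rho> \<nu> CARD('n) (inv_form A y) - \<rho> \<nu> CARD('n) (y \<bullet> y))"
    by (rule Bochner_Integration.integral_diff[OF i[OF B] i[OF A]])
  finally show ?thesis by (simp add: Qh_def diff_divide_distrib)
qed

lemma scatter_eq_orthonormal: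
  fixes A :: "real^'n^'n"
  assumes "scatter_eq \<nu> Q A" "orthonormal_wrt A w"
  shows "(LINT y|Q. u \<nu> CARD('n) (inv_form A y) * (w i \<bullet> y)\<^sup>2) = 1"
  using assms unfolding scatter_eq_def orthonormal_wrt_def by metis

text \<open>
  In simultaneously diagonal coordinates the difference of the two \<open>\<rho>\<close>-terms dominates
  \<open>- \<Sum> ln b\<^sub>i / 2 * u(s\<^sub>A) (w\<^sub>i' y)\<^sup>2\<close> by Jensen's inequality. The equation makes the integral of the
  latter equal to \<open>- (ln det B - ln det A) / 2\<close>, which cancels the determinant term.
\<close>

lemma scatter_eq_imp_min:
  fixes A B :: "real^'n^'n"
  assumes Q: "borel_prob Q" and \<nu>: "\<nu> > 0" and A: "scatter_eq \<nu> Q A" and B: "B \<in> pd"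
  shows "Qh \<nu> Q A \<le> Qh \<nu> Q B"
    and "(\<And>x. x \<noteq> 0 \<Longrightarrow> measure Q {y. x \<bullet> y = 0} < 1) \<Longrightarrow> B \<noteq> A \<Longrightarrow> Qh \<nu> Q A < Qh \<nu> Q B"
proof -
  have Apd: "A \<in> pd" using A by (simp add: scatter_eq_def)
  obtain w b where w: "orthonormal_wrt A w" and b: "\<And>i. B *v w i = b i *\<^sub>R (A *v w i)"
    using simultaneous_diagonalization[OF Apd pd_symmetric[OF B]] by blast
  have bpos: "b i > 0" for i by (rule pd_diagonalized_pos[OF Apd B w b])
  \<comment> \<open>\<open>L\<close> is minus Jensen's lower bound of the difference of the two \<open>\<rho>\<close>-terms.\<close>
  define L where "L y = (\<Sum>i\<in>UNIV. ln (b i) / 2 * (u \<nu> CARD('n) (inv_form A y) * (w i \<bullet> y)\<^sup>2))" for y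
  define f where "f y = (\<rho> \<nu> CARD('n) (inv_form B y) - \<rho> \<nu> CARD('n) (inv_form A y)) + L y" for y
  have Li: "integrable Q L"
    unfolding L_def by (intro Bochner_Integration.integrable_sum integrable_mult_right integrable_weight_inner[OF Q \<nu> Apd])
  have fi: "integrable Q f"
    unfolding f_def by (intro Bochner_Integration.integrable_add Li integrable_\<rho>_diff[OF Q \<nu> B Apd])
  have "(LINT y|Q. L y) = (\<Sum>i\<in>UNIV. ln (b i) / 2)"
    unfolding L_def using integrable_weight_inner[OF Q \<nu> Apd] scatter_eq_orthonormal[OF A w]
    by (subst Bochner_Integration.integral_sum) (auto intro!: integrable_mult_right)
  also have "\<dots> = (ln (det B) - ln (det A)) / 2"
  proof -
    show ?thesis using ln_det_diagonalized[OF Apd w b bpos] by (simp add: sum_divide_distrib)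
  qed
  finally have diff: "Qh \<nu> Q B - Qh \<nu> Q A = (LINT y|Q. f y)"
    unfolding f_def Qh_diff[OF Q \<nu> Apd B]
    by (subst Bochner_Integration.integral_add) (auto intro!: Li integrable_\<rho>_diff[OF Q \<nu> B Apd])
  have f_eq: "f y = (\<nu> + real CARD('n)) / 2 * (ln ((\<nu> + (\<Sum>i\<in>UNIV. (w i \<bullet> y)\<^sup>2 / b i)) / (\<nu> + (\<Sum>i\<in>UNIV. (w i \<bullet> y)\<^sup>2)))
      - (- (\<Sum>i\<in>UNIV. (w i \<bullet> y)\<^sup>2 * ln (b i)) / (\<nu> + (\<Sum>i\<in>UNIV. (w i \<bullet> y)\<^sup>2))))" for y
  proof -
    have s: "inv_form A y \<ge> 0" "inv_form B y \<ge> 0" using Apd B by (simp_all add: inv_form_nonneg)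
    have "L y = (\<nu> + real CARD('n)) / 2 * ((\<Sum>i\<in>UNIV. (w i \<bullet> y)\<^sup>2 * ln (b i)) / (\<nu> + inv_form A y))"
      unfolding L_def u_def by (simp add: sum_divide_distrib sum_distrib_left mult_ac)
    then show ?thesis
      unfolding f_def \<rho>_diff[OF \<nu> s(2) s(1)]
      by (simp add: inv_form_orthonormal_wrt[OF w, symmetric] inv_form_diagonalized[OF w b bpos, symmetric] distrib_left)
  qed
  have f_nonneg: "0 \<le> f y" for y
    unfolding f_eq using ln_mean_ge_mean_ln(1)[of \<nu> b "\<lambda>i. (w i \<bullet> y)\<^sup>2", OF \<nu> bpos] \<nu>
    by (intro mult_nonneg_nonneg) auto
  show "Qh \<nu> Q A \<le> Qh \<nu> Q B"
    using diff Bochner_Integration.integral_nonneg[of Q f, OF f_nonneg] by linarith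
  show "Qh \<nu> Q A < Qh \<nu> Q B" if hyp: "\<And>x. x \<noteq> 0 \<Longrightarrow> measure Q {y. x \<bullet> y = 0} < 1" and "B \<noteq> A"
  proof -
    have "\<exists>i. b i \<noteq> 1"
    proof (rule ccontr)
      assume "\<not> ?thesis"
      then have "B = A" by (intro matrix_eq_on_orthonormal_wrt[OF w]) (simp add: b)
      with \<open>B \<noteq> A\<close> show False by simp
    qed
    then obtain i where i: "b i \<noteq> 1" by blast
    have wi: "w i \<noteq> 0" using w unfolding orthonormal_wrt_def by (metis inner_zero_left zero_neq_one)
    have fp: "0 < f y" if "w i \<bullet> y \<noteq> 0" for y
      unfolding f_eq using ln_mean_ge_mean_ln(2)[of \<nu> b "\<lambda>i. (w i \<bullet> y)\<^sup>2" i, OF \<nu> bpos] \<nu> i that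
      by (intro mult_pos_pos) auto
    have "(LINT y|Q. f y) \<noteq> 0"
    proof
      assume "(LINT y|Q. f y) = 0"
      then have "AE y in Q. f y = 0"
        using integral_nonneg_eq_0_iff_AE[OF fi] f_nonneg by simp
      then have ae: "AE y in Q. y \<in> {y. w i \<bullet> y = 0}"
        by eventually_elim (use fp in \<open>auto simp: less_le\<close>)
      interpret prob_space Q using Q by (simp add: borel_prob_def)
      have "{y. w i \<bullet> y = 0} \<in> sets borel"
        by (intro borel_closed closed_hyperplane)
      then have "{y. w i \<bullet> y = 0} \<in> sets Q" using Q by (simp add: borel_prob_def)
      then have "measure Q {y. w i \<bullet> y = 0} = 1" using ae by (subst prob_eq_1) auto
      with hyp[OF wi] show False by simp
    qed
    moreover have "0 \<le> (LINT y|Q. f y)" using f_nonneg by simp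
    ultimately show ?thesis using diff by simp
  qed
qed

text \<open>
  The tangent of the concave function \<open>\<rho>\<close> at \<open>s\<^sub>A\<close> majorizes \<open>Qh\<close> by a function of \<open>B\<close> that involves
  only \<open>det B\<close> and second moments.
\<close>

lemma Qh_diff_le_linearized:
  fixes A B :: "real^'n^'n"
  assumes Q: "borel_prob Q" and \<nu>: "\<nu> > 0" and A: "A \<in> pd" and B: "B \<in> pd"
  shows "Qh \<nu> Q B - Qh \<nu> Q A \<le> (ln (det B) - ln (det A)) / 2 +
    (LINT y|Q. u \<nu> CARD('n) (inv_form A y) * (inv_form B y - inv_form A y)) / 2"
proof -
  have i: "integrable Q (\<lambda>y. u \<nu> CARD('n) (inv_form A y) * (inv_form B y - inv_form A y))"
    unfolding right_diff_distrib
    by (intro Bochner_Integration.integrable_diff integrable_weight_inv_form Q \<nu> A B)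
  have "(LINT y|Q. \<rho> \<nu> CARD('n) (inv_form B y) - \<rho> \<nu> CARD('n) (inv_form A y))
      \<le> (LINT y|Q. u \<nu> CARD('n) (inv_form A y) * (inv_form B y - inv_form A y) / 2)"
  proof (rule integral_mono[OF integrable_\<rho>_diff[OF Q \<nu> B A]])
    show "integrable Q (\<lambda>y. u \<nu> CARD('n) (inv_form A y) * (inv_form B y - inv_form A y) / 2)"
      using i by simp
    fix y
    have s: "inv_form A y \<ge> 0" "inv_form B y \<ge> 0" using A B by (simp_all add: inv_form_nonneg)
    have "ln ((\<nu> + inv_form B y) / (\<nu> + inv_form A y)) \<le> (\<nu> + inv_form B y) / (\<nu> + inv_form A y) - 1"
      using s \<nu> by (intro ln_le_minus_one) auto
    also have "\<dots> = (inv_form B y - inv_form A y) / (\<nu> + inv_form A y)"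
      using s \<nu> by (simp add: field_simps)
    finally have "(\<nu> + real CARD('n)) / 2 * ln ((\<nu> + inv_form B y) / (\<nu> + inv_form A y))
       \<le> (\<nu> + real CARD('n)) / 2 * ((inv_form B y - inv_form A y) / (\<nu> + inv_form A y))"
      using \<nu> by (intro mult_left_mono) auto
    then show "\<rho> \<nu> CARD('n) (inv_form B y) - \<rho> \<nu> CARD('n) (inv_form A y)
        \<le> u \<nu> CARD('n) (inv_form A y) * (inv_form B y - inv_form A y) / 2"
      unfolding \<rho>_diff[OF \<nu> s(2) s(1)] by (simp add: u_def mult.commute)
  qed
  then show ?thesis unfolding Qh_diff[OF Q \<nu> A B] by simp
qed

lemma scatter_eq_diff_le:
  fixes A B :: "real^'n^'n"
  assumes Q: "borel_prob Q" and \<nu>: "\<nu> > 0" and A: "scatter_eq \<nu> Q A" and B: "B \<in> pd"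
    and w: "orthonormal_wrt A w" and b: "\<And>i. B *v w i = b i *\<^sub>R (A *v w i)"
  shows "Qh \<nu> Q B - Qh \<nu> Q A \<le> (\<Sum>i\<in>UNIV. (b i - 1)\<^sup>2 / b i) / 2"
proof -
  have Apd: "A \<in> pd" using A by (simp add: scatter_eq_def)
  have bpos: "b i > 0" for i by (rule pd_diagonalized_pos[OF Apd B w b])
  have ld: "ln (det B) - ln (det A) = (\<Sum>i\<in>UNIV. ln (b i))"
    using ln_det_diagonalized[OF Apd w b bpos] by simp
  have "(LINT y|Q. u \<nu> CARD('n) (inv_form A y) * (inv_form B y - inv_form A y))
     = (LINT y|Q. (\<Sum>i\<in>UNIV. (1 / b i - 1) * (u \<nu> CARD('n) (inv_form A y) * (w i \<bullet> y)\<^sup>2)))"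
  proof (rule Bochner_Integration.integral_cong[OF refl])
    fix y
    have "inv_form B y - inv_form A y = (\<Sum>i\<in>UNIV. (1 / b i - 1) * (w i \<bullet> y)\<^sup>2)"
      by (simp add: inv_form_orthonormal_wrt[OF w] inv_form_diagonalized[OF w b bpos]
          sum_subtractf left_diff_distrib)
    then show "u \<nu> CARD('n) (inv_form A y) * (inv_form B y - inv_form A y) =
        (\<Sum>i\<in>UNIV. (1 / b i - 1) * (u \<nu> CARD('n) (inv_form A y) * (w i \<bullet> y)\<^sup>2))"
      by (simp add: sum_distrib_left mult_ac)
  qed
  also have "\<dots> = (\<Sum>i\<in>UNIV. 1 / b i - 1)"
    using integrable_weight_inner[OF Q \<nu> Apd] scatter_eq_orthonormal[OF A w]
    by (subst Bochner_Integration.integral_sum) (auto intro!: integrable_mult_right)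
  finally have "Qh \<nu> Q B - Qh \<nu> Q A \<le> (\<Sum>i\<in>UNIV. ln (b i)) / 2 + (\<Sum>i\<in>UNIV. 1 / b i - 1) / 2"
    using Qh_diff_le_linearized[OF Q \<nu> Apd B] ld by simp
  also have "\<dots> = (\<Sum>i\<in>UNIV. ln (b i) + (1 / b i - 1)) / 2"
    by (simp add: sum.distrib add_divide_distrib)
  also have "\<dots> \<le> (\<Sum>i\<in>UNIV. (b i - 1)\<^sup>2 / b i) / 2"
  proof (intro divide_right_mono sum_mono)
    fix i
    have "ln (b i) + (1 / b i - 1) \<le> (b i - 1) + (1 / b i - 1)"
      using ln_le_minus_one[OF bpos[of i]] by simp
    also have "\<dots> = (b i - 1)\<^sup>2 / b i"
      using bpos[of i] by (simp add: field_simps power2_eq_square)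
    finally show "ln (b i) + (1 / b i - 1) \<le> (b i - 1)\<^sup>2 / b i" .
  qed simp
  finally show ?thesis .
qed

text \<open>
  The difference \<open>Qh B - Qh A\<close> lies between \<open>0\<close> and a quadratic bound: the generalized eigenvalues
  of \<open>B\<close> satisfy \<open>b\<^sub>i - 1 = w\<^sub>i' (B - A) w\<^sub>i\<close>, where \<open>w\<^sub>i' A w\<^sub>i = 1\<close> bounds \<open>w\<^sub>i\<close> uniformly in \<open>B\<close>.
\<close>

lemma scatter_eq_imp_critical:
  fixes A :: "real^'n^'n"
  assumes Q: "borel_prob Q" and \<nu>: "\<nu> > 0" and A: "scatter_eq \<nu> Q A"
  shows "critical_point_on (Qh \<nu> Q) pd A"
proof -
  have Apd: "A \<in> pd" using A by (simp add: scatter_eq_def)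
  obtain c where c: "c > 0" "\<And>x. c * (norm x)\<^sup>2 \<le> x \<bullet> (A *v x)" using pd_lower[OF Apd] by blast
  define n where "n = real CARD('n)"
  have n: "n > 0" by (simp add: n_def)
  \<comment> \<open>The radius \<open>c / (2 n)\<close> keeps all generalized eigenvalues \<open>b i\<close> at least \<open>1 / 2\<close>.\<close>
  have bound: "\<bar>Qh \<nu> Q B - Qh \<nu> Q A\<bar> \<le> n * (n / c)\<^sup>2 * (norm (B - A))\<^sup>2"
    if B: "B \<in> pd" and close: "dist B A < c / (2 * n)" for B
  proof -
    obtain w b where w: "orthonormal_wrt A w" and b: "\<And>i. B *v w i = b i *\<^sub>R (A *v w i)"
      using simultaneous_diagonalization[OF Apd pd_symmetric[OF B]] by blast
    define \<delta> where "\<delta> = n * norm (B - A) / c"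
    have \<delta>: "\<delta> \<le> 1 / 2" "\<delta> \<ge> 0"
      using close n c by (auto simp: \<delta>_def dist_norm field_simps)
    have bd: "\<bar>b i - 1\<bar> \<le> \<delta>" for i
    proof -
      have wAw: "w i \<bullet> (A *v w i) = 1" using w by (simp add: orthonormal_wrt_def)
      then have "b i - 1 = w i \<bullet> ((B - A) *v w i)"
        by (simp add: matrix_vector_mult_diff_rdistrib inner_simps b)
      then have "\<bar>b i - 1\<bar> \<le> n * norm (B - A) * (norm (w i))\<^sup>2"
        using abs_quadratic_form_le[of "w i" "B - A"] by (simp add: n_def)
      also have "\<dots> \<le> n * norm (B - A) * (1 / c)"
        using c(2)[of "w i"] wAw c(1) n by (intro mult_left_mono) (auto simp: field_simps)
      finally show ?thesis by (simp add: \<delta>_def)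
    qed
    have "(b i - 1)\<^sup>2 / b i \<le> 2 * \<delta>\<^sup>2" for i
    proof -
      have "(b i - 1)\<^sup>2 \<le> \<delta>\<^sup>2" using bd[of i] \<delta> by (metis abs_ge_zero power2_abs power_mono)
      moreover have "1 / 2 \<le> b i" using bd[of i] \<delta> by linarith
      ultimately have "(b i - 1)\<^sup>2 / b i \<le> \<delta>\<^sup>2 / (1 / 2)" by (intro frac_le) auto
      then show ?thesis by simp
    qed
    then have "(\<Sum>i\<in>UNIV. (b i - 1)\<^sup>2 / b i) \<le> (\<Sum>i\<in>(UNIV::'n set). 2 * \<delta>\<^sup>2)"
      by (intro sum_mono) auto
    then have "Qh \<nu> Q B - Qh \<nu> Q A \<le> n * \<delta>\<^sup>2"
      using scatter_eq_diff_le[OF Q \<nu> A B w b] by (simp add: n_def)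
    moreover have "n * \<delta>\<^sup>2 = n * (n / c)\<^sup>2 * (norm (B - A))\<^sup>2"
      by (simp add: \<delta>_def power_mult_distrib power_divide)
    ultimately show ?thesis using scatter_eq_imp_min(1)[OF Q \<nu> A B] by simp
  qed
  have "(Qh \<nu> Q has_derivative (\<lambda>_. 0)) (at A within pd)"
  proof (rule has_derivativeI_sandwich)
    show "0 < c / (2 * n)" using c n by simp
    show "bounded_linear (\<lambda>_::real^'n^'n. 0::real)" by (rule bounded_linear_zero)
    show "((\<lambda>B. n * (n / c)\<^sup>2 * norm (B - A)) \<longlongrightarrow> 0) (at A within pd)"
      by (rule tendsto_eq_intros | simp)+
    fix B :: "real^'n^'n"
    assume "B \<in> pd" "B \<noteq> A" "dist B A < c / (2 * n)"
    then show "norm (Qh \<nu> Q B - Qh \<nu> Q A - 0) / norm (B - A) \<le> n * (n / c)\<^sup>2 * norm (B - A)"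
      using bound[of B] by (simp add: divide_le_eq power2_eq_square mult_ac)
  qed
  then show ?thesis using Apd by (simp add: critical_point_on_def)
qed

text \<open>
  A function that lies above \<open>f\<close> along a curve and touches it at a critical point of \<open>f\<close> has a
  vanishing derivative there. This replaces the computation of the derivative of \<open>f\<close>.
\<close>

lemma critical_point_upper_curve:
  fixes f :: "'a::real_normed_vector \<Rightarrow> real" and \<gamma> :: "real \<Rightarrow> 'a"
  assumes crit: "critical_point_on f S x"
    and \<gamma>: "(\<gamma> has_vector_derivative v) (at 0)" "\<gamma> 0 = x"
    and \<delta>: "\<delta> > 0" and S: "\<And>t. \<bar>t\<bar> < \<delta> \<Longrightarrow> \<gamma> t \<in> S"
    and R: "\<And>t. \<bar>t\<bar> < \<delta> \<Longrightarrow> f (\<gamma> t) - f x \<le> R t" "R 0 = 0" "(R has_real_derivative r) (at 0)"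
  shows "r = 0"
proof -
  define T where "T = {-\<delta><..<\<delta>}"
  have TS: "\<gamma> ` T \<subseteq> S" using S by (auto simp: T_def)
  have "(f has_derivative (\<lambda>_. 0)) (at (\<gamma> 0) within \<gamma> ` T)"
    using crit has_derivative_subset[OF _ TS] unfolding critical_point_on_def \<gamma>(2) by blast
  moreover have "(\<gamma> has_derivative (\<lambda>t. t *\<^sub>R v)) (at 0 within T)"
    using \<gamma>(1) unfolding has_vector_derivative_def by (rule has_derivative_at_withinI)
  ultimately have "(f \<circ> \<gamma> has_derivative ((\<lambda>_. 0) \<circ> (\<lambda>t. t *\<^sub>R v))) (at 0 within T)"
    by (intro diff_chain_within)
  moreover have "at 0 within T = at (0::real)"
    using \<delta> by (intro at_within_open) (auto simp: T_def)
  ultimately have "((\<lambda>t. f (\<gamma> t)) has_real_derivative 0) (at 0)"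
    by (simp add: has_field_derivative_def o_def lambda_zero)
  then have "((\<lambda>t. R t - (f (\<gamma> t) - f x)) has_real_derivative r - (0 - 0)) (at 0)"
    by (intro DERIV_diff R(3) DERIV_const)
  moreover have "\<forall>t. \<bar>0 - t\<bar> < \<delta> \<longrightarrow> R 0 - (f (\<gamma> 0) - f x) \<le> R t - (f (\<gamma> t) - f x)"
    using R(1,2) \<gamma>(2) by simp
  ultimately have "r - (0 - 0) = 0" by (rule DERIV_local_min[OF _ \<delta>])
  then show ?thesis by simp
qed

definition outer :: "real^'n \<Rightarrow> real^'n^'n" where
  "outer a = (\<chi> i j. a $ i * a $ j)"

lemma outer_mult: "outer a *v x = (a \<bullet> x) *\<^sub>R a"
  by (simp add: outer_def matrix_vector_mult_def inner_vec_def vec_eq_iff sum_distrib_left mult_ac)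

lemma transpose_outer: "transpose (outer a) = outer a"
  by (simp add: outer_def transpose_def vec_eq_iff mult.commute)

text \<open>
  In an \<open>A\<close>-orthonormal family that contains \<open>w\<close> the update is diagonal, with one entry \<open>1 + t\<close> and
  all others \<open>1\<close>.
\<close>

lemma rank_one_update:
  fixes A :: "real^'n^'n"
  assumes A: "A \<in> pd" and w: "w \<bullet> (A *v w) = 1" and t: "\<bar>t\<bar> < 1"
  defines "B \<equiv> A + t *\<^sub>R outer (A *v w)"
  shows "B \<in> pd" and "det B = det A * (1 + t)"
    and "inv_form B y = inv_form A y - t / (1 + t) * (w \<bullet> y)\<^sup>2"
proof -
  have symA: "(A *v x) \<bullet> y = x \<bullet> (A *v y)" for x y
    by (rule dot_symmetric_matrix[OF pd_symmetric[OF A]])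
  have Bx: "B *v x = A *v x + (t * ((A *v w) \<bullet> x)) *\<^sub>R (A *v w)" for x
    by (simp add: B_def matrix_vector_mult_add_rdistrib scaleR_matrix_vector_assoc[symmetric] outer_mult)
  show Bpd: "B \<in> pd"
    unfolding pd_def
  proof (intro CollectI conjI allI impI)
    show "transpose B = B"
      using pd_symmetric[OF A] transpose_outer[of "A *v w"]
      by (simp add: B_def transpose_def vec_eq_iff)
    fix x :: "real^'n" assume x: "x \<noteq> 0"
    define c where "c = (A *v w) \<bullet> x"
    have wx: "w \<bullet> (A *v x) = c" by (simp add: c_def symA)
    have xw: "x \<bullet> (A *v w) = c" by (simp add: c_def inner_commute)
    have "0 \<le> (x - c *\<^sub>R w) \<bullet> (A *v (x - c *\<^sub>R w))" by (rule pd_nonneg[OF A])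
    also have "\<dots> = x \<bullet> (A *v x) - c\<^sup>2"
      by (simp add: matrix_vector_mult_diff_distrib matrix_vector_mult_scaleR inner_simps wx xw w power2_eq_square)
    finally have c2: "c\<^sup>2 \<le> x \<bullet> (A *v x)" by simp
    have "- t * c\<^sup>2 \<le> \<bar>t\<bar> * c\<^sup>2" by (intro mult_right_mono) auto
    also have "\<dots> \<le> \<bar>t\<bar> * (x \<bullet> (A *v x))" using c2 by (intro mult_left_mono) auto
    also have "\<dots> < 1 * (x \<bullet> (A *v x))" using t pd_pos[OF A x] by (intro mult_strict_right_mono) auto
    finally have "0 < x \<bullet> (A *v x) + t * c\<^sup>2" by simp
    also have "\<dots> = x \<bullet> (B *v x)"
      by (simp add: Bx inner_simps c_def[symmetric] xw power2_eq_square)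
    finally show "0 < x \<bullet> (B *v x)" .
  qed
  obtain k :: 'n where True by simp
  let ?M = "outer (A *v w)"
  have "\<exists>w' b'. orthonormal_wrt A w' \<and> (\<forall>i. ?M *v w' i = b' i *\<^sub>R (A *v w' i)) \<and>
    (\<forall>i\<in>{k}. w' i = w \<and> b' i = 1)"
    by (rule pencil_extend[OF A transpose_outer, where I="{k}" and w="\<lambda>_. w" and b="\<lambda>_. 1"])
      (auto simp: w outer_mult symA)
  then obtain v b where v: "orthonormal_wrt A v" and b: "\<And>i. ?M *v v i = b i *\<^sub>R (A *v v i)"
    and vk: "v k = w" "b k = 1" by blast
  have vv: "v i \<bullet> (A *v v j) = (if i = j then 1 else 0)" for i j
    using v by (simp add: orthonormal_wrt_def)
  have b0: "b i = 0" if "i \<noteq> k" for i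
  proof -
    have "(A *v w) \<bullet> v i = 0" using vv[of k i] that vk by (simp add: symA)
    then have "b i *\<^sub>R (A *v v i) = 0" using b[of i] by (simp add: outer_mult)
    then have "v i \<bullet> (b i *\<^sub>R (A *v v i)) = 0" by (simp only: inner_zero_right)
    then show ?thesis using vv[of i i] by (simp only: inner_scaleR_right) simp
  qed
  define \<beta> where "\<beta> i = (if i = k then 1 + t else 1)" for i
  have Bv: "B *v v i = \<beta> i *\<^sub>R (A *v v i)" for i
  proof -
    have "B *v v i = (1 + t * b i) *\<^sub>R (A *v v i)"
      by (simp add: B_def matrix_vector_mult_add_rdistrib scaleR_matrix_vector_assoc[symmetric] b scaleR_add_left)
    also have "1 + t * b i = \<beta> i" using vk(2) b0 by (simp add: \<beta>_def)
    finally show ?thesis .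
  qed
  have \<beta>pos: "\<beta> i > 0" for i using t by (auto simp: \<beta>_def)
  show "det B = det A * (1 + t)"
    unfolding det_diagonalized[OF v Bv] by (simp add: \<beta>_def prod.delta)
  have split: "p / (1 + t) = p - t / (1 + t) * p" for p
  proof -
    have "1 + t \<noteq> 0" using t by auto
    then have "1 / (1 + t) = 1 - t / (1 + t)" by (simp add: diff_divide_distrib[symmetric] eq_divide_eq divide_simps)
    then have "1 / (1 + t) * p = (1 - t / (1 + t)) * p" by (rule arg_cong)
    then show ?thesis by (simp add: left_diff_distrib)
  qed
  have "inv_form B y = (\<Sum>i\<in>UNIV. (v i \<bullet> y)\<^sup>2 - (if i = k then t / (1 + t) * (v i \<bullet> y)\<^sup>2 else 0))"
    unfolding inv_form_diagonalized[OF v Bv \<beta>pos]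
    by (intro sum.cong refl) (simp add: \<beta>_def split[of "(w \<bullet> y)\<^sup>2"] vk)
  also have "\<dots> = inv_form A y - t / (1 + t) * (w \<bullet> y)\<^sup>2"
    by (simp add: sum_subtractf inv_form_orthonormal_wrt[OF v] vk)
  finally show "inv_form B y = inv_form A y - t / (1 + t) * (w \<bullet> y)\<^sup>2" .
qed

lemma second_moment_of_normalized:
  fixes A :: "real^'n^'n" and g :: "'a \<Rightarrow> real^'n"
  assumes A: "A \<in> pd" and one: "\<And>w. w \<bullet> (A *v w) = 1 \<Longrightarrow> (LINT y|M. U y * (w \<bullet> g y)\<^sup>2) = 1"
  shows "(LINT y|M. U y * (x \<bullet> g y)\<^sup>2) = x \<bullet> (A *v x)"
proof (cases "x = 0")
  case True then show ?thesis by simp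
next
  case False
  define c where "c = x \<bullet> (A *v x)"
  have c: "c > 0" using pd_pos[OF A False] by (simp add: c_def)
  have "(x /\<^sub>R sqrt c) \<bullet> (A *v (x /\<^sub>R sqrt c)) = c / (sqrt c * sqrt c)"
    by (simp add: matrix_vector_mult_scaleR c_def[symmetric] field_simps)
  then have "(x /\<^sub>R sqrt c) \<bullet> (A *v (x /\<^sub>R sqrt c)) = 1" using c by simp
  from one[OF this] have "1 = (LINT y|M. (1 / c) * (U y * (x \<bullet> g y)\<^sup>2))"
    using c by (simp add: power_mult_distrib power_divide less_imp_le field_simps)
  also have "\<dots> = (1 / c) * (LINT y|M. U y * (x \<bullet> g y)\<^sup>2)"
    by (rule integral_mult_right_zero)
  finally show ?thesis using c by (simp add: c_def field_simps)
qed

text \<open>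
  Along \<open>A + t (A w)(A w)'\<close> with \<open>w' A w = 1\<close> the upper bound is
  \<open>ln (1 + t) / 2 - t / (1 + t) * K / 2\<close> with \<open>K = \<integral> u(s\<^sub>A) (w' y)\<^sup>2 dQ\<close>. Its derivative at \<open>0\<close> is
  \<open>(1 - K) / 2\<close>.
\<close>

lemma critical_imp_scatter_eq:
  fixes A :: "real^'n^'n"
  assumes Q: "borel_prob Q" and \<nu>: "\<nu> > 0" and crit: "critical_point_on (Qh \<nu> Q) pd A"
  shows "scatter_eq \<nu> Q A"
proof -
  have A: "A \<in> pd" using crit by (simp add: critical_point_on_def)
  have one: "(LINT y|Q. u \<nu> CARD('n) (inv_form A y) * (w \<bullet> y)\<^sup>2) = 1" if w: "w \<bullet> (A *v w) = 1" for w
  proof -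
    define K where "K = (LINT y|Q. u \<nu> CARD('n) (inv_form A y) * (w \<bullet> y)\<^sup>2)"
    define \<gamma> where "\<gamma> t = A + t *\<^sub>R outer (A *v w)" for t
    define R where "R t = ln (1 + t) / 2 - t / (1 + t) * K / 2" for t
    have "1 / 2 - K / 2 = 0"
    proof (rule critical_point_upper_curve[OF crit, of \<gamma> "outer (A *v w)" 1 R])
      show "(\<gamma> has_vector_derivative outer (A *v w)) (at 0)"
        unfolding \<gamma>_def[abs_def] by (auto intro!: derivative_eq_intros)
      show "\<gamma> 0 = A" by (simp add: \<gamma>_def)
      show "R 0 = 0" by (simp add: R_def)
      show "(R has_real_derivative 1 / 2 - K / 2) (at 0)"
        unfolding R_def[abs_def] by (auto intro!: derivative_eq_intros)
      fix t :: real assume t: "\<bar>t\<bar> < 1"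
      note ro = rank_one_update[OF A w t, folded \<gamma>_def]
      show "\<gamma> t \<in> pd" by (rule ro)
      have "(ln (det (\<gamma> t)) - ln (det A)) = ln (1 + t)"
        unfolding ro(2) using det_pd_pos[OF A] t by (subst ln_mult_pos) auto
      moreover have "(LINT y|Q. u \<nu> CARD('n) (inv_form A y) * (inv_form (\<gamma> t) y - inv_form A y))
          = - (t / (1 + t) * K)"
      proof -
        have "(LINT y|Q. u \<nu> CARD('n) (inv_form A y) * (inv_form (\<gamma> t) y - inv_form A y))
          = (LINT y|Q. - (t / (1 + t)) * (u \<nu> CARD('n) (inv_form A y) * (w \<bullet> y)\<^sup>2))"
          by (intro Bochner_Integration.integral_cong refl) (simp add: ro(3))
        also have "\<dots> = - (t / (1 + t)) * K" unfolding K_def by (rule integral_mult_right_zero)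
        finally show ?thesis by simp
      qed
      ultimately show "Qh \<nu> Q (\<gamma> t) - Qh \<nu> Q A \<le> R t"
        using Qh_diff_le_linearized[OF Q \<nu> A ro(1)] by (simp add: R_def)
    qed simp
    then show ?thesis by (simp add: K_def)
  qed
  show ?thesis
    unfolding scatter_eq_def
    using A second_moment_of_normalized[where g="\<lambda>y. y", OF A one] by simp
qed


section \<open>Existence of a solution by monotone iteration\<close>

text \<open>
  The right-hand side of the estimating equation as a matrix; the solutions are its fixed points.
\<close>

definition scatter_map :: "real \<Rightarrow> (real^'n) measure \<Rightarrow> real^'n^'n \<Rightarrow> real^'n^'n" where
  "scatter_map \<nu> Q B = (\<chi> i j. LINT y|Q. u \<nu> CARD('n) (inv_form B y) * (y $ i * y $ j))"

lemma quadratic_form_sum: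
  fixes M :: "real^'n^'n"
  shows "x \<bullet> (M *v x) = (\<Sum>i\<in>UNIV. \<Sum>j\<in>UNIV. x $ i * x $ j * M $ i $ j)"
  by (simp add: inner_vec_def matrix_vector_mult_def sum_distrib_left mult_ac)

lemma scatter_map_form:
  fixes B :: "real^'n^'n"
  assumes Q: "borel_prob Q" and \<nu>: "\<nu> > 0" and B: "B \<in> pd"
  shows "x \<bullet> (scatter_map \<nu> Q B *v x) = (LINT y|Q. u \<nu> CARD('n) (inv_form B y) * (x \<bullet> y)\<^sup>2)"
proof -
  have i: "integrable Q (\<lambda>y. u \<nu> CARD('n) (inv_form B y) * (y $ i * y $ j))" for i j
  proof -
    have eq: "u \<nu> CARD('n) (inv_form B y) * (y $ i * y $ j) =
        (u \<nu> CARD('n) (inv_form B y) * ((axis i 1 + axis j 1) \<bullet> y)\<^sup>2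
         - u \<nu> CARD('n) (inv_form B y) * ((axis i 1 - axis j 1) \<bullet> y)\<^sup>2) / 4" for y
      by (simp add: inner_simps inner_axis' power2_eq_square algebra_simps)
    show ?thesis unfolding eq
      by (intro integrable_divide Bochner_Integration.integrable_diff integrable_weight_inner[OF Q \<nu> B])
  qed
  have "(LINT y|Q. u \<nu> CARD('n) (inv_form B y) * (x \<bullet> y)\<^sup>2)
    = (LINT y|Q. (\<Sum>i\<in>UNIV. \<Sum>j\<in>UNIV. x $ i * x $ j * (u \<nu> CARD('n) (inv_form B y) * (y $ i * y $ j))))"
    by (intro Bochner_Integration.integral_cong refl)
      (simp add: inner_vec_def power2_eq_square sum_product sum_distrib_left mult_ac)
  also have "\<dots> = (\<Sum>i\<in>UNIV. \<Sum>j\<in>UNIV. x $ i * x $ j * (LINT y|Q. u \<nu> CARD('n) (inv_form B y) * (y $ i * y $ j)))"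
    using i by (simp add: Bochner_Integration.integral_sum)
  also have "\<dots> = x \<bullet> (scatter_map \<nu> Q B *v x)"
    unfolding quadratic_form_sum by (simp add: scatter_map_def)
  finally show ?thesis by simp
qed

lemma scatter_map_pd:
  fixes B :: "real^'n^'n"
  assumes Q: "borel_prob Q" and \<nu>: "\<nu> > 0" and B: "B \<in> pd"
    and nd: "\<And>x. x \<noteq> 0 \<Longrightarrow> measure Q {y. x \<bullet> y = 0} < 1"
  shows "scatter_map \<nu> Q B \<in> pd"
  unfolding pd_def
proof (intro CollectI conjI allI impI)
  show "transpose (scatter_map \<nu> Q B) = scatter_map \<nu> Q B"
    by (simp add: scatter_map_def transpose_def vec_eq_iff mult.commute)
  fix x :: "real^'n" assume x: "x \<noteq> 0"
  interpret prob_space Q using Q by (simp add: borel_prob_def)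
  let ?f = "\<lambda>y. u \<nu> CARD('n) (inv_form B y) * (x \<bullet> y)\<^sup>2"
  have up: "u \<nu> CARD('n) (inv_form B y) > 0" for y by (intro u_pos \<nu> inv_form_nonneg B)
  have fn: "0 \<le> ?f y" for y using up[of y] by simp
  have "(LINT y|Q. ?f y) \<noteq> 0"
  proof
    assume "(LINT y|Q. ?f y) = 0"
    then have "AE y in Q. ?f y = 0"
      using integral_nonneg_eq_0_iff_AE[OF integrable_weight_inner[OF Q \<nu> B]] fn by blast
    then have ae: "AE y in Q. y \<in> {y. x \<bullet> y = 0}"
      by eventually_elim (use up in \<open>auto simp: less_le\<close>)
    have "{y. x \<bullet> y = 0} \<in> sets borel" by (intro borel_closed closed_hyperplane)
    then have "{y. x \<bullet> y = 0} \<in> sets Q" using Q by (simp add: borel_prob_def)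
    then have "measure Q {y. x \<bullet> y = 0} = 1" using ae by (subst prob_eq_1) auto
    with nd[OF x] show False by simp
  qed
  moreover have "0 \<le> (LINT y|Q. ?f y)" using fn by (rule Bochner_Integration.integral_nonneg)
  ultimately show "0 < x \<bullet> (scatter_map \<nu> Q B *v x)"
    unfolding scatter_map_form[OF Q \<nu> B] by simp
qed

text \<open>
  A larger form has a smaller inverse form, and the weight \<open>u\<close> is decreasing.
\<close>

lemma scatter_map_mono:
  fixes B C :: "real^'n^'n"
  assumes Q: "borel_prob Q" and \<nu>: "\<nu> > 0" and B: "B \<in> pd" and C: "C \<in> pd"
    and le: "\<And>x. x \<bullet> (B *v x) \<le> x \<bullet> (C *v x)"
  shows "x \<bullet> (scatter_map \<nu> Q B *v x) \<le> x \<bullet> (scatter_map \<nu> Q C *v x)"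
  unfolding scatter_map_form[OF Q \<nu> B] scatter_map_form[OF Q \<nu> C]
proof (rule integral_mono[OF integrable_weight_inner[OF Q \<nu> B] integrable_weight_inner[OF Q \<nu> C]])
  fix y
  show "u \<nu> CARD('n) (inv_form B y) * (x \<bullet> y)\<^sup>2 \<le> u \<nu> CARD('n) (inv_form C y) * (x \<bullet> y)\<^sup>2"
    by (intro mult_right_mono u_antimono \<nu> inv_form_nonneg C inv_form_antimono[OF C B le]) auto
qed

lemma \<U>_hyperplane:
  fixes Q :: "(real^'n) measure"
  assumes Q: "Q \<in> \<U> a" and a: "a > 0" and x: "x \<noteq> 0"
  shows "measure Q {y. x \<bullet> y = 0} < 1"
proof -
  have d: "dim {y. x \<bullet> y = 0} = CARD('n) - 1" using dim_hyperplane[OF x] by simp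
  have "dim {y. x \<bullet> y = 0} < DIM(real^'n)" unfolding d by simp
  then have "measure Q {y. x \<bullet> y = 0} < 1 - (real DIM(real^'n) - real (dim {y. x \<bullet> y = 0})) / a"
    using Q subspace_hyperplane[of x] unfolding \<U>_def by blast
  also have "\<dots> \<le> 1" using a d by simp
  finally show ?thesis .
qed

lemma scaled_identity:
  fixes y :: "real^'n"
  assumes c: "c > 0"
  shows "c *\<^sub>R (mat 1 :: real^'n^'n) \<in> pd" and "inv_form (c *\<^sub>R (mat 1 :: real^'n^'n)) y = (norm y)\<^sup>2 / c"
proof -
  show pd: "c *\<^sub>R (mat 1 :: real^'n^'n) \<in> pd"
    using c by (simp add: pd_def scaleR_matrix_vector_assoc[symmetric] transpose_scalar)
  have "(c *\<^sub>R (mat 1 :: real^'n^'n)) *v ((1/c) *\<^sub>R y) = y"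
    using c by (simp add: scaleR_matrix_vector_assoc[symmetric])
  from inv_form_eqI[OF pd this] show "inv_form (c *\<^sub>R (mat 1 :: real^'n^'n)) y = (norm y)\<^sup>2 / c"
    by (simp add: power2_norm_eq_inner)
qed

text \<open>
  At \<open>c I\<close> the map is bounded by \<open>c \<integral> a |y|\<^sup>2 / (c \<nu> + |y|\<^sup>2) dQ\<close> times the identity. By dominated
  convergence this integral tends to \<open>0\<close> as \<open>c\<close> grows.
\<close>

lemma scatter_map_supersolution:
  fixes Q :: "(real^'n) measure"
  assumes Q: "borel_prob Q" and \<nu>: "\<nu> > 0"
  obtains c where "c > 0"
    "\<And>x. x \<bullet> (scatter_map \<nu> Q (c *\<^sub>R mat 1) *v x) \<le> x \<bullet> ((c *\<^sub>R mat 1) *v x)"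
proof -
  interpret prob_space Q using Q by (simp add: borel_prob_def)
  define a where "a = \<nu> + real CARD('n)"
  have a: "a > 0" using \<nu> by (simp add: a_def)
  define f where "f k y = a * (norm y)\<^sup>2 / (real (Suc k) * \<nu> + (norm y)\<^sup>2)" for k and y :: "real^'n"
  have den: "real (Suc k) * \<nu> + (norm y)\<^sup>2 > 0" for k and y :: "real^'n"
    using \<nu> by (simp add: add_pos_nonneg)
  have fb: "0 \<le> f k y" "f k y \<le> a" for k and y :: "real^'n"
  proof -
    show "0 \<le> f k y" using a den[of k y] by (simp add: f_def less_imp_le)
    have "a * (norm y)\<^sup>2 \<le> a * (real (Suc k) * \<nu> + (norm y)\<^sup>2)"
      using a \<nu> by (intro mult_left_mono) auto
    then show "f k y \<le> a" unfolding f_def using den[of k y] by (simp add: divide_le_eq)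
  qed
  have fm: "f k \<in> borel_measurable borel" for k unfolding f_def[abs_def] by measurable
  have fi: "integrable Q (f k)" for k
    by (rule borel_prob_integrable_bounded[OF Q fm, where C=a]) (use fb in auto)
  have "(\<lambda>k. LINT y|Q. f k y) \<longlonglongrightarrow> (LINT y|Q. 0)"
  proof (rule integral_dominated_convergence[where w="\<lambda>_. a"])
    show "f k \<in> borel_measurable Q" for k using fi by blast
    show "AE y in Q. norm (f k y) \<le> a" for k using fb by simp
    show "AE y in Q. (\<lambda>k. f k y) \<longlonglongrightarrow> 0"
    proof (rule AE_I2)
      fix y :: "real^'n"
      have "filterlim (\<lambda>k. real k * \<nu>) at_top sequentially"
        by (rule filterlim_at_top_mult_tendsto_pos[OF tendsto_const \<nu> filterlim_real_sequentially])
      then have "filterlim (\<lambda>k. real (Suc k) * \<nu> + (norm y)\<^sup>2) at_top sequentially"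
        by (rule filterlim_at_top_mono) (use \<nu> in \<open>auto simp: distrib_right intro!: always_eventually\<close>)
      then show "(\<lambda>k. f k y) \<longlonglongrightarrow> 0"
        unfolding f_def by (intro tendsto_divide_0[OF tendsto_const] filterlim_at_top_imp_at_infinity)
    qed
  qed auto
  then have "\<forall>\<^sub>F k in sequentially. (LINT y|Q. f k y) < 1"
    by (intro order_tendstoD) auto
  then obtain k where k: "(LINT y|Q. f k y) < 1" by (auto simp: eventually_sequentially)
  define c where "c = real (Suc k)"
  have c: "c > 0" by (simp add: c_def)
  show ?thesis
  proof
    show "c > 0" by (rule c)
    fix x :: "real^'n"
    note cpd = scaled_identity(1)[OF c]
    have "x \<bullet> (scatter_map \<nu> Q (c *\<^sub>R mat 1) *v x) = (LINT y|Q. u \<nu> CARD('n) ((norm y)\<^sup>2 / c) * (x \<bullet> y)\<^sup>2)"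
      unfolding scatter_map_form[OF Q \<nu> cpd] scaled_identity(2)[OF c] by simp
    also have "\<dots> \<le> (LINT y|Q. c * (norm x)\<^sup>2 * f k y)"
    proof (rule integral_mono)
      show "integrable Q (\<lambda>y. u \<nu> CARD('n) ((norm y)\<^sup>2 / c) * (x \<bullet> y)\<^sup>2)"
        using integrable_weight_inner[OF Q \<nu> cpd] unfolding scaled_identity(2)[OF c] .
      show "integrable Q (\<lambda>y. c * (norm x)\<^sup>2 * f k y)" by (intro integrable_mult_right fi)
      fix y
      have "(x \<bullet> y)\<^sup>2 \<le> (norm x * norm y)\<^sup>2"
        using Cauchy_Schwarz_ineq2[of x y] by (metis abs_ge_zero power2_abs power_mono)
      then have "u \<nu> CARD('n) ((norm y)\<^sup>2 / c) * (x \<bullet> y)\<^sup>2 \<le> u \<nu> CARD('n) ((norm y)\<^sup>2 / c) * (norm x * norm y)\<^sup>2"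
        using u_pos[OF \<nu>, of "(norm y)\<^sup>2 / c" "CARD('n)"] c by (intro mult_left_mono) auto
      moreover have "u \<nu> CARD('n) ((norm y)\<^sup>2 / c) = c * (a / (c * \<nu> + (norm y)\<^sup>2))"
        using c by (simp add: u_def a_def add_divide_eq_iff divide_simps) (simp add: mult_ac)
      moreover have "c * (a / (c * \<nu> + (norm y)\<^sup>2)) * (norm x * norm y)\<^sup>2 = c * (norm x)\<^sup>2 * f k y"
        by (simp add: f_def c_def power_mult_distrib mult_ac)
      ultimately show "u \<nu> CARD('n) ((norm y)\<^sup>2 / c) * (x \<bullet> y)\<^sup>2 \<le> c * (norm x)\<^sup>2 * f k y" by simp
    qed
    also have "\<dots> = c * (norm x)\<^sup>2 * (LINT y|Q. f k y)" by (rule integral_mult_right_zero)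
    also have "\<dots> \<le> c * (norm x)\<^sup>2 * 1" using k c by (intro mult_left_mono) auto
    also have "\<dots> = x \<bullet> ((c *\<^sub>R mat 1) *v x)"
      by (simp add: scaleR_matrix_vector_assoc[symmetric] power2_norm_eq_inner)
    finally show "x \<bullet> (scatter_map \<nu> Q (c *\<^sub>R mat 1) *v x) \<le> x \<bullet> ((c *\<^sub>R mat 1) *v x)" .
  qed
qed

lemma decreasing_iterates:
  fixes Q :: "(real^'n) measure"
  assumes Q: "borel_prob Q" and \<nu>: "\<nu> > 0"
    and nd: "\<And>x. x \<noteq> 0 \<Longrightarrow> measure Q {y. x \<bullet> y = 0} < 1"
  obtains A :: "nat \<Rightarrow> real^'n^'n" where "\<And>k. A k \<in> pd"
    "\<And>k. A (Suc k) = scatter_map \<nu> Q (A k)"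
    "\<And>k x. x \<bullet> (A (Suc k) *v x) \<le> x \<bullet> (A k *v x)"
proof -
  obtain c where c: "c > 0"
    and sup: "\<And>x. x \<bullet> (scatter_map \<nu> Q (c *\<^sub>R mat 1) *v x) \<le> x \<bullet> ((c *\<^sub>R mat 1) *v x)"
    using scatter_map_supersolution[OF Q \<nu>] by blast
  define A where "A k = (scatter_map \<nu> Q ^^ k) (c *\<^sub>R mat 1)" for k
  have pd: "A k \<in> pd" for k
    by (induction k) (simp_all add: A_def scaled_identity(1)[OF c] scatter_map_pd[OF Q \<nu> _ nd])
  have step: "A (Suc k) = scatter_map \<nu> Q (A k)" for k by (simp add: A_def)
  have dec: "x \<bullet> (A (Suc k) *v x) \<le> x \<bullet> (A k *v x)" for k x
  proof (induction k arbitrary: x)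
    case 0 show ?case using sup by (simp add: A_def)
  next
    case (Suc k)
    show ?case using scatter_map_mono[OF Q \<nu> pd pd Suc] by (simp only: step[symmetric])
  qed
  show ?thesis using that pd step dec by blast
qed

lemma matrix_entry_polarization:
  fixes M :: "real^'n^'n"
  assumes "transpose M = M"
  shows "M $ i $ j = ((axis i 1 + axis j 1) \<bullet> (M *v (axis i 1 + axis j 1))
    - (axis i 1 - axis j 1) \<bullet> (M *v (axis i 1 - axis j 1))) / 4"
proof -
  have e: "axis k 1 \<bullet> (M *v axis l 1) = M $ k $ l" for k l
    by (simp add: inner_axis' matrix_vector_mult_basis column_def)
  have "M $ j $ i = M $ i $ j" using assms by (metis transpose_def vec_lambda_beta)
  then show ?thesis
    by (simp add: matrix_vector_right_distrib matrix_vector_mult_diff_distrib inner_simps e)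
qed

text \<open>
  Each value of the forms decreases and is nonnegative, hence converges; polarization transfers
  the convergence to the entries.
\<close>

lemma decreasing_forms_limit:
  fixes A :: "nat \<Rightarrow> real^'n^'n"
  assumes sym: "\<And>k. transpose (A k) = A k"
    and nonneg: "\<And>k x. 0 \<le> x \<bullet> (A k *v x)"
    and dec: "\<And>k x. x \<bullet> (A (Suc k) *v x) \<le> x \<bullet> (A k *v x)"
  obtains L where "transpose L = L" "\<And>x. (\<lambda>k. x \<bullet> (A k *v x)) \<longlonglongrightarrow> x \<bullet> (L *v x)"
    "\<And>k x. x \<bullet> (L *v x) \<le> x \<bullet> (A k *v x)"
proof -
  have ds: "decseq (\<lambda>k. x \<bullet> (A k *v x))" for x using dec by (rule decseq_SucI)
  have conv: "convergent (\<lambda>k. x \<bullet> (A k *v x))" for x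
  proof -
    obtain l where "(\<lambda>k. x \<bullet> (A k *v x)) \<longlonglongrightarrow> l"
      using decseq_convergent[OF ds, of 0] nonneg by metis
    then show ?thesis by (rule convergentI)
  qed
  have econv: "(\<lambda>k. A k $ i $ j) \<longlonglongrightarrow> lim (\<lambda>k. A k $ i $ j)" for i j
  proof -
    have "convergent (\<lambda>k. A k $ i $ j)"
      unfolding matrix_entry_polarization[OF sym] divide_inverse
      by (intro convergent_mult convergent_diff conv convergent_const)
    then show ?thesis by (simp add: convergent_LIMSEQ_iff)
  qed
  define L where "L = (\<chi> i j. lim (\<lambda>k. A k $ i $ j))"
  have symk: "A k $ j $ i = A k $ i $ j" for k i j using sym[of k] by (metis transpose_def vec_lambda_beta)
  have lim: "(\<lambda>k. x \<bullet> (A k *v x)) \<longlonglongrightarrow> x \<bullet> (L *v x)" for x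
    unfolding quadratic_form_sum L_def by (simp, intro tendsto_intros econv)
  show ?thesis
  proof
    show "transpose L = L" by (simp add: L_def transpose_def vec_eq_iff symk)
    show "(\<lambda>k. x \<bullet> (A k *v x)) \<longlonglongrightarrow> x \<bullet> (L *v x)" for x by (rule lim)
    show "x \<bullet> (L *v x) \<le> x \<bullet> (A k *v x)" for k x by (rule decseq_ge[OF ds lim])
  qed
qed

lemma orthonormal_expansion:
  fixes A :: "real^'n^'n"
  assumes w: "orthonormal_wrt A w" and A: "A \<in> pd"
  shows "x = (\<Sum>i\<in>UNIV. (w i \<bullet> (A *v x)) *\<^sub>R w i)"
proof -
  let ?W = "(\<chi> i. w i) :: real^'n^'n"
  have "transpose ?W *v c = (\<Sum>i\<in>UNIV. (c $ i) *\<^sub>R w i)" for c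
    by (simp add: vec_eq_iff matrix_vector_mult_def transpose_def mult.commute)
  moreover have "(?W *v v) $ i = w i \<bullet> v" for v i
    by (simp add: matrix_vector_mult_def inner_vec_def)
  ultimately have "(transpose ?W ** ?W) *v (A *v x) = (\<Sum>i\<in>UNIV. (w i \<bullet> (A *v x)) *\<^sub>R w i)"
    by (simp add: matrix_vector_mul_assoc[symmetric])
  then show ?thesis
    by (simp add: orthonormal_wrt_matrix_inv(2)[OF w, symmetric] matrix_inv_pd[OF A])
qed

text \<open>
  The conjugate description squeezes \<open>s\<close> between its value at the limit and
  \<open>2 x' y - x' A\<^sub>k x\<close> for the \<open>x\<close> that is optimal at the limit.
\<close>

lemma inv_form_tendsto_from_above:
  fixes A :: "nat \<Rightarrow> real^'n^'n"
  assumes pd: "\<And>k. A k \<in> pd" and L: "L \<in> pd"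
    and lim: "\<And>x. (\<lambda>k. x \<bullet> (A k *v x)) \<longlonglongrightarrow> x \<bullet> (L *v x)"
    and ge: "\<And>k x. x \<bullet> (L *v x) \<le> x \<bullet> (A k *v x)"
  shows "(\<lambda>k. inv_form (A k) y) \<longlonglongrightarrow> inv_form L y"
proof -
  obtain x where x: "inv_form L y = 2 * (x \<bullet> y) - x \<bullet> (L *v x)" using inv_form_attained[OF L] .
  show ?thesis
  proof (rule tendsto_sandwich)
    show "\<forall>\<^sub>F k in sequentially. 2 * (x \<bullet> y) - x \<bullet> (A k *v x) \<le> inv_form (A k) y"
      by (intro always_eventually allI inv_form_ge pd)
    show "\<forall>\<^sub>F k in sequentially. inv_form (A k) y \<le> inv_form L y"
      by (intro always_eventually allI inv_form_antimono pd L ge)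
    show "(\<lambda>k. 2 * (x \<bullet> y) - x \<bullet> (A k *v x)) \<longlonglongrightarrow> inv_form L y"
      unfolding x by (intro tendsto_intros lim)
  qed (rule tendsto_const)
qed

lemma limit_scatter_eq:
  fixes A :: "nat \<Rightarrow> real^'n^'n"
  assumes Q: "borel_prob Q" and \<nu>: "\<nu> > 0" and pd: "\<And>k. A k \<in> pd" and L: "L \<in> pd"
    and step: "\<And>k. A (Suc k) = scatter_map \<nu> Q (A k)"
    and dec: "\<And>k x. x \<bullet> (A (Suc k) *v x) \<le> x \<bullet> (A k *v x)"
    and lim: "\<And>x. (\<lambda>k. x \<bullet> (A k *v x)) \<longlonglongrightarrow> x \<bullet> (L *v x)"
    and ge: "\<And>k x. x \<bullet> (L *v x) \<le> x \<bullet> (A k *v x)"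
  shows "scatter_eq \<nu> Q L"
  unfolding scatter_eq_def
proof (intro conjI allI L)
  fix x :: "real^'n"
  have "(\<lambda>k. LINT y|Q. u \<nu> CARD('n) (inv_form (A k) y) * (x \<bullet> y)\<^sup>2)
      \<longlonglongrightarrow> (LINT y|Q. u \<nu> CARD('n) (inv_form L y) * (x \<bullet> y)\<^sup>2)"
  proof (rule integral_dominated_convergence[where w="\<lambda>y. u \<nu> CARD('n) (inv_form L y) * (x \<bullet> y)\<^sup>2
      + u \<nu> CARD('n) (inv_form (A 0) y) * (x \<bullet> y)\<^sup>2"])
    show "(\<lambda>y. u \<nu> CARD('n) (inv_form (A k) y) * (x \<bullet> y)\<^sup>2) \<in> borel_measurable Q" for k
      using integrable_weight_inner[OF Q \<nu> pd] by blast
    show "(\<lambda>y. u \<nu> CARD('n) (inv_form L y) * (x \<bullet> y)\<^sup>2) \<in> borel_measurable Q"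
      using integrable_weight_inner[OF Q \<nu> L] by blast
    show "integrable Q (\<lambda>y. u \<nu> CARD('n) (inv_form L y) * (x \<bullet> y)\<^sup>2
      + u \<nu> CARD('n) (inv_form (A 0) y) * (x \<bullet> y)\<^sup>2)"
      by (intro Bochner_Integration.integrable_add integrable_weight_inner[OF Q \<nu>] L pd)
    show "AE y in Q. (\<lambda>k. u \<nu> CARD('n) (inv_form (A k) y) * (x \<bullet> y)\<^sup>2)
        \<longlonglongrightarrow> u \<nu> CARD('n) (inv_form L y) * (x \<bullet> y)\<^sup>2"
    proof (rule AE_I2)
      fix y
      have "\<nu> + inv_form L y \<noteq> 0" using inv_form_nonneg[OF L, of y] \<nu> by simp
      then show "(\<lambda>k. u \<nu> CARD('n) (inv_form (A k) y) * (x \<bullet> y)\<^sup>2)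
        \<longlonglongrightarrow> u \<nu> CARD('n) (inv_form L y) * (x \<bullet> y)\<^sup>2"
        unfolding u_def by (intro tendsto_intros inv_form_tendsto_from_above[OF pd L lim ge]) auto
    qed
    have A0: "x \<bullet> (A k *v x) \<le> x \<bullet> (A 0 *v x)" for k x
      by (induction k) (use dec order_trans in blast)+
    show "AE y in Q. norm (u \<nu> CARD('n) (inv_form (A k) y) * (x \<bullet> y)\<^sup>2)
        \<le> u \<nu> CARD('n) (inv_form L y) * (x \<bullet> y)\<^sup>2 + u \<nu> CARD('n) (inv_form (A 0) y) * (x \<bullet> y)\<^sup>2" for k
    proof (rule AE_I2)
      fix y
      have p: "u \<nu> CARD('n) (inv_form B y) > 0" if "B \<in> pd" for B :: "real^'n^'n"
        by (intro u_pos \<nu> inv_form_nonneg that)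
      have "u \<nu> CARD('n) (inv_form (A k) y) \<le> u \<nu> CARD('n) (inv_form (A 0) y)"
        by (intro u_antimono \<nu> inv_form_nonneg pd inv_form_antimono A0)
      then have "u \<nu> CARD('n) (inv_form (A k) y) * (x \<bullet> y)\<^sup>2 \<le> u \<nu> CARD('n) (inv_form (A 0) y) * (x \<bullet> y)\<^sup>2"
        by (intro mult_right_mono) auto
      moreover have "0 \<le> u \<nu> CARD('n) (inv_form L y) * (x \<bullet> y)\<^sup>2" using p[OF L] by simp
      ultimately show "norm (u \<nu> CARD('n) (inv_form (A k) y) * (x \<bullet> y)\<^sup>2)
        \<le> u \<nu> CARD('n) (inv_form L y) * (x \<bullet> y)\<^sup>2 + u \<nu> CARD('n) (inv_form (A 0) y) * (x \<bullet> y)\<^sup>2"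
        using p[OF pd[of k]] by (simp add: abs_mult)
    qed
  qed
  moreover have "(\<lambda>k. LINT y|Q. u \<nu> CARD('n) (inv_form (A k) y) * (x \<bullet> y)\<^sup>2) \<longlonglongrightarrow> x \<bullet> (L *v x)"
    using LIMSEQ_Suc[OF lim[of x]] by (simp add: step scatter_map_form[OF Q \<nu> pd])
  ultimately show "x \<bullet> (L *v x) = (LINT y|Q. u \<nu> CARD('n) (inv_form L y) * (x \<bullet> y)\<^sup>2)"
    by (rule LIMSEQ_unique[symmetric])
qed

lemma eventually_inv_form_ge:
  fixes A :: "nat \<Rightarrow> real^'n^'n"
  assumes pd: "\<And>k. A k \<in> pd" and lim: "(\<lambda>k. e \<bullet> (A k *v e)) \<longlonglongrightarrow> 0" and y: "e \<bullet> y \<noteq> 0"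
  shows "filterlim (\<lambda>k. inv_form (A k) y) at_top sequentially"
  unfolding filterlim_at_top
proof (intro allI)
  fix M :: real
  \<comment> \<open>With this multiple of \<open>e\<close> the conjugate bound is \<open>2 (\<bar>M\<bar> + 1)\<close> minus a term that tends to \<open>0\<close>.\<close>
  define t where "t = (\<bar>M\<bar> + 1) / (e \<bullet> y)"
  have "(\<lambda>k. t\<^sup>2 * (e \<bullet> (A k *v e))) \<longlonglongrightarrow> t\<^sup>2 * 0" by (intro tendsto_intros lim)
  then have "\<forall>\<^sub>F k in sequentially. t\<^sup>2 * (e \<bullet> (A k *v e)) < 1" by (intro order_tendstoD) auto
  then show "\<forall>\<^sub>F k in sequentially. M \<le> inv_form (A k) y"
  proof eventually_elim
    case (elim k)
    have "2 * ((t *\<^sub>R e) \<bullet> y) - (t *\<^sub>R e) \<bullet> (A k *v (t *\<^sub>R e)) \<le> inv_form (A k) y"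
      by (rule inv_form_ge[OF pd])
    moreover have "(t *\<^sub>R e) \<bullet> y = \<bar>M\<bar> + 1" using y by (simp add: t_def)
    moreover have "(t *\<^sub>R e) \<bullet> (A k *v (t *\<^sub>R e)) = t\<^sup>2 * (e \<bullet> (A k *v e))"
      by (simp add: matrix_vector_mult_scaleR power2_eq_square)
    ultimately show ?case using elim by linarith
  qed
qed

text \<open>
  Diagonalize the limit \<open>L\<close> by orthonormal \<open>e\<^sub>i\<close> with eigenvalues \<open>l\<^sub>i\<close>, let \<open>Z\<close> be the set of \<open>i\<close>
  with \<open>l\<^sub>i = 0\<close>, let \<open>H\<close> be the range of \<open>L\<close>, and let \<open>r\<close> be the inverse form of \<open>L\<close> restricted to
  its range. With \<open>s\<^sub>k\<close> the inverse form of the \<open>k\<close>-th iterate and \<open>U\<^sub>k\<close> its weight, the trace of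
  \<open>A\<^sub>k\<^sup>-\<^sup>1 A\<^sub>k\<^sub>+\<^sub>1\<close>, which is \<open>\<integral> U\<^sub>k s\<^sub>k\<close>, is at most \<open>d\<close> because the iterates decrease, while
  \<open>\<integral> U\<^sub>k r\<close> converges to the rank of \<open>L\<close>. So the limit superior of \<open>\<integral> U\<^sub>k (s\<^sub>k - r)\<close> is at most
  \<open>card Z\<close>. On the other hand the integrand tends to \<open>a\<close> off \<open>H\<close>, where \<open>s\<^sub>k\<close> is unbounded, and
  is asymptotically nonnegative on \<open>H\<close>. Therefore \<open>a Q(H\<^sup>c) \<le> card Z\<close>, which the hypothesis on
  \<open>Q\<close> excludes unless \<open>Z\<close> is empty. Only one subspace is needed, although the small eigenvalues of
  the iterates may vanish at different rates.
\<close>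

lemma limit_pd:
  fixes A :: "nat \<Rightarrow> real^'n^'n"
  assumes Q: "Q \<in> \<U> (\<nu> + real CARD('n))" and \<nu>: "\<nu> > 0" and pd: "\<And>k. A k \<in> pd"
    and step: "\<And>k. A (Suc k) = scatter_map \<nu> Q (A k)"
    and dec: "\<And>k x. x \<bullet> (A (Suc k) *v x) \<le> x \<bullet> (A k *v x)"
    and sym: "transpose L = L"
    and lim: "\<And>x. (\<lambda>k. x \<bullet> (A k *v x)) \<longlonglongrightarrow> x \<bullet> (L *v x)"
    and ge: "\<And>k x. x \<bullet> (L *v x) \<le> x \<bullet> (A k *v x)"
  shows "L \<in> pd"
proof -
  have bQ: "borel_prob Q" using Q by (simp add: \<U>_def)
  interpret prob_space Q using bQ by (simp add: borel_prob_def)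
  have sQ: "sets Q = sets borel" using bQ by (simp add: borel_prob_def)
  define a where "a = \<nu> + real CARD('n)"
  have a: "a > 0" using \<nu> by (simp add: a_def)
  obtain e l where e: "orthonormal_wrt (mat 1) e" and l': "\<And>i. L *v e i = l i *\<^sub>R (mat 1 *v e i)"
    using simultaneous_diagonalization[OF mat_1_pd sym] by blast
  have l: "L *v e i = l i *\<^sub>R e i" for i using l' by simp
  have ee: "e i \<bullet> e j = (if i = j then 1 else 0)" for i j using e by (simp add: orthonormal_wrt_def)
  have eLe: "e i \<bullet> (L *v e i) = l i" for i by (simp add: l ee)
  have l0: "0 \<le> l i" for i
    using LIMSEQ_le_const[OF lim[of "e i"], of 0] pd_nonneg[OF pd] by (simp add: eLe)
  have expand: "x = (\<Sum>i\<in>UNIV. (e i \<bullet> x) *\<^sub>R e i)" for x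
    using orthonormal_expansion[OF e mat_1_pd, of x] by simp
  define Z where "Z = {i. l i = 0}"
  have "Z = {}"
  proof (rule ccontr)
    assume Z0: "Z \<noteq> {}"
    define H where "H = {y. \<forall>i\<in>Z. e i \<bullet> y = 0}"
    have subH: "subspace H" unfolding H_def subspace_def by (auto simp: inner_simps)
    have "H \<subseteq> span (e ` (- Z))"
    proof
      fix y assume y: "y \<in> H"
      have "y = (\<Sum>i\<in>- Z. (e i \<bullet> y) *\<^sub>R e i)"
        by (subst expand[of y], rule sum.mono_neutral_right) (use y in \<open>auto simp: H_def\<close>)
      also have "\<dots> \<in> span (e ` (- Z))" by (intro span_sum span_scale span_base) auto
      finally show "y \<in> span (e ` (- Z))" .
    qed
    then have "dim H \<le> card (e ` (- Z))" by (intro dim_le_card) auto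
    also have "\<dots> \<le> card (- Z)" by (intro card_image_le) simp
    finally have dimH: "dim H \<le> card (- Z)" .
    have cZ: "card Z + card (- Z) = CARD('n)"
      by (subst card_Un_disjoint[symmetric]) (auto simp: Compl_partition)
    have "card Z > 0" using Z0 by (simp add: card_gt_0_iff)
    then have dimlt: "dim H < DIM(real^'n)" using dimH cZ by simp
    then have "measure Q H < 1 - (real DIM(real^'n) - real (dim H)) / a"
      using Q subH unfolding \<U>_def a_def by blast
    also have "\<dots> \<le> 1 - real (card Z) / a"
    proof -
      have "real (card Z) \<le> real DIM(real^'n) - real (dim H)" using dimH cZ by simp
      then show ?thesis using a by (simp add: divide_right_mono)
    qed
    finally have QH: "real (card Z) < a * (1 - measure Q H)"
      using a by (simp add: field_simps)
    have Hm: "H \<in> sets borel" by (rule borel_closed[OF closed_subspace[OF subH]])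
    define s where "s k y = inv_form (A k) y" for k y
    have s0: "0 \<le> s k y" for k y unfolding s_def by (intro inv_form_nonneg pd)
    define r where "r y = (\<Sum>i\<in>- Z. (e i \<bullet> y)\<^sup>2 / l i)" for y
    have r0: "0 \<le> r y" for y unfolding r_def using l0 by (intro sum_nonneg) simp
    define U where "U k y = u \<nu> CARD('n) (s k y)" for k y
    have U0: "0 < U k y" for k y unfolding U_def by (intro u_pos \<nu> s0)
    have A0: "x \<bullet> (A k *v x) \<le> x \<bullet> (A 0 *v x)" for k x
      by (induction k) (use dec order_trans in blast)+
    have UU: "U k y \<le> U 0 y" for k y
      unfolding U_def s_def by (intro u_antimono \<nu> inv_form_nonneg pd inv_form_antimono A0)
    have Ub: "U k y \<le> a / \<nu>" for k y
      using u_antimono[OF \<nu> order_refl s0[of k y], of "CARD('n)"] by (simp add: U_def u_def a_def)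
    have iUr: "integrable Q (\<lambda>y. U k y * r y)" for k
      unfolding U_def r_def s_def sum_distrib_left times_divide_eq_right
      by (intro Bochner_Integration.integrable_sum integrable_divide integrable_weight_inner[OF bQ \<nu> pd])
    have iUs: "integrable Q (\<lambda>y. U k y * s k y)" for k
      unfolding U_def s_def by (intro integrable_weight_inv_form bQ \<nu> pd)
    define f where "f k y = U k y * s k y - U k y * r y" for k y
    have fi: "integrable Q (f k)" for k unfolding f_def by (intro Bochner_Integration.integrable_diff iUr iUs)
    have int_s: "(LINT y|Q. U k y * s k y) \<le> real CARD('n)" for k
    proof -
      obtain w where w: "orthonormal_wrt (A k) w" using orthonormal_wrt_exists[OF pd] .
      have "(LINT y|Q. U k y * s k y) = (LINT y|Q. (\<Sum>i\<in>UNIV. U k y * (w i \<bullet> y)\<^sup>2))"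
        by (simp add: s_def inv_form_orthonormal_wrt[OF w] sum_distrib_left)
      also have "\<dots> = (\<Sum>i\<in>UNIV. w i \<bullet> (A (Suc k) *v w i))"
        unfolding step scatter_map_form[OF bQ \<nu> pd] U_def s_def
        by (intro Bochner_Integration.integral_sum integrable_weight_inner[OF bQ \<nu> pd])
      also have "\<dots> \<le> (\<Sum>i\<in>(UNIV::'n set). 1)"
        using w by (intro sum_mono order_trans[OF dec]) (simp add: orthonormal_wrt_def)
      finally show ?thesis by simp
    qed
    have int_r: "(LINT y|Q. U k y * r y) = (\<Sum>i\<in>- Z. (e i \<bullet> (A (Suc k) *v e i)) / l i)" for k
    proof -
      have "(LINT y|Q. U k y * r y) = (LINT y|Q. (\<Sum>i\<in>- Z. U k y * (e i \<bullet> y)\<^sup>2 / l i))"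
        by (simp add: r_def sum_distrib_left)
      also have "\<dots> = (\<Sum>i\<in>- Z. (LINT y|Q. U k y * (e i \<bullet> y)\<^sup>2 / l i))"
        unfolding U_def s_def
        by (intro Bochner_Integration.integral_sum integrable_divide integrable_weight_inner[OF bQ \<nu> pd])
      also have "\<dots> = (\<Sum>i\<in>- Z. (e i \<bullet> (A (Suc k) *v e i)) / l i)"
        unfolding step scatter_map_form[OF bQ \<nu> pd] U_def s_def by simp
      finally show ?thesis .
    qed
    have "(\<lambda>k. LINT y|Q. U k y * r y) \<longlonglongrightarrow> (\<Sum>i\<in>- Z. (e i \<bullet> (L *v e i)) / l i)"
      unfolding int_r by (intro tendsto_intros LIMSEQ_Suc[OF lim]) (simp add: Z_def)
    also have "(\<Sum>i\<in>- Z. (e i \<bullet> (L *v e i)) / l i) = real (card (- Z))"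
      by (simp add: eLe Z_def)
    finally have lim_r: "(\<lambda>k. LINT y|Q. U k y * r y) \<longlonglongrightarrow> real (card (- Z))" .
    define h where "h y = a * indicator (- H) y" for y
    \<comment> \<open>Cutting \<open>f k\<close> off at \<open>h\<close> makes the pointwise limit exist everywhere; off \<open>H\<close> nothing is lost, since \<open>f k \<le> a\<close> there.\<close>
    define g where "g k y = min (f k y) (h y)" for k y
    have hm: "h \<in> borel_measurable Q" unfolding h_def[abs_def] using Hm sQ by measurable
    have gm: "g k \<in> borel_measurable Q" for k unfolding g_def[abs_def] using hm fi[of k] by measurable
    have hb: "0 \<le> h y" "h y \<le> a" for y using a by (auto simp: h_def indicator_def)
    have gb: "norm (g k y) \<le> a + U 0 y * r y" for k y
    proof -
      have "U k y * r y \<le> U 0 y * r y" using UU r0 by (intro mult_right_mono) auto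
      moreover have "0 \<le> U k y * s k y" using U0[of k y] s0[of k y] by simp
      ultimately have "- (U 0 y * r y) \<le> f k y" by (simp add: f_def)
      moreover have "0 \<le> U 0 y * r y" using U0[of 0 y] r0[of y] by simp
      ultimately show ?thesis using hb[of y] a unfolding g_def by (auto simp: min_def)
    qed
    have wi: "integrable Q (\<lambda>y. a + U 0 y * r y)" by (intro Bochner_Integration.integrable_add iUr) simp
    have lim_gy: "(\<lambda>k. g k y) \<longlonglongrightarrow> h y" for y
    proof (cases "y \<in> H")
      case True
      then have hy: "h y = 0" by (simp add: h_def)
      \<comment> \<open>For \<open>y\<close> in \<open>H\<close> this \<open>x\<close> maximizes \<open>2 x' y - x' L x\<close>, with value \<open>r y\<close>; so \<open>s k y\<close> is eventually not much smaller than \<open>r y\<close>.\<close>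
      define x where "x = (\<Sum>i\<in>- Z. ((e i \<bullet> y) / l i) *\<^sub>R e i)"
      have xy: "x \<bullet> y = r y" by (simp add: x_def r_def inner_sum_left power2_eq_square)
      have "L *v x = (\<Sum>i\<in>- Z. ((e i \<bullet> y) / l i) *\<^sub>R (L *v e i))"
        unfolding x_def linear_sum[OF matrix_vector_mul_linear] by (simp add: matrix_vector_mult_scaleR)
      also have "\<dots> = (\<Sum>i\<in>- Z. (e i \<bullet> y) *\<^sub>R e i)"
        by (intro sum.cong refl) (simp add: l Z_def)
      finally have "x \<bullet> (L *v x) = (\<Sum>i\<in>- Z. \<Sum>j\<in>- Z. (e i \<bullet> y) * (e j \<bullet> y) / l j * (e j \<bullet> e i))"
        by (simp add: x_def inner_sum_left inner_sum_right sum_distrib_left mult_ac)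
      also have "\<dots> = (\<Sum>i\<in>- Z. \<Sum>j\<in>- Z. if i = j then (e i \<bullet> y) * (e j \<bullet> y) / l j else 0)"
        by (intro sum.cong refl) (auto simp: ee)
      also have "\<dots> = r y" by (simp add: r_def power2_eq_square)
      finally have xLx: "x \<bullet> (L *v x) = r y" .
      define c where "c k = 2 * (x \<bullet> y) - x \<bullet> (A k *v x)" for k
      have c: "c \<longlonglongrightarrow> r y"
        using tendsto_diff[OF tendsto_const lim[of x], of "2 * (x \<bullet> y)"] by (simp add: c_def[abs_def] xLx xy)
      have cs: "c k \<le> s k y" for k unfolding c_def s_def by (rule inv_form_ge[OF pd])
      show ?thesis unfolding hy
      proof (rule tendsto_sandwich[of "\<lambda>k. min 0 (a / \<nu> * (c k - r y))" _ _ "\<lambda>_. 0"])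
        show "\<forall>\<^sub>F k in sequentially. min 0 (a / \<nu> * (c k - r y)) \<le> g k y"
        proof (intro always_eventually allI)
          fix k
          have "min 0 (a / \<nu> * (c k - r y)) \<le> U k y * (c k - r y)"
          proof (cases "c k - r y \<ge> 0")
            case True then show ?thesis using U0[of k y] by (simp add: min.coboundedI1)
          next
            case False
            then show ?thesis using Ub[of k y] by (intro min.coboundedI2 mult_right_mono_neg) auto
          qed
          also have "\<dots> \<le> f k y"
            unfolding f_def right_diff_distrib[symmetric] using U0[of k y] cs[of k] by (intro mult_left_mono) auto
          finally show "min 0 (a / \<nu> * (c k - r y)) \<le> g k y" by (simp add: g_def hy)
        qed
        show "\<forall>\<^sub>F k in sequentially. g k y \<le> 0" by (simp add: g_def hy)
        have "(\<lambda>k. min 0 (a / \<nu> * (c k - r y))) \<longlonglongrightarrow> min 0 (a / \<nu> * (r y - r y))"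
          by (intro tendsto_intros c)
        then show "(\<lambda>k. min 0 (a / \<nu> * (c k - r y))) \<longlonglongrightarrow> 0" by simp
      qed (rule tendsto_const)
    next
      case False
      then obtain i where i: "l i = 0" "e i \<bullet> y \<noteq> 0" by (auto simp: H_def Z_def)
      have hy: "h y = a" using False by (simp add: h_def)
      have "(\<lambda>k. e i \<bullet> (A k *v e i)) \<longlonglongrightarrow> 0" using lim[of "e i"] i by (simp add: eLe)
      from eventually_inv_form_ge[OF pd this i(2)]
      have "filterlim (\<lambda>k. s k y) at_top sequentially" by (simp add: s_def)
      then have "filterlim (\<lambda>k. \<nu> + s k y) at_top sequentially"
        by (rule filterlim_tendsto_add_at_top[OF tendsto_const])
      then have "(\<lambda>k. a * (\<nu> + r y) / (\<nu> + s k y)) \<longlonglongrightarrow> 0"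
        by (intro tendsto_divide_0[OF tendsto_const] filterlim_at_top_imp_at_infinity)
      then have "(\<lambda>k. a - a * (\<nu> + r y) / (\<nu> + s k y)) \<longlonglongrightarrow> a - 0" by (intro tendsto_intros)
      moreover have "f k y = a - a * (\<nu> + r y) / (\<nu> + s k y)" for k
      proof -
        have "\<nu> + s k y > 0" using s0[of k y] \<nu> by simp
        then show ?thesis
          by (simp add: f_def U_def u_def a_def[symmetric] diff_divide_distrib[symmetric]) (simp add: field_simps)
      qed
      ultimately have "(\<lambda>k. f k y) \<longlonglongrightarrow> a" by simp
      then have "(\<lambda>k. min (f k y) a) \<longlonglongrightarrow> min a a" by (intro tendsto_intros)
      then show ?thesis by (simp add: g_def hy)
    qed
    have "(\<lambda>k. LINT y|Q. g k y) \<longlonglongrightarrow> (LINT y|Q. h y)"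
      by (rule integral_dominated_convergence[OF hm gm wi]) (simp_all add: lim_gy gb[simplified])
    moreover have "(\<lambda>k. real CARD('n) - (LINT y|Q. U k y * r y)) \<longlonglongrightarrow> real CARD('n) - real (card (- Z))"
      by (intro tendsto_intros lim_r)
    moreover have "(LINT y|Q. g k y) \<le> real CARD('n) - (LINT y|Q. U k y * r y)" for k
    proof -
      have "integrable Q (g k)"
        by (rule Bochner_Integration.integrable_bound[OF wi gm])
          (intro AE_I2 order_trans[OF gb], simp)
      then have "(LINT y|Q. g k y) \<le> (LINT y|Q. f k y)"
        by (rule integral_mono[OF _ fi]) (simp add: g_def)
      also have "\<dots> = (LINT y|Q. U k y * s k y) - (LINT y|Q. U k y * r y)"
        unfolding f_def by (rule Bochner_Integration.integral_diff[OF iUs iUr])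
      finally show ?thesis using int_s[of k] by simp
    qed
    ultimately have "(LINT y|Q. h y) \<le> real CARD('n) - real (card (- Z))"
      by (intro LIMSEQ_le) auto
    moreover have "(LINT y|Q. h y) = a * (1 - measure Q H)"
    proof -
      have HQ: "H \<in> sets Q" using Hm sQ by simp
      have sp: "space Q = UNIV" using sQ sets_eq_imp_space_eq[of Q borel] by simp
      have "(LINT y|Q. h y) = a * measure Q (- H)"
        unfolding h_def by (simp add: sp)
      also have "measure Q (- H) = 1 - measure Q H"
        using prob_compl[OF HQ] by (simp add: sp Compl_eq_Diff_UNIV)
      finally show ?thesis .
    qed
    ultimately show False using QH cZ by linarith
  qed
  then have lpos: "l i > 0" for i using l0[of i] by (auto simp: Z_def less_le)
  show ?thesis
    unfolding pd_def
  proof (intro CollectI conjI allI impI sym)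
    fix x :: "real^'n" assume x: "x \<noteq> 0"
    have eL: "e i \<bullet> (L *v x) = l i * (e i \<bullet> x)" for i
      using dot_symmetric_matrix[OF sym, of "e i" x] by (simp add: l)
    have "x \<bullet> (L *v x) = (\<Sum>i\<in>UNIV. l i * (e i \<bullet> x)\<^sup>2)"
      by (subst (1) expand[of x]) (simp add: inner_sum_left eL power2_eq_square mult_ac)
    moreover have "\<exists>i. e i \<bullet> x \<noteq> 0"
      using expand[of x] x by (metis (no_types, lifting) scaleR_zero_left sum.neutral)
    then obtain i where "e i \<bullet> x \<noteq> 0" ..
    then have "(\<Sum>i\<in>UNIV. l i * (e i \<bullet> x)\<^sup>2) > 0"
      using lpos by (intro sum_pos2[of UNIV i]) (auto simp: less_imp_le)
    ultimately show "0 < x \<bullet> (L *v x)" by simp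
  qed
qed

theorem scatter_eq_exists:
  fixes Q :: "(real^'n) measure"
  assumes Q: "Q \<in> \<U> (\<nu> + real CARD('n))" and \<nu>: "\<nu> > 0"
  shows "\<exists>A. scatter_eq \<nu> Q A"
proof -
  have bQ: "borel_prob Q" using Q by (simp add: \<U>_def)
  have a: "\<nu> + real CARD('n) > 0" using \<nu> by simp
  obtain A :: "nat \<Rightarrow> real^'n^'n" where pd: "\<And>k. A k \<in> pd"
    and step: "\<And>k. A (Suc k) = scatter_map \<nu> Q (A k)"
    and dec: "\<And>k x. x \<bullet> (A (Suc k) *v x) \<le> x \<bullet> (A k *v x)"
    using decreasing_iterates[OF bQ \<nu> \<U>_hyperplane[OF Q a]] by blast
  obtain L where L: "transpose L = L" "\<And>x. (\<lambda>k. x \<bullet> (A k *v x)) \<longlonglongrightarrow> x \<bullet> (L *v x)"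
    "\<And>k x. x \<bullet> (L *v x) \<le> x \<bullet> (A k *v x)"
    using decreasing_forms_limit[of A, OF pd_symmetric[OF pd] pd_nonneg[OF pd] dec] by blast
  have "L \<in> pd" by (rule limit_pd[OF Q \<nu> pd step dec L])
  then show ?thesis using limit_scatter_eq[OF bQ \<nu> pd _ step dec L(2,3)] by blast
qed


section \<open>Consequences of the estimating equation\<close>

text \<open>
  The trace of the equation relative to \<open>A\<close> reads \<open>d = \<integral> u(s) s dQ\<close>, and
  \<open>u(s) s = \<nu> + d - \<nu> u(s)\<close>.
\<close>

lemma scatter_eq_weight_integral:
  fixes A :: "real^'n^'n"
  assumes Q: "borel_prob Q" and \<nu>: "\<nu> > 0" and A: "scatter_eq \<nu> Q A"
  shows "(LINT y|Q. u \<nu> CARD('n) (inv_form A y)) = 1"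
proof -
  interpret prob_space Q using Q by (simp add: borel_prob_def)
  have Apd: "A \<in> pd" using A by (simp add: scatter_eq_def)
  obtain w where w: "orthonormal_wrt A w" using orthonormal_wrt_exists[OF Apd] .
  have "real CARD('n) = (\<Sum>i\<in>UNIV. (LINT y|Q. u \<nu> CARD('n) (inv_form A y) * (w i \<bullet> y)\<^sup>2))"
    by (simp add: scatter_eq_orthonormal[OF A w])
  also have "\<dots> = (LINT y|Q. (\<Sum>i\<in>UNIV. u \<nu> CARD('n) (inv_form A y) * (w i \<bullet> y)\<^sup>2))"
    by (intro Bochner_Integration.integral_sum[symmetric] integrable_weight_inner Q \<nu> Apd)
  also have "\<dots> = (LINT y|Q. (\<nu> + real CARD('n)) - \<nu> * u \<nu> CARD('n) (inv_form A y))"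
    using u_mult_eq[OF \<nu> inv_form_nonneg[OF Apd], of "CARD('n)"]
    by (simp add: sum_distrib_left[symmetric] inv_form_orthonormal_wrt[OF w, symmetric])
  also have "\<dots> = (\<nu> + real CARD('n)) - \<nu> * (LINT y|Q. u \<nu> CARD('n) (inv_form A y))"
    using integrable_weight[OF Q \<nu> Apd, of "CARD('n)"]
    by (subst Bochner_Integration.integral_diff) (auto simp: prob_space)
  finally show ?thesis using \<nu> by simp
qed

lemma sum_inner_orthonormal_le:
  fixes B :: "'a::real_inner set"
  assumes fin: "finite B" and orth: "pairwise orthogonal B" and norm: "\<And>x. x \<in> B \<Longrightarrow> norm x = 1"
  shows "(\<Sum>x\<in>B. (x \<bullet> v)\<^sup>2) \<le> (norm v)\<^sup>2"
proof -
  define p where "p = (\<Sum>x\<in>B. (x \<bullet> v) *\<^sub>R x)"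
  have on: "x \<bullet> y = (if x = y then 1 else 0)" if "x \<in> B" "y \<in> B" for x y
    using orth norm that by (auto simp: pairwise_def orthogonal_def dot_square_norm)
  have pv: "p \<bullet> v = (\<Sum>x\<in>B. (x \<bullet> v)\<^sup>2)"
    by (simp add: p_def inner_sum_left power2_eq_square)
  have "x \<bullet> p = x \<bullet> v" if "x \<in> B" for x
  proof -
    have "x \<bullet> p = (\<Sum>y\<in>B. if x = y then y \<bullet> v else 0)"
      unfolding p_def inner_sum_right by (intro sum.cong refl) (simp add: on that)
    then show ?thesis using that fin by simp
  qed
  then have "p \<bullet> p = (\<Sum>x\<in>B. (x \<bullet> v)\<^sup>2)"
    by (subst p_def) (simp add: inner_sum_left power2_eq_square)
  moreover have "0 \<le> (v - p) \<bullet> (v - p)" by simp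
  ultimately show ?thesis
    using pv by (simp add: inner_simps power2_norm_eq_inner inner_commute)
qed

text \<open>
  Sum the equation over an \<open>A\<close>-orthonormal family \<open>c\<^sub>\<beta>\<close> of functionals that vanish on \<open>H\<close>; there are
  at least \<open>d - dim H\<close> of them. By Bessel's inequality the integrand \<open>g\<close> is at most \<open>u(s) s\<close>, which
  is less than \<open>a\<close>, and it vanishes on \<open>H\<close>. So \<open>d - dim H \<le> \<integral> g dQ < a Q(H\<^sup>c)\<close>, where the last
  inequality is strict because \<open>Q(H\<^sup>c) = 0\<close> would make the integral zero.
\<close>

lemma scatter_eq_imp_\<U>:
  fixes A :: "real^'n^'n"
  assumes Q: "borel_prob Q" and \<nu>: "\<nu> > 0" and A: "scatter_eq \<nu> Q A"
  shows "Q \<in> \<U> (\<nu> + real CARD('n))"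
  unfolding \<U>_def
proof (intro CollectI conjI allI impI Q)
  fix H :: "(real^'n) set"
  assume "subspace H \<and> dim H < DIM(real^'n)"
  then have subH: "subspace H" and dimH: "dim H < CARD('n)" by auto
  interpret prob_space Q using Q by (simp add: borel_prob_def)
  have sQ: "sets Q = sets borel" using Q by (simp add: borel_prob_def)
  have sp: "space Q = UNIV" using sQ sets_eq_imp_space_eq[of Q borel] by simp
  define a where "a = \<nu> + real CARD('n)"
  have a: "a > 0" using \<nu> by (simp add: a_def)
  have Apd: "A \<in> pd" using A by (simp add: scatter_eq_def)
  obtain w where w: "orthonormal_wrt A w" using orthonormal_wrt_exists[OF Apd] .
  define W :: "real^'n^'n" where "W = (\<chi> i. w i)"
  have Wy: "(W *v y) $ i = w i \<bullet> y" for y i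
    by (simp add: W_def matrix_vector_mult_def inner_vec_def)
  define V where "V = (\<lambda>h. W *v h) ` H"
  have subV: "subspace V" unfolding V_def by (intro linear_subspace_image subH matrix_vector_mul_linear)
  have dimV: "dim V \<le> dim H" unfolding V_def by (intro dim_image_le matrix_vector_mul_linear)
  define V' where "V' = {x \<in> UNIV. \<forall>v\<in>V. orthogonal v x}"
  have "dim V' + dim V = dim (UNIV :: (real^'n) set)"
    unfolding V'_def by (intro dim_subspace_orthogonal_to_vectors subV) auto
  then have dimV': "real (dim V') \<ge> real CARD('n) - real (dim H)" using dimV by simp
  have "subspace V'" unfolding V'_def subspace_def by (auto simp: orthogonal_def inner_simps)
  then obtain B where B: "B \<subseteq> V'" "pairwise orthogonal B" "\<And>x. x \<in> B \<Longrightarrow> norm x = 1"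
    "independent B" "card B = dim V'"
    using orthonormal_basis_subspace by metis
  have finB: "finite B" using B(4) by (rule independent_imp_finite)
  define c where "c \<beta> = (\<Sum>i\<in>UNIV. (\<beta> $ i) *\<^sub>R w i)" for \<beta> :: "real^'n"
  have cy: "c \<beta> \<bullet> y = \<beta> \<bullet> (W *v y)" for \<beta> y
    by (simp add: c_def inner_sum_left Wy inner_vec_def[of \<beta>])
  have cA: "c \<beta> \<bullet> (A *v c \<beta>) = 1" if "\<beta> \<in> B" for \<beta>
  proof -
    have "(W *v (A *v c \<beta>)) $ i = \<beta> $ i" for i
    proof -
      have "w i \<bullet> (A *v c \<beta>) = (\<Sum>j\<in>UNIV. \<beta> $ j * (w i \<bullet> (A *v w j)))"
        unfolding c_def linear_sum[OF matrix_vector_mul_linear]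
        by (simp add: inner_sum_right matrix_vector_mult_scaleR)
      also have "\<dots> = (\<Sum>j\<in>UNIV. if i = j then \<beta> $ j else 0)"
        using w by (intro sum.cong refl) (simp add: orthonormal_wrt_def)
      finally show ?thesis by (simp add: Wy)
    qed
    then have "W *v (A *v c \<beta>) = \<beta>" by (simp add: vec_eq_iff)
    then show ?thesis using B(3)[OF that] by (simp add: cy dot_square_norm)
  qed
  define U where "U y = u \<nu> CARD('n) (inv_form A y)" for y
  have U0: "0 < U y" for y unfolding U_def by (intro u_pos \<nu> inv_form_nonneg Apd)
  define g where "g y = (\<Sum>\<beta>\<in>B. U y * (c \<beta> \<bullet> y)\<^sup>2)" for y
  have gi: "integrable Q g"
    unfolding g_def U_def by (intro Bochner_Integration.integrable_sum integrable_weight_inner Q \<nu> Apd)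
  have int_g: "(LINT y|Q. g y) = real (card B)"
  proof -
    have "(LINT y|Q. g y) = (\<Sum>\<beta>\<in>B. c \<beta> \<bullet> (A *v c \<beta>))"
      unfolding g_def U_def using A integrable_weight_inner[OF Q \<nu> Apd]
      by (subst Bochner_Integration.integral_sum) (auto simp: scatter_eq_def)
    then show ?thesis using cA by simp
  qed
  have gH: "g y = 0" if "y \<in> H" for y
  proof -
    have "c \<beta> \<bullet> y = 0" if "\<beta> \<in> B" for \<beta>
    proof -
      have "orthogonal (W *v y) \<beta>" using B(1) that \<open>y \<in> H\<close> by (auto simp: V'_def V_def)
      then show ?thesis unfolding cy by (simp add: orthogonal_def inner_commute)
    qed
    then show ?thesis by (simp add: g_def)
  qed
  have g_less: "g y < a" for y
  proof -
    have "g y = U y * (\<Sum>\<beta>\<in>B. (\<beta> \<bullet> (W *v y))\<^sup>2)" by (simp add: g_def sum_distrib_left cy)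
    also have "\<dots> \<le> U y * (norm (W *v y))\<^sup>2"
      using U0[of y] by (intro mult_left_mono sum_inner_orthonormal_le finB B) auto
    also have "(norm (W *v y))\<^sup>2 = inv_form A y"
      unfolding W_def norm_row_matrix inv_form_orthonormal_wrt[OF w] ..
    also have "U y * inv_form A y = a - \<nu> * U y"
      unfolding U_def a_def by (intro u_mult_eq \<nu> inv_form_nonneg Apd)
    also have "\<dots> < a" using \<nu> U0[of y] by simp
    finally show ?thesis .
  qed
  have HQ: "H \<in> sets Q" unfolding sQ by (rule borel_closed[OF closed_subspace[OF subH]])
  define f where "f y = a * indicator (- H) y - g y" for y
  have HQ': "- H \<in> sets Q" using HQ sets.compl_sets[OF HQ] by (simp add: sp Compl_eq_Diff_UNIV)
  have ii: "integrable Q (\<lambda>y. a * indicator (- H) y)"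
    using HQ' by (intro integrable_mult_right integrable_real_indicator) (auto simp: less_top[symmetric])
  have fi: "integrable Q f" unfolding f_def by (intro Bochner_Integration.integrable_diff ii gi)
  have f0: "0 \<le> f y" for y using g_less[of y] gH[of y] by (cases "y \<in> H") (auto simp: f_def)
  have fpos: "f y > 0" if "y \<notin> H" for y using g_less[of y] that by (simp add: f_def)
  have int_f: "(LINT y|Q. f y) = a * (1 - measure Q H) - real (card B)"
  proof -
    have "(LINT y|Q. f y) = (LINT y|Q. a * indicator (- H) y) - (LINT y|Q. g y)"
      unfolding f_def by (rule Bochner_Integration.integral_diff[OF ii gi])
    moreover have "(LINT y|Q. a * indicator (- H) y) = a * measure Q (- H)" by (simp add: sp)
    moreover have "measure Q (- H) = 1 - measure Q H"
      using prob_compl[OF HQ] by (simp add: sp Compl_eq_Diff_UNIV)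
    ultimately show ?thesis using int_g by simp
  qed
  have "(LINT y|Q. f y) \<noteq> 0"
  proof
    assume "(LINT y|Q. f y) = 0"
    then have "AE y in Q. f y = 0" using integral_nonneg_eq_0_iff_AE[OF fi] f0 by simp
    then have "AE y in Q. y \<in> H" by eventually_elim (use fpos in \<open>auto simp: less_le\<close>)
    then have "measure Q H = 1" using HQ by (subst prob_eq_1) auto
    then have "real (card B) \<le> 0"
      using int_f Bochner_Integration.integral_nonneg[of Q f, OF f0] by simp
    moreover have "real (dim H) < real CARD('n)" using dimH by simp
    ultimately show False using dimV' unfolding B(5) by linarith
  qed
  then have "real (card B) < a * (1 - measure Q H)"
    using int_f Bochner_Integration.integral_nonneg[of Q f, OF f0] by simp
  then have "real CARD('n) - real (dim H) < a * (1 - measure Q H)" using dimV' B(5) by simp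
  then have "(real CARD('n) - real (dim H)) / a < 1 - measure Q H"
    using a by (simp add: divide_less_eq mult.commute)
  then show "measure Q H < 1 - (real DIM(real^'n) - real (dim H)) / (\<nu> + real CARD('n))"
    unfolding a_def by simp
qed

section \<open>Adjoining a coordinate\<close>

definition vcons :: "real^'n \<Rightarrow> real \<Rightarrow> real^('n option)" where
  "vcons x t = (\<chi> i. case i of Some k \<Rightarrow> x $ k | None \<Rightarrow> t)"

lemma vcons_nth [simp]: "vcons x t $ None = t" "vcons x t $ Some k = x $ k"
  by (simp_all add: vcons_def)

lemma vcons_exists: "\<exists>x t. z = vcons x t"
  by (rule exI[of _ "\<chi> k. z $ Some k"], rule exI[of _ "z $ None"])
    (simp add: vec_eq_iff vcons_def split: option.split)

lemma vcons_eq_iff [simp]: "vcons x t = vcons y s \<longleftrightarrow> x = y \<and> t = s"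
  by (metis vcons_nth vec_eq_iff)

lemma vcons_0: "vcons 0 0 = 0"
  by (simp add: vcons_def vec_eq_iff split: option.split)

lemma T1_eq_vcons: "T1 y = vcons y 1"
  by (simp add: T1_def vcons_def)

lemma sum_option: "(\<Sum>i\<in>(UNIV::'n::finite option set). f i) = f None + (\<Sum>k\<in>UNIV. f (Some k))"
  by (simp add: UNIV_option_conv sum.reindex)

lemma inner_vcons: "vcons x t \<bullet> vcons y s = x \<bullet> y + t * s"
  by (simp add: inner_vec_def sum_option)

lemma A_of_vcons:
  "A_of \<Sigma> \<mu> 1 *v vcons x t = vcons (\<Sigma> *v x + (\<mu> \<bullet> x + t) *\<^sub>R \<mu>) (\<mu> \<bullet> x + t)"
proof -
  have "(A_of \<Sigma> \<mu> 1 *v vcons x t) $ i = vcons (\<Sigma> *v x + (\<mu> \<bullet> x + t) *\<^sub>R \<mu>) (\<mu> \<bullet> x + t) $ i" for i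
    by (cases i) (simp_all add: matrix_vector_mult_def A_of_def sum_option inner_vec_def
        distrib_right sum.distrib sum_distrib_left mult_ac algebra_simps)
  then show ?thesis by (simp add: vec_eq_iff)
qed

lemma A_of_form:
  "vcons x t \<bullet> (A_of \<Sigma> \<mu> 1 *v vcons x t) = x \<bullet> (\<Sigma> *v x) + (\<mu> \<bullet> x + t)\<^sup>2"
  by (simp add: A_of_vcons inner_vcons inner_simps power2_eq_square inner_commute algebra_simps)

lemma A_of_pd:
  fixes \<Sigma> :: "real^'n^'n"
  assumes "\<Sigma> \<in> pd"
  shows "A_of \<Sigma> \<mu> 1 \<in> pd"
  unfolding pd_def
proof (intro CollectI conjI allI impI)
  have "\<Sigma> $ k $ l = \<Sigma> $ l $ k" for k l
    using pd_symmetric[OF assms] by (metis transpose_def vec_lambda_beta)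
  then have "transpose (A_of \<Sigma> \<mu> 1) $ i $ j = A_of \<Sigma> \<mu> 1 $ i $ j" for i j
    by (simp add: transpose_def A_of_def mult.commute split: option.split)
  then show "transpose (A_of \<Sigma> \<mu> 1) = A_of \<Sigma> \<mu> 1" by (simp add: vec_eq_iff)
  fix z :: "real^('n option)" assume z: "z \<noteq> 0"
  obtain x t where zx: "z = vcons x t" using vcons_exists by blast
  show "0 < z \<bullet> (A_of \<Sigma> \<mu> 1 *v z)"
  proof (cases "x = 0")
    case True
    then have "t \<noteq> 0" using z zx vcons_0 by auto
    then show ?thesis unfolding zx A_of_form using True by simp
  next
    case False
    then show ?thesis unfolding zx A_of_form using pd_pos[OF assms False] by (simp add: add_pos_nonneg)
  qed
qed

lemma inv_form_A_of:
  fixes \<Sigma> :: "real^'n^'n"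
  assumes S: "\<Sigma> \<in> pd"
  shows "inv_form (A_of \<Sigma> \<mu> 1) (T1 y) = 1 + inv_form \<Sigma> (y - \<mu>)"
proof -
  define p where "p = matrix_inv \<Sigma> *v (y - \<mu>)"
  have "A_of \<Sigma> \<mu> 1 *v vcons p (1 - \<mu> \<bullet> p) = T1 y"
    by (simp add: A_of_vcons T1_eq_vcons p_def matrix_inv_pd[OF S])
  from inv_form_eqI[OF A_of_pd[OF S] this] show ?thesis
    by (simp add: T1_eq_vcons inner_vcons inv_form_def p_def[symmetric] inner_simps)
qed

lemma A_of_inject:
  assumes "A_of \<Sigma> \<mu> 1 = A_of \<Sigma>' \<mu>' 1"
  shows "\<mu> = \<mu>'" "\<Sigma> = \<Sigma>'"
proof -
  have e: "A_of \<Sigma> \<mu> 1 $ i $ j = A_of \<Sigma>' \<mu>' 1 $ i $ j" for i j using assms by simp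
  show m: "\<mu> = \<mu>'" using e[of "Some _" None] by (simp add: A_of_def vec_eq_iff)
  show "\<Sigma> = \<Sigma>'" using e[of "Some _" "Some _"] m by (simp add: A_of_def vec_eq_iff)
qed

lemma A_of_surj:
  fixes A :: "real^('n::finite option)^('n option)"
  assumes A: "A \<in> pd" and A1: "A $ None $ None = 1"
  obtains \<mu> \<Sigma> where "\<Sigma> \<in> pd" "A = A_of \<Sigma> \<mu> 1"
proof -
  define \<mu> where "\<mu> = (\<chi> k. A $ Some k $ None)"
  define \<Sigma> where "\<Sigma> = (\<chi> k l. A $ Some k $ Some l - \<mu> $ k * \<mu> $ l)"
  have sym: "A $ i $ j = A $ j $ i" for i j
  proof -
    have "transpose A $ j $ i = A $ j $ i" by (simp add: pd_symmetric[OF A])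
    then show ?thesis by (simp add: transpose_def)
  qed
  have eq: "A = A_of \<Sigma> \<mu> 1"
    using A1 sym[of None "Some _"] by (simp add: vec_eq_iff A_of_def \<Sigma>_def \<mu>_def split: option.split)
  have "\<Sigma> \<in> pd"
    unfolding pd_def
  proof (intro CollectI conjI allI impI)
    show "transpose \<Sigma> = \<Sigma>" using sym by (simp add: vec_eq_iff transpose_def \<Sigma>_def mult.commute)
    fix x :: "real^'n" assume "x \<noteq> 0"
    then have "vcons x (- (\<mu> \<bullet> x)) \<noteq> 0" by (metis vcons_0 vcons_eq_iff)
    from pd_pos[OF A this] show "0 < x \<bullet> (\<Sigma> *v x)" unfolding eq A_of_form by simp
  qed
  with eq that show ?thesis by blast
qed

text \<open>
  This matrix is \<open>L' L\<close>, where \<open>L\<close> arises from the identity by adding multiples of other rows to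
  the last one.
\<close>

lemma det_A_of_mat_1:
  fixes \<mu> :: "real^'n"
  shows "det (A_of (mat 1) \<mu> 1) = 1"
proof -
  define L :: "real^('n option)^('n option)" where
    "L = (\<chi> i. if i = None then row None (mat 1) + vcons \<mu> 0 else row i (mat 1))"
  have "vcons \<mu> 0 = (\<Sum>k\<in>UNIV. \<mu> $ k *s row (Some k) (mat 1))"
  proof -
    have "vcons \<mu> 0 $ i = (\<Sum>k\<in>UNIV. \<mu> $ k *s row (Some k) (mat 1)) $ i" for i
      by (cases i) (simp_all add: row_def mat_def if_distrib cong: if_cong)
    then show ?thesis by (simp add: vec_eq_iff)
  qed
  also have "\<dots> \<in> vec.span {row j (mat 1) |j. j \<noteq> None}"
    by (intro vec.span_sum vec.span_scale vec.span_base) auto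
  finally have "det L = det (mat 1 :: real^('n option)^('n option))"
    unfolding L_def by (rule det_row_span)
  then have L1: "det L = 1" by simp
  have Lrow: "L $ i = (case i of None \<Rightarrow> vcons \<mu> 1 | Some k \<Rightarrow> vcons (axis k 1) 0)" for i
    by (cases i) (auto simp: L_def row_def mat_def vec_eq_iff vcons_def axis_def split: option.split)
  have "transpose L ** L = A_of (mat 1) \<mu> 1"
  proof -
    have delta: "(if P then 1 else 0) * x = (if P then x else (0::real))" for P x by simp
    have "(transpose L ** L) $ i $ j = A_of (mat 1) \<mu> 1 $ i $ j" for i j
      by (cases i; cases j)
        (simp_all add: matrix_matrix_mult_def transpose_def sum_option Lrow A_of_def axis_def mat_def delta)
    then show ?thesis by (simp add: vec_eq_iff)
  qed
  then have "det (A_of (mat 1) \<mu> 1 :: real^('n option)^('n option)) = det (transpose L) * det L"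
    by (metis det_mul)
  then show ?thesis by (simp add: L1)
qed

text \<open>
  An orthonormal eigenbasis of \<open>\<Sigma>\<close> lifts to a family that diagonalizes \<open>A_of \<Sigma> \<mu> 1\<close> relative to
  \<open>A_of (mat 1) \<mu> 1\<close>, with the eigenvalues of \<open>\<Sigma>\<close> and one additional eigenvalue \<open>1\<close>.
\<close>

lemma det_A_of:
  fixes \<Sigma> :: "real^'n^'n"
  assumes S: "\<Sigma> \<in> pd"
  shows "det (A_of \<Sigma> \<mu> 1) = det \<Sigma>"
proof -
  obtain e l where e: "orthonormal_wrt (mat 1) e" and l: "\<And>i. \<Sigma> *v e i = l i *\<^sub>R (mat 1 *v e i)"
    using simultaneous_diagonalization[OF mat_1_pd pd_symmetric[OF S]] by blast
  have ee: "e i \<bullet> e j = (if i = j then 1 else 0)" for i j using e by (simp add: orthonormal_wrt_def)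
  define e' where "e' i = (case i of None \<Rightarrow> vcons 0 1 | Some k \<Rightarrow> vcons (e k) (- (\<mu> \<bullet> e k)))" for i
  define l' where "l' i = (case i of None \<Rightarrow> 1 | Some k \<Rightarrow> l k)" for i
  have e'1: "orthonormal_wrt (A_of (mat 1) \<mu> 1) e'"
    unfolding orthonormal_wrt_def
    by (auto simp: e'_def A_of_vcons inner_vcons ee inner_commute split: option.split)
  have vs: "c *\<^sub>R vcons x t = vcons (c *\<^sub>R x) (c * t)" for c x t
    by (simp add: vec_eq_iff vcons_def split: option.split)
  have "A_of \<Sigma> \<mu> 1 *v e' i = l' i *\<^sub>R (A_of (mat 1) \<mu> 1 *v e' i)" for i
    by (cases i) (simp_all add: e'_def l'_def A_of_vcons vs l)
  from det_diagonalized[OF e'1 this]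
  have "det (A_of \<Sigma> \<mu> 1) = (\<Prod>i\<in>UNIV. l' i)" by (simp add: det_A_of_mat_1)
  also have "\<dots> = (\<Prod>k\<in>UNIV. l k)"
    by (simp add: UNIV_option_conv prod.reindex l'_def)
  also have "\<dots> = det \<Sigma>" using det_diagonalized[OF e l] by simp
  finally show ?thesis .
qed

text \<open>
  The image of \<open>T1\<close> lies in a hyperplane that misses the origin, so adding the origin raises the
  dimension by one.
\<close>

lemma aff_dim_insert_0_T1:
  fixes J :: "(real^'n) set"
  shows "aff_dim (insert 0 (T1 ` J)) = aff_dim J + 1"
proof -
  have lin: "linear (\<lambda>y::real^'n. vcons y 0)"
    by (rule linearI) (simp_all add: vec_eq_iff vcons_def split: option.split)
  have inj: "inj (\<lambda>y::real^'n. vcons y 0)" by (rule injI) simp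
  have "T1 y = vcons 0 1 + vcons y 0" for y :: "real^'n"
    by (simp add: T1_eq_vcons vec_eq_iff vcons_def split: option.split)
  then have "T1 ` J = (+) (vcons 0 1) ` ((\<lambda>y. vcons y 0) ` J)" by (simp add: image_image)
  then have dim: "aff_dim (T1 ` J) = aff_dim J"
    by (simp only: aff_dim_translation_eq aff_dim_injective_linear_image[OF lin inj])
  have "affine {z :: real^('n option). axis None 1 \<bullet> z = 1}" by (rule affine_hyperplane)
  moreover have "T1 ` J \<subseteq> {z. axis None 1 \<bullet> z = 1}" by (auto simp: T1_eq_vcons inner_axis')
  ultimately have "affine hull (T1 ` J) \<subseteq> {z. axis None 1 \<bullet> z = 1}" by (intro hull_minimal)
  then have "0 \<notin> affine hull (T1 ` J)" by auto
  then show ?thesis by (simp add: aff_dim_insert dim)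
qed

lemma continuous_on_T1: "continuous_on S (T1 :: real^'n \<Rightarrow> real^('n option))"
proof -
  have "continuous_on S (\<lambda>y::real^'n. \<chi> i. case i of Some k \<Rightarrow> y $ k | None \<Rightarrow> 1)"
  proof (intro continuous_on_vec_lambda)
    fix i :: "'n option"
    show "continuous_on S (\<lambda>y::real^'n. case i of Some k \<Rightarrow> y $ k | None \<Rightarrow> 1)"
      by (cases i) (auto intro!: continuous_intros)
  qed
  then show ?thesis by (simp add: T1_def[abs_def])
qed

lemma T1_measurable: "borel_prob P \<Longrightarrow> T1 \<in> measurable P borel"
  using borel_measurable_continuous_onI[OF continuous_on_T1]
  by (simp add: borel_prob_def measurable_cong_sets[of P borel])

lemma borel_prob_distr_T1:
  assumes "borel_prob P"
  shows "borel_prob (distr P borel T1)"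
proof -
  interpret prob_space P using assms by (simp add: borel_prob_def)
  show ?thesis
    unfolding borel_prob_def using prob_space_distr[OF T1_measurable[OF assms]] by simp
qed

lemma measure_distr_T1:
  assumes P: "borel_prob P" and "H \<in> sets borel"
  shows "measure (distr P borel T1) H = measure P (T1 -` H)"
proof -
  have "space P = UNIV" using P sets_eq_imp_space_eq[of P borel] by (simp add: borel_prob_def)
  then show ?thesis using measure_distr[OF T1_measurable[OF P] assms(2)] by simp
qed

text \<open>
  A linear subspace \<open>H\<close> pulls back under \<open>T1\<close> to an affine subspace of dimension at most
  \<open>dim H - 1\<close>, and an affine subspace \<open>J\<close> of dimension \<open>q\<close> spans a linear subspace of dimension
  \<open>q + 1\<close>. Hence the two families of conditions correspond with the same \<open>a\<close>. The hypothesis on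
  \<open>a\<close> is used for subspaces that do not meet the image of \<open>T1\<close>: they have mass \<open>0\<close>, and the
  bound has to be positive.
\<close>

lemma distr_T1_in_\<U>_iff:
  fixes P :: "(real^'n) measure"
  assumes P: "borel_prob P" and a: "a > real CARD('n) + 1"
  shows "distr P borel T1 \<in> \<U> a \<longleftrightarrow> P \<in> \<V> a"
proof
  let ?Q = "distr P borel T1"
  interpret prob_space P using P by (simp add: borel_prob_def)
  have sP: "sets P = sets borel" using P by (simp add: borel_prob_def)
  assume Q: "?Q \<in> \<U> a"
  show "P \<in> \<V> a"
    unfolding \<V>_def
  proof (intro CollectI conjI allI impI P)
    fix J :: "(real^'n) set" and q
    assume "affine J \<and> aff_dim J = int q \<and> q < DIM(real^'n)"
    then have q: "aff_dim J = int q" "q < CARD('n)" by auto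
    define H where "H = span (T1 ` J)"
    have subH: "subspace H" by (simp add: H_def)
    have "int (dim H) = aff_dim (insert 0 (T1 ` J))"
      unfolding H_def by (subst aff_dim_zero) (simp add: hull_inc, metis dim_span span_insert_0)
    then have dimH: "dim H = q + 1" using q by (simp add: aff_dim_insert_0_T1)
    have Hm: "H \<in> sets borel" by (rule borel_closed[OF closed_subspace[OF subH]])
    have "T1 -` H \<inter> space P \<in> sets P" by (rule measurable_sets[OF T1_measurable[OF P] Hm])
    moreover have "space P = UNIV" using sP sets_eq_imp_space_eq[of P borel] by simp
    moreover have "J \<subseteq> T1 -` H" by (auto simp: H_def intro: span_base)
    ultimately have "measure P J \<le> measure P (T1 -` H)" by (intro finite_measure_mono) auto
    also have "\<dots> = measure ?Q H" by (simp add: measure_distr_T1[OF P Hm])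
    also have "\<dots> < 1 - (real DIM(real^('n option)) - real (dim H)) / a"
      using Q subH dimH q(2) unfolding \<U>_def by auto
    finally show "measure P J < 1 - (real DIM(real^'n) - real q) / a"
      by (simp add: dimH)
  qed
next
  let ?Q = "distr P borel T1"
  assume PV: "P \<in> \<V> a"
  show "?Q \<in> \<U> a"
    unfolding \<U>_def
  proof (intro CollectI conjI allI impI borel_prob_distr_T1 P)
    fix H :: "(real^('n option)) set"
    assume "subspace H \<and> dim H < DIM(real^('n option))"
    then have subH: "subspace H" and dimH: "dim H \<le> CARD('n)" by auto
    have Hm: "H \<in> sets borel" by (rule borel_closed[OF closed_subspace[OF subH]])
    define J where "J = (T1 :: real^'n \<Rightarrow> _) -` H"
    have a0: "a > 0" using a by simp
    have "measure P J < 1 - (real CARD('n) + 1 - real (dim H)) / a"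
    proof (cases "J = {}")
      case True
      have "(real CARD('n) + 1 - real (dim H)) / a < 1" using a a0 by simp
      then show ?thesis using True by simp
    next
      case False
      have aff: "affine J"
        unfolding affine_def
      proof (intro ballI allI impI)
        fix x y and s t :: real assume "x \<in> J" "y \<in> J" "s + t = 1"
        moreover have "T1 (s *\<^sub>R x + t *\<^sub>R y) = s *\<^sub>R T1 x + t *\<^sub>R T1 y" if "s + t = 1"
          using that by (simp add: T1_eq_vcons vec_eq_iff vcons_def split: option.split)
        ultimately show "s *\<^sub>R x + t *\<^sub>R y \<in> J"
          using subH by (simp add: J_def subspace_add subspace_scale)
      qed
      obtain q where q: "aff_dim J = int q"
      proof -
        have "aff_dim J \<ge> 0" using aff_dim_geq[of J] aff_dim_empty[of J] False by linarith
        then show thesis using that nonneg_int_cases by blast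
      qed
      have "insert 0 (T1 ` J) \<subseteq> H" using subspace_0[OF subH] by (auto simp: J_def)
      then have "aff_dim (insert 0 (T1 ` J)) \<le> aff_dim H" by (rule aff_dim_subset)
      then have q1: "q + 1 \<le> dim H" by (simp add: aff_dim_insert_0_T1 q aff_dim_subspace[OF subH])
      then have "measure P J < 1 - (real DIM(real^'n) - real q) / a"
        using PV aff q dimH unfolding \<V>_def by auto
      also have "\<dots> \<le> 1 - (real CARD('n) + 1 - real (dim H)) / a"
        using q1 a0 by (simp add: divide_right_mono)
      finally show ?thesis .
    qed
    then show "measure ?Q H < 1 - (real DIM(real^('n option)) - real (dim H)) / a"
      by (simp add: measure_distr_T1[OF P Hm] J_def add.commute)
  qed
qed


section \<open>Location and scatter\<close>

lemma u_shift: "u (\<nu> - 1) (d + 1) (1 + s) = u \<nu> d s"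
  by (simp add: u_def algebra_simps)

lemma u_A_of:
  fixes \<Sigma> :: "real^'n^'n"
  assumes "\<Sigma> \<in> pd"
  shows "u (\<nu> - 1) (CARD('n) + 1) (inv_form (A_of \<Sigma> \<mu> 1) (T1 y)) = u \<nu> CARD('n) (inv_form \<Sigma> (y - \<mu>))"
  unfolding inv_form_A_of[OF assms] by (rule u_shift)

lemma integral_distr_T1:
  fixes f :: "real^('n::finite option) \<Rightarrow> real"
  assumes "borel_prob P" "f \<in> borel_measurable borel"
  shows "(LINT z|distr P borel T1. f z) = (LINT y|P. f (T1 y))"
    and "integrable (distr P borel T1) f \<longleftrightarrow> integrable P (\<lambda>y. f (T1 y))"
  using integral_distr[OF T1_measurable[OF assms(1)] assms(2)]
    integrable_distr_eq[OF T1_measurable[OF assms(1)] assms(2)] by simp_all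

text \<open>
  Lowering \<open>\<nu>\<close> by one compensates for raising both \<open>s\<close> and the dimension by one, so the integrands
  agree exactly and not only up to a constant.
\<close>

lemma h_ls_eq:
  fixes \<Sigma> :: "real^'n^'n"
  assumes \<nu>: "\<nu> > 1" and S: "\<Sigma> \<in> pd"
  shows "h_ls \<nu> y (\<mu>, \<Sigma>) = ln (det (A_of \<Sigma> \<mu> 1)) / 2 +
    (\<rho> (\<nu> - 1) CARD('n option) (inv_form (A_of \<Sigma> \<mu> 1) (T1 y)) - \<rho> (\<nu> - 1) CARD('n option) (T1 y \<bullet> T1 y))"
proof -
  have s: "inv_form \<Sigma> (y - \<mu>) \<ge> 0" by (rule inv_form_nonneg[OF S])
  have yy: "T1 y \<bullet> T1 y = 1 + y \<bullet> y" by (simp add: T1_eq_vcons inner_vcons)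
  have y0: "0 \<le> y \<bullet> y" by simp
  have "\<rho> (\<nu> - 1) CARD('n option) (1 + inv_form \<Sigma> (y - \<mu>)) - \<rho> (\<nu> - 1) CARD('n option) (1 + y \<bullet> y)
      = \<rho> \<nu> CARD('n) (inv_form \<Sigma> (y - \<mu>)) - \<rho> \<nu> CARD('n) (y \<bullet> y)"
    using \<nu> s y0 by (subst (1 2) \<rho>_diff) (auto simp: algebra_simps)
  then show ?thesis
    by (simp add: h_ls_def \<rho>_ls_def det_A_of[OF S] inv_form_A_of[OF S] yy inv_form_mat_1)
qed

lemma integrable_h_ls:
  fixes \<Sigma> :: "real^'n^'n"
  assumes P: "borel_prob P" and \<nu>: "\<nu> > 1" and S: "\<Sigma> \<in> pd"
  shows "integrable P (\<lambda>y. h_ls \<nu> y (\<mu>, \<Sigma>))"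
    and "(LINT y|P. h_ls \<nu> y (\<mu>, \<Sigma>)) = Qh (\<nu> - 1) (distr P borel T1) (A_of \<Sigma> \<mu> 1)"
proof -
  interpret prob_space P using P by (simp add: borel_prob_def)
  let ?f = "\<lambda>z :: real^('n option). \<rho> (\<nu> - 1) CARD('n option) (inv_form (A_of \<Sigma> \<mu> 1) z) - \<rho> (\<nu> - 1) CARD('n option) (z \<bullet> z)"
  have \<nu>': "\<nu> - 1 > 0" using \<nu> by simp
  have fm: "?f \<in> borel_measurable borel" by measurable
  have "integrable (distr P borel T1) ?f"
    using integrable_\<rho>_diff[OF borel_prob_distr_T1[OF P] \<nu>' A_of_pd[OF S] mat_1_pd] by (simp add: inv_form_mat_1)
  then have i: "integrable P (\<lambda>y. ?f (T1 y))" using integral_distr_T1(2)[OF P fm] by simp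
  show "integrable P (\<lambda>y. h_ls \<nu> y (\<mu>, \<Sigma>))"
    unfolding h_ls_eq[OF \<nu> S] by (intro Bochner_Integration.integrable_add i) simp
  have "(LINT y|P. h_ls \<nu> y (\<mu>, \<Sigma>)) = ln (det (A_of \<Sigma> \<mu> 1)) / 2 + (LINT y|P. ?f (T1 y))"
    unfolding h_ls_eq[OF \<nu> S] by (subst Bochner_Integration.integral_add[OF _ i]) (auto simp: prob_space)
  then show "(LINT y|P. h_ls \<nu> y (\<mu>, \<Sigma>)) = Qh (\<nu> - 1) (distr P borel T1) (A_of \<Sigma> \<mu> 1)"
    unfolding Qh_def integral_distr_T1(1)[OF P fm] .
qed

text \<open>
  Translations of \<open>\<mu>\<close> give \<open>\<integral> u (y - \<mu>) dP = 0\<close>, rank one updates of \<open>\<Sigma>\<close> give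
  \<open>\<integral> u (y - \<mu>)(y - \<mu>)' dP = \<Sigma>\<close>, and the trace of the latter gives \<open>\<integral> u dP = 1\<close>. These are the
  blocks of the equation in dimension \<open>d + 1\<close>, although \<open>A_of \<Sigma> \<mu> 1\<close> cannot be varied in all
  directions of that space.
\<close>

lemma location_scatter_critical_imp_scatter_eq:
  fixes P :: "(real^'n) measure"
  assumes P: "borel_prob P" and \<nu>: "\<nu> > 1"
    and crit: "critical_point_on (\<lambda>\<theta>. LINT y|P. h_ls \<nu> y \<theta>) (UNIV \<times> pd) (\<mu>, \<Sigma>)"
  shows "scatter_eq (\<nu> - 1) (distr P borel T1) (A_of \<Sigma> \<mu> 1)"
proof -
  let ?F = "\<lambda>\<theta>. LINT y|P. h_ls \<nu> y \<theta>"
  let ?Q = "distr P borel T1 :: (real^('n option)) measure"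
  interpret prob_space P using P by (simp add: borel_prob_def)
  have \<nu>': "\<nu> - 1 > 0" and \<nu>0: "\<nu> > 0" using \<nu> by simp_all
  have bQ: "borel_prob ?Q" by (rule borel_prob_distr_T1[OF P])
  have S: "\<Sigma> \<in> pd" using crit by (simp add: critical_point_on_def)
  have A: "A_of \<Sigma> \<mu> 1 \<in> pd" by (rule A_of_pd[OF S])
  define s where "s y = inv_form \<Sigma> (y - \<mu>)" for y
  define U where "U y = u \<nu> CARD('n) (s y)" for y
  have UA: "u (\<nu> - 1) CARD('n option) (inv_form (A_of \<Sigma> \<mu> 1) (T1 y)) = U y" for y
    using u_A_of[OF S, of \<nu> \<mu> y] by (simp add: U_def s_def)
  have int_sq: "integrable P (\<lambda>y. U y * (p \<bullet> (y - \<mu>) + m)\<^sup>2)"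
    "(LINT z|?Q. u (\<nu> - 1) CARD('n option) (inv_form (A_of \<Sigma> \<mu> 1) z) * (vcons p (m - \<mu> \<bullet> p) \<bullet> z)\<^sup>2)
      = (LINT y|P. U y * (p \<bullet> (y - \<mu>) + m)\<^sup>2)" for p m
  proof -
    \<comment> \<open>Every vector of the larger space has the form \<open>vcons p (m - \<mu> \<bullet> p)\<close>, in which the functional is centred at \<open>\<mu>\<close>.\<close>
    have eq: "vcons p (m - \<mu> \<bullet> p) \<bullet> T1 y = p \<bullet> (y - \<mu>) + m" for y
      by (simp add: T1_eq_vcons inner_vcons inner_simps inner_commute)
    have me: "(\<lambda>z. u (\<nu> - 1) CARD('n option) (inv_form (A_of \<Sigma> \<mu> 1) z) * (vcons p (m - \<mu> \<bullet> p) \<bullet> z)\<^sup>2)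
        \<in> borel_measurable borel" by measurable
    show "integrable P (\<lambda>y. U y * (p \<bullet> (y - \<mu>) + m)\<^sup>2)"
      using integrable_weight_inner[OF bQ \<nu>' A, of "CARD('n option)" "vcons p (m - \<mu> \<bullet> p)"]
      unfolding integral_distr_T1(2)[OF P me] UA eq .
    show "(LINT z|?Q. u (\<nu> - 1) CARD('n option) (inv_form (A_of \<Sigma> \<mu> 1) z) * (vcons p (m - \<mu> \<bullet> p) \<bullet> z)\<^sup>2)
      = (LINT y|P. U y * (p \<bullet> (y - \<mu>) + m)\<^sup>2)"
      unfolding integral_distr_T1(1)[OF P me] UA eq ..
  qed
  have iU: "integrable P U" using int_sq(1)[of 0 1] by simp
  have iU2: "integrable P (\<lambda>y. U y * (p \<bullet> (y - \<mu>))\<^sup>2)" for p using int_sq(1)[of p 0] by simp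
  have iU1: "integrable P (\<lambda>y. U y * (p \<bullet> (y - \<mu>)))" for p
  proof -
    have "U y * (p \<bullet> (y - \<mu>)) = (U y * (p \<bullet> (y - \<mu>) + 1)\<^sup>2 - U y * (p \<bullet> (y - \<mu>))\<^sup>2 - U y) / 2" for y
      by (simp add: power2_eq_square algebra_simps)
    then show ?thesis
      by (simp only:) (intro integrable_divide Bochner_Integration.integrable_diff iU iU2 int_sq(1))
  qed
  have upper: "?F (\<mu>', \<Sigma>') - ?F (\<mu>, \<Sigma>) \<le> (ln (det \<Sigma>') - ln (det \<Sigma>)) / 2 +
      (LINT y|P. U y * (inv_form \<Sigma>' (y - \<mu>') - s y)) / 2" if S': "\<Sigma>' \<in> pd" for \<mu>' \<Sigma>'
  proof -
    have me: "(\<lambda>z. u (\<nu> - 1) CARD('n option) (inv_form (A_of \<Sigma> \<mu> 1) z) *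
        (inv_form (A_of \<Sigma>' \<mu>' 1) z - inv_form (A_of \<Sigma> \<mu> 1) z)) \<in> borel_measurable borel"
      by measurable
    have "(LINT z|?Q. u (\<nu> - 1) CARD('n option) (inv_form (A_of \<Sigma> \<mu> 1) z) *
        (inv_form (A_of \<Sigma>' \<mu>' 1) z - inv_form (A_of \<Sigma> \<mu> 1) z))
      = (LINT y|P. U y * (inv_form \<Sigma>' (y - \<mu>') - s y))"
      unfolding integral_distr_T1(1)[OF P me] UA by (simp add: inv_form_A_of S S' s_def)
    then show ?thesis
      using Qh_diff_le_linearized[OF bQ \<nu>' A A_of_pd[OF S'], of \<mu>']
      by (simp add: integrable_h_ls(2)[OF P \<nu>] S S' det_A_of)
  qed
  have second: "(LINT y|P. U y * (w \<bullet> (y - \<mu>))\<^sup>2) = 1" if w: "w \<bullet> (\<Sigma> *v w) = 1" for w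
  proof -
    define K where "K = (LINT y|P. U y * (w \<bullet> (y - \<mu>))\<^sup>2)"
    define \<gamma> where "\<gamma> t = (\<mu>, \<Sigma> + t *\<^sub>R outer (\<Sigma> *v w))" for t
    define R where "R t = ln (1 + t) / 2 - t / (1 + t) * K / 2" for t
    have "1 / 2 - K / 2 = 0"
    proof (rule critical_point_upper_curve[OF crit, of \<gamma> "(0, outer (\<Sigma> *v w))" 1 R])
      show "(\<gamma> has_vector_derivative (0, outer (\<Sigma> *v w))) (at 0)"
        unfolding \<gamma>_def[abs_def] by (intro has_vector_derivative_Pair) (auto intro!: derivative_eq_intros)
      show "\<gamma> 0 = (\<mu>, \<Sigma>)" by (simp add: \<gamma>_def)
      show "R 0 = 0" by (simp add: R_def)
      show "(R has_real_derivative 1 / 2 - K / 2) (at 0)"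
        unfolding R_def[abs_def] by (auto intro!: derivative_eq_intros)
      fix t :: real assume t: "\<bar>t\<bar> < 1"
      note ro = rank_one_update[OF S w t]
      show "\<gamma> t \<in> UNIV \<times> pd" using ro(1) by (simp add: \<gamma>_def)
      have "ln (det (\<Sigma> + t *\<^sub>R outer (\<Sigma> *v w))) - ln (det \<Sigma>) = ln (1 + t)"
        unfolding ro(2) using det_pd_pos[OF S] t by (subst ln_mult_pos) auto
      moreover have "(LINT y|P. U y * (inv_form (\<Sigma> + t *\<^sub>R outer (\<Sigma> *v w)) (y - \<mu>) - s y)) = - (t / (1 + t)) * K"
      proof -
        have "(LINT y|P. U y * (inv_form (\<Sigma> + t *\<^sub>R outer (\<Sigma> *v w)) (y - \<mu>) - s y))
          = (LINT y|P. - (t / (1 + t)) * (U y * (w \<bullet> (y - \<mu>))\<^sup>2))"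
          by (intro Bochner_Integration.integral_cong refl) (simp add: ro(3) s_def)
        also have "\<dots> = - (t / (1 + t)) * K" unfolding K_def by (rule integral_mult_right_zero)
        finally show ?thesis .
      qed
      ultimately show "?F (\<gamma> t) - ?F (\<mu>, \<Sigma>) \<le> R t"
        using upper[OF ro(1), of \<mu>] by (simp add: R_def \<gamma>_def)
    qed simp
    then show ?thesis by (simp add: K_def)
  qed
  have first: "(LINT y|P. U y * (p \<bullet> (y - \<mu>))) = 0" for p
  proof -
    \<comment> \<open>Moving \<open>\<mu>\<close> in the direction \<open>\<Sigma> p\<close> isolates the component of the first moment along \<open>p\<close>.\<close>
    define v where "v = \<Sigma> *v p"
    define K where "K = (LINT y|P. U y * (p \<bullet> (y - \<mu>)))"
    define C where "C = (v \<bullet> p) * (LINT y|P. U y)"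
    define \<gamma> where "\<gamma> t = (\<mu> + t *\<^sub>R v, \<Sigma>)" for t
    define R where "R t = - t * K + t\<^sup>2 * C / 2" for t
    have "- K = 0"
    proof (rule critical_point_upper_curve[OF crit, of \<gamma> "(v, 0)" 1 R])
      show "(\<gamma> has_vector_derivative (v, 0)) (at 0)"
        unfolding \<gamma>_def[abs_def] by (intro has_vector_derivative_Pair) (auto intro!: derivative_eq_intros)
      show "\<gamma> 0 = (\<mu>, \<Sigma>)" by (simp add: \<gamma>_def)
      show "R 0 = 0" by (simp add: R_def)
      show "(R has_real_derivative - K) (at 0)"
        unfolding R_def[abs_def] by (auto intro!: derivative_eq_intros)
      fix t :: real
      show "\<gamma> t \<in> UNIV \<times> pd" using S by (simp add: \<gamma>_def)
      have shift: "inv_form \<Sigma> (y - (\<mu> + t *\<^sub>R v)) - s y = - 2 * t * (p \<bullet> (y - \<mu>)) + t\<^sup>2 * (v \<bullet> p)" for y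
      proof -
        define x where "x = matrix_inv \<Sigma> *v (y - \<mu>)"
        have "\<Sigma> *v (x - t *\<^sub>R p) = y - (\<mu> + t *\<^sub>R v)"
          by (simp add: x_def v_def matrix_vector_mult_diff_distrib matrix_vector_mult_scaleR matrix_inv_pd[OF S])
        from inv_form_eqI[OF S this]
        have "inv_form \<Sigma> (y - (\<mu> + t *\<^sub>R v)) = ((y - \<mu>) - t *\<^sub>R v) \<bullet> (x - t *\<^sub>R p)"
          by (simp add: diff_diff_eq)
        also have "\<dots> = (y - \<mu>) \<bullet> x - t * ((y - \<mu>) \<bullet> p) - t * (v \<bullet> x) + t\<^sup>2 * (v \<bullet> p)"
          by (simp only: inner_diff_left inner_diff_right inner_scaleR_left inner_scaleR_right power2_eq_square)
            (simp add: algebra_simps)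
        also have "v \<bullet> x = p \<bullet> (y - \<mu>)"
          unfolding v_def dot_symmetric_matrix[OF pd_symmetric[OF S]] by (simp add: x_def matrix_inv_pd[OF S])
        also have "(y - \<mu>) \<bullet> p = p \<bullet> (y - \<mu>)" by (rule inner_commute)
        also have "(y - \<mu>) \<bullet> x = s y" by (simp add: s_def inv_form_def x_def)
        finally show ?thesis by simp
      qed
      have "(LINT y|P. U y * (inv_form \<Sigma> (y - (\<mu> + t *\<^sub>R v)) - s y))
          = (LINT y|P. - 2 * t * (U y * (p \<bullet> (y - \<mu>))) + t\<^sup>2 * (v \<bullet> p) * U y)"
        unfolding shift by (intro Bochner_Integration.integral_cong refl) (simp add: algebra_simps)
      also have "\<dots> = - 2 * t * K + t\<^sup>2 * (v \<bullet> p) * (LINT y|P. U y)"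
        unfolding K_def using iU iU1[of p]
        by (subst Bochner_Integration.integral_add) auto
      finally show "?F (\<gamma> t) - ?F (\<mu>, \<Sigma>) \<le> R t"
        using upper[OF S, of "\<mu> + t *\<^sub>R v"] by (simp add: R_def \<gamma>_def C_def)
    qed simp
    then show ?thesis by (simp add: K_def)
  qed
  have total: "(LINT y|P. U y) = 1"
  proof -
    obtain w where w: "orthonormal_wrt \<Sigma> w" using orthonormal_wrt_exists[OF S] .
    have "real CARD('n) = (\<Sum>i\<in>UNIV. (LINT y|P. U y * (w i \<bullet> (y - \<mu>))\<^sup>2))"
      using w second by (simp add: orthonormal_wrt_def)
    also have "\<dots> = (LINT y|P. (\<Sum>i\<in>UNIV. U y * (w i \<bullet> (y - \<mu>))\<^sup>2))"
      by (intro Bochner_Integration.integral_sum[symmetric] iU2)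
    also have "\<dots> = (LINT y|P. (\<nu> + real CARD('n)) - \<nu> * U y)"
      using u_mult_eq[OF \<nu>0 inv_form_nonneg[OF S], of "CARD('n)"]
      by (simp add: sum_distrib_left[symmetric] inv_form_orthonormal_wrt[OF w, symmetric] U_def s_def)
    also have "\<dots> = (\<nu> + real CARD('n)) - \<nu> * (LINT y|P. U y)"
      using iU by (subst Bochner_Integration.integral_diff) (auto simp: prob_space)
    finally show ?thesis using \<nu>0 by simp
  qed
  have second': "(LINT y|P. U y * (p \<bullet> (y - \<mu>))\<^sup>2) = p \<bullet> (\<Sigma> *v p)" for p
    by (rule second_moment_of_normalized[OF S second])
  show ?thesis
    unfolding scatter_eq_def
  proof (intro conjI allI A)
    fix z :: "real^('n option)"
    obtain p t where z0: "z = vcons p t" using vcons_exists by blast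
    define m where "m = \<mu> \<bullet> p + t"
    have z: "z = vcons p (m - \<mu> \<bullet> p)" by (simp add: z0 m_def)
    have "(LINT z'|?Q. u (\<nu> - 1) CARD('n option) (inv_form (A_of \<Sigma> \<mu> 1) z') * (z \<bullet> z')\<^sup>2)
      = (LINT y|P. U y * (p \<bullet> (y - \<mu>) + m)\<^sup>2)" unfolding z by (rule int_sq)
    also have "\<dots> = (LINT y|P. U y * (p \<bullet> (y - \<mu>))\<^sup>2 + 2 * m * (U y * (p \<bullet> (y - \<mu>))) + m\<^sup>2 * U y)"
      by (intro Bochner_Integration.integral_cong refl) (simp add: power2_eq_square algebra_simps)
    also have "\<dots> = (LINT y|P. U y * (p \<bullet> (y - \<mu>))\<^sup>2) + 2 * m * (LINT y|P. U y * (p \<bullet> (y - \<mu>))) + m\<^sup>2 * (LINT y|P. U y)"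
      using iU iU1[of p] iU2[of p] by (subst Bochner_Integration.integral_add | simp)+
    also have "\<dots> = p \<bullet> (\<Sigma> *v p) + m\<^sup>2" by (simp add: first second' total)
    also have "\<dots> = z \<bullet> (A_of \<Sigma> \<mu> 1 *v z)" unfolding z A_of_form by simp
    finally show "z \<bullet> (A_of \<Sigma> \<mu> 1 *v z)
      = (LINT y|?Q. u (\<nu> - 1) CARD('n option) (inv_form (A_of \<Sigma> \<mu> 1) y) * (z \<bullet> y)\<^sup>2)" ..
  qed
qed

lemma critical_point_iff_scatter_eq:
  fixes A :: "real^'n^'n"
  assumes "borel_prob Q" "\<nu> > 0"
  shows "critical_point_on (Qh \<nu> Q) pd A \<longleftrightarrow> scatter_eq \<nu> Q A"
  using critical_imp_scatter_eq scatter_eq_imp_critical assms by blast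

text \<open>
  Two different solutions would each have to be strictly better than the other.
\<close>

lemma A_crit_scatter_eq:
  fixes Q :: "(real^'n) measure"
  assumes Q: "Q \<in> \<U> (\<nu> + real CARD('n))" and \<nu>: "\<nu> > 0"
  shows "\<exists>!A. critical_point_on (Qh \<nu> Q) pd A" and "scatter_eq \<nu> Q (A_crit \<nu> Q)"
    and "\<And>B. B \<in> pd \<Longrightarrow> B \<noteq> A_crit \<nu> Q \<Longrightarrow> Qh \<nu> Q (A_crit \<nu> Q) < Qh \<nu> Q B"
proof -
  have bQ: "borel_prob Q" using Q by (simp add: \<U>_def)
  have a: "\<nu> + real CARD('n) > 0" using \<nu> by simp
  note hyp = \<U>_hyperplane[OF Q a]
  note iff = critical_point_iff_scatter_eq[OF bQ \<nu>]
  obtain A where A: "scatter_eq \<nu> Q A" using scatter_eq_exists[OF Q \<nu>] by blast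
  have uniq: "B = A" if B: "scatter_eq \<nu> Q B" for B
  proof (rule ccontr)
    assume ne: "B \<noteq> A"
    have "A \<in> pd" "B \<in> pd" using A B by (simp_all add: scatter_eq_def)
    then have "Qh \<nu> Q A < Qh \<nu> Q B" "Qh \<nu> Q B < Qh \<nu> Q A"
      using scatter_eq_imp_min(2)[OF bQ \<nu> A _ hyp] scatter_eq_imp_min(2)[OF bQ \<nu> B _ hyp] ne by blast+
    then show False by simp
  qed
  show ex1: "\<exists>!A. critical_point_on (Qh \<nu> Q) pd A" unfolding iff using A uniq by blast
  show eq: "scatter_eq \<nu> Q (A_crit \<nu> Q)"
    using theI'[OF ex1] unfolding A_crit_def iff .
  show "\<And>B. B \<in> pd \<Longrightarrow> B \<noteq> A_crit \<nu> Q \<Longrightarrow> Qh \<nu> Q (A_crit \<nu> Q) < Qh \<nu> Q B"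
    using scatter_eq_imp_min(2)[OF bQ \<nu> eq _ hyp] by blast
qed

lemma M_functional_A_of:
  fixes P :: "(real^'n) measure"
  assumes P: "borel_prob P" and \<nu>: "\<nu> > 1" and S: "\<Sigma> \<in> pd"
    and min: "\<And>B. B \<in> pd \<Longrightarrow> B \<noteq> A_of \<Sigma> \<mu> 1 \<Longrightarrow>
      Qh (\<nu> - 1) (distr P borel T1) (A_of \<Sigma> \<mu> 1) < Qh (\<nu> - 1) (distr P borel T1) B"
  shows "M_functional \<nu> P (\<mu>, \<Sigma>)"
  unfolding M_functional_def
proof (intro conjI ballI impI)
  show "(\<mu>, \<Sigma>) \<in> UNIV \<times> pd" using S by simp
  fix \<theta> :: "(real^'n) \<times> (real^'n^'n)" assume "\<theta> \<in> UNIV \<times> pd"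
  then obtain \<mu>' \<Sigma>' where \<theta>: "\<theta> = (\<mu>', \<Sigma>')" and S': "\<Sigma>' \<in> pd" by auto
  note i = integrable_h_ls[OF P \<nu> S', of \<mu>'] integrable_h_ls[OF P \<nu> S, of \<mu>]
  show "integral_defined_gt_minf P (\<lambda>y. h_ls \<nu> y \<theta>)"
    unfolding \<theta> integral_defined_gt_minf_def using i(1) unfolding real_integrable_def
    by (auto simp: less_top)
  assume "\<theta> \<noteq> (\<mu>, \<Sigma>)"
  then have "A_of \<Sigma>' \<mu>' 1 \<noteq> A_of \<Sigma> \<mu> 1" using A_of_inject \<theta> by blast
  from min[OF A_of_pd[OF S'] this]
  show "ext_integral P (\<lambda>y. h_ls \<nu> y (\<mu>, \<Sigma>)) < ext_integral P (\<lambda>y. h_ls \<nu> y \<theta>)"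
    unfolding \<theta> by (simp add: ext_integral_eq_lebesgue_integral i)
qed

theorem theorem6:
  shows
  "(\<forall>(\<nu>::real) (Q :: (real^'n) measure). \<nu> > 0 \<and> Q \<in> \<U> (\<nu> + real CARD('n)) \<longrightarrow>
      (\<forall>A \<in> pd. integrable Q (\<lambda>y. \<rho> \<nu> CARD('n) (inv_form A y) - \<rho> \<nu> CARD('n) (y \<bullet> y))) \<and>
      (\<exists>!A. critical_point_on (Qh \<nu> Q) pd A) \<and>
      (\<forall>B \<in> pd. Qh \<nu> Q (A_crit \<nu> Q) \<le> Qh \<nu> Q B))
   \<and>
   (\<forall>(\<nu>::real) (P :: (real^'n) measure). \<nu> > 1 \<and> borel_prob P \<longrightarrow>
      (let d = CARD('n); Q = distr P borel T1; \<nu>' = \<nu> - 1; A\<^sub>0 = A_crit \<nu>' Q in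
        (P \<in> \<V> (\<nu> + real d) \<longrightarrow>
           Q \<in> \<U> (\<nu> + real d) \<and>
           (\<exists>!A. critical_point_on (Qh \<nu>' Q) pd A) \<and>
           \<comment> \<open>(b)\<close>
           A\<^sub>0 $ None $ None = 1 \<and>
           integrable Q (\<lambda>z. u \<nu>' (d + 1) (inv_form A\<^sub>0 z)) \<and>
           (LINT z|Q. u \<nu>' (d + 1) (inv_form A\<^sub>0 z)) = 1 \<and>
           \<comment> \<open>(c)\<close>
           (\<forall>(\<mu> :: real^'n). \<forall>\<Sigma> \<in> pd. A_of \<Sigma> \<mu> 1 \<in> pd \<and>
              (\<forall>y. u \<nu>' (d + 1) (inv_form (A_of \<Sigma> \<mu> 1) (T1 y)) = u \<nu> d (inv_form \<Sigma> (y - \<mu>)))) \<and>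
           (\<exists>!(\<mu>, \<Sigma>). \<Sigma> \<in> pd \<and> A\<^sub>0 = A_of \<Sigma> \<mu> 1) \<and>
           (\<forall>\<mu>\<^sub>\<nu>. \<forall>\<Sigma>\<^sub>\<nu> \<in> pd. A\<^sub>0 = A_of \<Sigma>\<^sub>\<nu> \<mu>\<^sub>\<nu> 1 \<longrightarrow>
              (\<forall>y. u \<nu>' (d + 1) (inv_form A\<^sub>0 (T1 y)) = u \<nu> d (inv_form \<Sigma>\<^sub>\<nu> (y - \<mu>\<^sub>\<nu>))) \<and>
              \<comment> \<open>(d)\<close>
              integrable P (\<lambda>y. u \<nu> d (inv_form \<Sigma>\<^sub>\<nu> (y - \<mu>\<^sub>\<nu>))) \<and>
              (LINT y|P. u \<nu> d (inv_form \<Sigma>\<^sub>\<nu> (y - \<mu>\<^sub>\<nu>))) = 1 \<and>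
              \<comment> \<open>(e)\<close>
              M_functional \<nu> P (\<mu>\<^sub>\<nu>, \<Sigma>\<^sub>\<nu>))) \<and>
        \<comment> \<open>(f)\<close>
        (P \<notin> \<V> (\<nu> + real d) \<longrightarrow>
           (\<forall>\<theta> \<in> UNIV \<times> pd. integrable P (\<lambda>y. h_ls \<nu> y \<theta>)) \<and>
           \<not> (\<exists>\<theta>. critical_point_on (\<lambda>\<theta>. LINT y|P. h_ls \<nu> y \<theta>) (UNIV \<times> pd) \<theta>))))"
proof -
  have a: "(\<forall>A \<in> pd. integrable Q (\<lambda>y. \<rho> \<nu> CARD('n) (inv_form A y) - \<rho> \<nu> CARD('n) (y \<bullet> y))) \<and>
      (\<exists>!A. critical_point_on (Qh \<nu> Q) pd A) \<and> (\<forall>B \<in> pd. Qh \<nu> Q (A_crit \<nu> Q) \<le> Qh \<nu> Q B)"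
    if \<nu>: "\<nu> > 0" and Q: "Q \<in> \<U> (\<nu> + real CARD('n))" for \<nu> :: real and Q :: "(real^'n) measure"
  proof (intro conjI ballI)
    have bQ: "borel_prob Q" using Q by (simp add: \<U>_def)
    show "integrable Q (\<lambda>y. \<rho> \<nu> CARD('n) (inv_form A y) - \<rho> \<nu> CARD('n) (y \<bullet> y))" if "A \<in> pd" for A
      using integrable_\<rho>_diff[OF bQ \<nu> that mat_1_pd] by (simp add: inv_form_mat_1)
    show "\<exists>!A. critical_point_on (Qh \<nu> Q) pd A" by (rule A_crit_scatter_eq(1)[OF Q \<nu>])
    show "Qh \<nu> Q (A_crit \<nu> Q) \<le> Qh \<nu> Q B" if "B \<in> pd" for B
      using A_crit_scatter_eq(3)[OF Q \<nu> that] by (cases "B = A_crit \<nu> Q") (auto intro: less_imp_le)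
  qed
  have be: "Q \<in> \<U> (\<nu> + real CARD('n)) \<and>
           (\<exists>!A. critical_point_on (Qh (\<nu> - 1) Q) pd A) \<and>
           A\<^sub>0 $ None $ None = 1 \<and>
           integrable Q (\<lambda>z. u (\<nu> - 1) (CARD('n) + 1) (inv_form A\<^sub>0 z)) \<and>
           (LINT z|Q. u (\<nu> - 1) (CARD('n) + 1) (inv_form A\<^sub>0 z)) = 1 \<and>
           (\<forall>(\<mu> :: real^'n). \<forall>\<Sigma> \<in> pd. A_of \<Sigma> \<mu> 1 \<in> pd \<and>
              (\<forall>y. u (\<nu> - 1) (CARD('n) + 1) (inv_form (A_of \<Sigma> \<mu> 1) (T1 y)) = u \<nu> CARD('n) (inv_form \<Sigma> (y - \<mu>)))) \<and>
           (\<exists>!(\<mu>, \<Sigma>). \<Sigma> \<in> pd \<and> A\<^sub>0 = A_of \<Sigma> \<mu> 1) \<and>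
           (\<forall>\<mu>\<^sub>\<nu>. \<forall>\<Sigma>\<^sub>\<nu> \<in> pd. A\<^sub>0 = A_of \<Sigma>\<^sub>\<nu> \<mu>\<^sub>\<nu> 1 \<longrightarrow>
              (\<forall>y. u (\<nu> - 1) (CARD('n) + 1) (inv_form A\<^sub>0 (T1 y)) = u \<nu> CARD('n) (inv_form \<Sigma>\<^sub>\<nu> (y - \<mu>\<^sub>\<nu>))) \<and>
              integrable P (\<lambda>y. u \<nu> CARD('n) (inv_form \<Sigma>\<^sub>\<nu> (y - \<mu>\<^sub>\<nu>))) \<and>
              (LINT y|P. u \<nu> CARD('n) (inv_form \<Sigma>\<^sub>\<nu> (y - \<mu>\<^sub>\<nu>))) = 1 \<and>
              M_functional \<nu> P (\<mu>\<^sub>\<nu>, \<Sigma>\<^sub>\<nu>))"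
    if \<nu>: "\<nu> > 1" and P: "borel_prob P" and V: "P \<in> \<V> (\<nu> + real CARD('n))"
      and Q_def: "Q = distr P borel T1" and A0_def: "A\<^sub>0 = A_crit (\<nu> - 1) Q"
    for \<nu> :: real and P :: "(real^'n) measure" and Q A\<^sub>0
  proof -
    have \<nu>': "\<nu> - 1 > 0" using \<nu> by simp
    have bQ: "borel_prob Q" unfolding Q_def by (rule borel_prob_distr_T1[OF P])
    have QU: "Q \<in> \<U> (\<nu> + real CARD('n))"
      unfolding Q_def using V distr_T1_in_\<U>_iff[OF P, of "\<nu> + real CARD('n)"] \<nu> by simp
    then have QU': "Q \<in> \<U> (\<nu> - 1 + real CARD('n option))" by (simp add: add.commute)
    note crit = A_crit_scatter_eq[OF QU' \<nu>', folded A0_def]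
    have A0: "A\<^sub>0 \<in> pd" using crit(2) by (simp add: scatter_eq_def)
    have um: "(\<lambda>z. u (\<nu> - 1) (CARD('n) + 1) (inv_form A\<^sub>0 z)) \<in> borel_measurable borel" by measurable
    have iw: "integrable Q (\<lambda>z. u (\<nu> - 1) (CARD('n) + 1) (inv_form A\<^sub>0 z))"
      by (rule integrable_weight[OF bQ \<nu>' A0])
    have one: "(LINT z|Q. u (\<nu> - 1) (CARD('n) + 1) (inv_form A\<^sub>0 z)) = 1"
      using scatter_eq_weight_integral[OF bQ \<nu>' crit(2)] by simp
    have A01: "A\<^sub>0 $ None $ None = 1"
    proof -
      have m: "(\<lambda>z. u (\<nu> - 1) CARD('n option) (inv_form A\<^sub>0 z) * (vcons 0 1 \<bullet> z)\<^sup>2) \<in> borel_measurable borel"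
        by measurable
      have ax: "vcons (0 :: real^'n) 1 = axis None 1"
        by (simp add: vec_eq_iff vcons_def axis_def split: option.split)
      have "A\<^sub>0 $ None $ None = vcons 0 1 \<bullet> (A\<^sub>0 *v vcons 0 1)"
        by (simp add: ax inner_axis' matrix_vector_mult_basis column_def)
      also have "\<dots> = (LINT z|Q. u (\<nu> - 1) CARD('n option) (inv_form A\<^sub>0 z) * (vcons 0 1 \<bullet> z)\<^sup>2)"
        using crit(2) by (simp add: scatter_eq_def)
      also have "\<dots> = (LINT z|Q. u (\<nu> - 1) (CARD('n) + 1) (inv_form A\<^sub>0 z))"
        unfolding Q_def integral_distr_T1(1)[OF P m] integral_distr_T1(1)[OF P um]
        by (simp add: T1_eq_vcons inner_vcons)
      finally show ?thesis using one by simp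
    qed
    have ex1: "\<exists>!(\<mu>, \<Sigma>). \<Sigma> \<in> pd \<and> A\<^sub>0 = A_of \<Sigma> \<mu> 1"
    proof -
      obtain \<mu> \<Sigma> where S: "\<Sigma> \<in> pd" "A\<^sub>0 = A_of \<Sigma> \<mu> 1" using A_of_surj[OF A0 A01] by blast
      have "\<mu>' = \<mu> \<and> \<Sigma>' = \<Sigma>" if "A\<^sub>0 = A_of \<Sigma>' \<mu>' 1" for \<mu>' \<Sigma>'
        using A_of_inject[OF trans[OF that[symmetric] S(2)]] by simp
      then show ?thesis using S(1) by (intro ex1I[of _ "(\<mu>, \<Sigma>)"]) (auto simp: S(2)[symmetric])
    qed
    have last: "(\<forall>y. u (\<nu> - 1) (CARD('n) + 1) (inv_form A\<^sub>0 (T1 y)) = u \<nu> CARD('n) (inv_form \<Sigma> (y - \<mu>))) \<and>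
              integrable P (\<lambda>y. u \<nu> CARD('n) (inv_form \<Sigma> (y - \<mu>))) \<and>
              (LINT y|P. u \<nu> CARD('n) (inv_form \<Sigma> (y - \<mu>))) = 1 \<and>
              M_functional \<nu> P (\<mu>, \<Sigma>)" if S: "\<Sigma> \<in> pd" and eq: "A\<^sub>0 = A_of \<Sigma> \<mu> 1" for \<mu> \<Sigma>
    proof (intro conjI allI)
      show c: "u (\<nu> - 1) (CARD('n) + 1) (inv_form A\<^sub>0 (T1 y)) = u \<nu> CARD('n) (inv_form \<Sigma> (y - \<mu>))" for y
        unfolding eq by (rule u_A_of[OF S])
      show "integrable P (\<lambda>y. u \<nu> CARD('n) (inv_form \<Sigma> (y - \<mu>)))"
        using iw unfolding Q_def integral_distr_T1(2)[OF P um] c .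
      show "(LINT y|P. u \<nu> CARD('n) (inv_form \<Sigma> (y - \<mu>))) = 1"
        using one unfolding Q_def integral_distr_T1(1)[OF P um] c .
      show "M_functional \<nu> P (\<mu>, \<Sigma>)"
        using crit(3) unfolding eq Q_def by (intro M_functional_A_of P \<nu> S)
    qed
    have lift: "\<forall>(\<mu> :: real^'n). \<forall>\<Sigma> \<in> pd. A_of \<Sigma> \<mu> 1 \<in> pd \<and>
        (\<forall>y. u (\<nu> - 1) (CARD('n) + 1) (inv_form (A_of \<Sigma> \<mu> 1) (T1 y)) = u \<nu> CARD('n) (inv_form \<Sigma> (y - \<mu>)))"
      using A_of_pd u_A_of by blast
    show ?thesis
      by (intro conjI QU crit(1) A01 iw one lift ex1) (intro allI ballI impI last)
  qed
  have f: "(\<forall>\<theta> \<in> UNIV \<times> pd. integrable P (\<lambda>y. h_ls \<nu> y \<theta>)) \<and>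
           \<not> (\<exists>\<theta>. critical_point_on (\<lambda>\<theta>. LINT y|P. h_ls \<nu> y \<theta>) (UNIV \<times> pd) \<theta>)"
    if \<nu>: "\<nu> > 1" and P: "borel_prob P" and V: "P \<notin> \<V> (\<nu> + real CARD('n))"
    for \<nu> :: real and P :: "(real^'n) measure"
  proof (intro conjI ballI notI)
    show "integrable P (\<lambda>y. h_ls \<nu> y \<theta>)" if "\<theta> \<in> UNIV \<times> pd" for \<theta>
      using that integrable_h_ls(1)[OF P \<nu>] by (cases \<theta>) auto
    assume "\<exists>\<theta>. critical_point_on (\<lambda>\<theta>. LINT y|P. h_ls \<nu> y \<theta>) (UNIV \<times> pd) \<theta>"
    then obtain \<mu> \<Sigma> where "critical_point_on (\<lambda>\<theta>. LINT y|P. h_ls \<nu> y \<theta>) (UNIV \<times> pd) (\<mu>, \<Sigma>)"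
      by auto
    then have "scatter_eq (\<nu> - 1) (distr P borel T1) (A_of \<Sigma> \<mu> 1)"
      by (rule location_scatter_critical_imp_scatter_eq[OF P \<nu>])
    then have "distr P borel T1 \<in> \<U> (\<nu> - 1 + real CARD('n option))"
      by (intro scatter_eq_imp_\<U> borel_prob_distr_T1[OF P]) (use \<nu> in auto)
    then have "distr P borel T1 \<in> \<U> (\<nu> + real CARD('n))" by (simp add: add.commute)
    then show False
      using V distr_T1_in_\<U>_iff[OF P, of "\<nu> + real CARD('n)"] \<nu> by simp
  qed
  show ?thesis
    unfolding Let_def
  proof (rule conjI, goal_cases)
    case 1
    show ?case by (intro allI impI, elim conjE, rule a)
  next
    case 2
    show ?case
    proof (intro allI impI, elim conjE, rule conjI, goal_cases)
      case (1 \<nu> P)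
      then show ?case by (intro impI be[OF _ _ _ refl refl])
    next
      case (2 \<nu> P)
      then show ?case by (intro impI f)
    qed
  qed
qed

end
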